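(* Let $p$ be a prime. The map $$\beta:\mathrm{Val}_p(\mathbb Q^{\rm cyc})\to\mathrm{Hom}(\mathbb Q^{{\rm cyc},p}_{\mathrm{Fr}},\mathbb Q_p),\qquad \beta(v)=\beta_v:\mathbb Q^{{\rm cyc},p}_{\mathrm{Fr}}\subset\mathbb Q_p,$$ determines a canonical and equivariant isomorphism of sets (bijection).
   Context: $\mathbb Q^{\rm cyc}$ is the field generated over $\mathbb Q$ by all (abstract) roots of unity; $\mathbb Q^{{\rm cyc},p}\subset\mathbb Q^{\rm cyc}$ is the subfield generated by the group $\mu^{(p)}$ of roots of unity of order prime to $p$; $\mathrm{Fr}\in\mathrm{Aut}(\mathbb Q^{{\rm cyc},p})$ is the unique automorphism acting by $x\mapsto x^p$ on $\mu^{(p)}$, and $\mathbb Q^{{\rm cyc},p}_{\mathrm{Fr}}$ is its fixed subfield. $\mathrm{Val}_p(\mathbb Q^{\rm cyc})$ is the set of extensions of the $p$-adic valuation of $\mathbb Q$ to $\mathbb Q^{\rm cyc}$. $\mathrm{Hom}$ denotes field homomorphisms. For $v\in\mathrm{Val}_p(\mathbb Q^{\rm cyc})$, let $(\mathbb Q^{\rm cyc})_v$ be the completion; it contains $\mathbb Q_p$ (the closure of $\mathbb Q$). The intersection $\mathbb Q^{\rm cyc}\cap\mathbb Q_p$ inside $(\mathbb Q^{\rm cyc})_v$ is equal to $\mathbb Q^{{\rm cyc},p}_{\mathrm{Fr}}$ for every $v$, and $\beta_v$ is the resulting inclusion $\mathbb Q^{{\rm cyc},p}_{\mathrm{Fr}}\to\mathbb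 Q_p$ (which depends on $v$). Equivariance is with respect to $G_p=\mathrm{Gal}(\mathbb Q^{{\rm cyc},p}:\mathbb Q)\simeq\prod_{\ell\neq p}\mathbb Z_\ell^*$ (more precisely its quotient by the closed subgroup $f_p^{\hat{\mathbb Z}}$ generated by $\mathrm{Fr}$), acting on $\mathrm{Hom}(\mathbb Q^{{\rm cyc},p}_{\mathrm{Fr}},\mathbb Q_p)$ by $\beta\mapsto\beta\circ\gamma$ and on $\mathrm{Val}_p(\mathbb Q^{\rm cyc})$ by composing valuations with $\gamma$, $\gamma\in G_p\subset\mathrm{Gal}(\mathbb Q^{\rm cyc}:\mathbb Q)=\mathbb Z_p^*\times G_p$. *)

theory Defs
  imports
    "HOL-Analysis.Function_Topology"
    "HOL-Library.Extended_Real"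
    "HOL-Algebra.Algebraic_Closure_Type"
    "HOL-Algebra.Generated_Fields"
    "HOL-Algebra.Group_Action"
    "HOL-Algebra.QuotRing"
begin

section \<open>Cyclotomic fields\<close>

text \<open>
  The roots of unity are realised inside the complex numbers, which only serve as an
  algebraically closed field of characteristic zero: no topology or absolute value on
  them is ever used.
\<close>

definition roots_of_unity :: "complex set" where
  "roots_of_unity = {z. \<exists>n>0. z ^ n = 1}"

definition roots_prime_to :: "nat \<Rightarrow> complex set" where
  "roots_prime_to p = {z. \<exists>n>0. coprime n p \<and> z ^ n = 1}"

definition roots_p_power :: "nat \<Rightarrow> complex set" where
  "roots_p_power p = {z. \<exists>k. z ^ (p ^ k) = 1}"

definition Qcyc :: "complex set" where
  "Qcyc = generate_field ring_of_type_algebra roots_of_unity"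

definition Qcyc_prime_to :: "nat \<Rightarrow> complex set" where
  "Qcyc_prime_to p = generate_field ring_of_type_algebra (roots_prime_to p)"

abbreviation subring_of :: "'a::field set \<Rightarrow> 'a ring" where
  "subring_of K \<equiv> ring_of_type_algebra\<lparr>carrier := K\<rparr>"


section \<open>Galois groups and the Frobenius\<close>

text \<open>Automorphisms are extensional functions, so that equality is equality on the field.\<close>

definition gal :: "complex set \<Rightarrow> complex set \<Rightarrow> (complex \<Rightarrow> complex) set" where
  "gal L K = {\<sigma> \<in> ring_hom (subring_of L) (subring_of L) \<inter> Bij L. \<forall>x\<in>K. \<sigma> x = x}"

definition Gal :: "complex set \<Rightarrow> complex set \<Rightarrow> (complex \<Rightarrow> complex) monoid" where
  "Gal L K = BijGroup L\<lparr>carrier := gal L K\<rparr>"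

abbreviation G_p :: "nat \<Rightarrow> (complex \<Rightarrow> complex) monoid" where
  "G_p p \<equiv> Gal (Qcyc_prime_to p) \<rat>"

definition Fr :: "nat \<Rightarrow> complex \<Rightarrow> complex" where
  "Fr p = (THE \<sigma>. \<sigma> \<in> carrier (G_p p) \<and> (\<forall>z\<in>roots_prime_to p. \<sigma> z = z ^ p))"

definition Fr_fixed :: "nat \<Rightarrow> complex set" where
  "Fr_fixed p = {x \<in> Qcyc_prime_to p. Fr p x = x}"

text \<open>Pointwise convergence for the discrete topology on \<open>L\<close> is the Krull topology.\<close>

definition krull_topology :: "complex set \<Rightarrow> complex set \<Rightarrow> (complex \<Rightarrow> complex) topology" where
  "krull_topology L K = subtopology (product_topology (\<lambda>_. discrete_topology L) L) (gal L K)"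

definition Fr_closed_subgroup :: "nat \<Rightarrow> (complex \<Rightarrow> complex) set" where
  "Fr_closed_subgroup p =
     krull_topology (Qcyc_prime_to p) \<rat> closure_of generate (G_p p) {Fr p}"

text \<open>
  The inclusion of \<open>G_p\<close> as the second factor of the decomposition of the Galois group of
  \<open>Qcyc\<close> as the product of the p-adic units and \<open>G_p\<close>: the lifted automorphism is trivial on
  the roots of unity of p-power order.
\<close>

definition lift_gal :: "nat \<Rightarrow> (complex \<Rightarrow> complex) \<Rightarrow> complex \<Rightarrow> complex" where
  "lift_gal p \<gamma> = (THE \<sigma>. \<sigma> \<in> carrier (Gal Qcyc \<rat>) \<and>
     (\<forall>x\<in>Qcyc_prime_to p. \<sigma> x = \<gamma> x) \<and> (\<forall>z\<in>roots_p_power p. \<sigma> z = z))"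


section \<open>Valuations and completions\<close>

definition real_valuation :: "'a::field set \<Rightarrow> ('a \<Rightarrow> ereal) \<Rightarrow> bool" where
  "real_valuation K v \<longleftrightarrow>
     (\<forall>x\<in>K. v x \<noteq> -\<infinity> \<and> (v x = \<infinity> \<longleftrightarrow> x = 0)) \<and>
     (\<forall>x\<in>K. \<forall>y\<in>K. v (x * y) = v x + v y) \<and>
     (\<forall>x\<in>K. \<forall>y\<in>K. min (v x) (v y) \<le> v (x + y))"

definition padic_val :: "nat \<Rightarrow> rat \<Rightarrow> ereal" where
  "padic_val p q = (if q = 0 then \<infinity> else
     ereal (real (multiplicity (int p) (fst (quotient_of q))) -
            real (multiplicity (int p) (snd (quotient_of q)))))"

definition Val_p :: "nat \<Rightarrow> (complex \<Rightarrow> ereal) set" where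
  "Val_p p = {v \<in> extensional Qcyc. real_valuation Qcyc v \<and> (\<forall>q. v (of_rat q) = padic_val p q)}"

text \<open>The completion is the ring of Cauchy sequences modulo the ideal of null sequences.\<close>

definition cauchy_seqs :: "'a::field set \<Rightarrow> ('a \<Rightarrow> ereal) \<Rightarrow> (nat \<Rightarrow> 'a) set" where
  "cauchy_seqs K v = {s. range s \<subseteq> K \<and>
     (\<forall>C::real. \<exists>N. \<forall>m\<ge>N. \<forall>n\<ge>N. ereal C < v (s m - s n))}"

definition null_seqs :: "'a::field set \<Rightarrow> ('a \<Rightarrow> ereal) \<Rightarrow> (nat \<Rightarrow> 'a) set" where
  "null_seqs K v = {s \<in> cauchy_seqs K v. (\<lambda>n. v (s n)) \<longlonglongrightarrow> \<infinity>}"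

definition cauchy_ring :: "'a::field set \<Rightarrow> ('a \<Rightarrow> ereal) \<Rightarrow> (nat \<Rightarrow> 'a) ring" where
  "cauchy_ring K v =
     \<lparr>carrier = cauchy_seqs K v, monoid.mult = (\<lambda>s t n. s n * t n), one = (\<lambda>_. 1),
      ring.zero = (\<lambda>_. 0), add = (\<lambda>s t n. s n + t n)\<rparr>"

definition completion :: "'a::field set \<Rightarrow> ('a \<Rightarrow> ereal) \<Rightarrow> (nat \<Rightarrow> 'a) set ring" where
  "completion K v = cauchy_ring K v Quot null_seqs K v"

definition seq_class :: "'a::field set \<Rightarrow> ('a \<Rightarrow> ereal) \<Rightarrow> (nat \<Rightarrow> 'a) \<Rightarrow> (nat \<Rightarrow> 'a) set" where
  "seq_class K v s = null_seqs K v +>\<^bsub>cauchy_ring K v\<^esub> s"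

definition Qp :: "nat \<Rightarrow> (nat \<Rightarrow> rat) set ring" where
  "Qp p = completion UNIV (padic_val p)"

definition Qcyc_to_completion :: "(complex \<Rightarrow> ereal) \<Rightarrow> complex \<Rightarrow> (nat \<Rightarrow> complex) set" where
  "Qcyc_to_completion v x = seq_class Qcyc v (\<lambda>_. x)"

text \<open>
  The canonical map from \<open>Qp p\<close> to the completion of \<open>Qcyc\<close> at a valuation \<open>v\<close> extending the
  p-adic one; its image is the closure of the rationals. A class of rational sequences is
  sent to the class of any of its members.
\<close>

definition Qp_to_completion ::
    "(complex \<Rightarrow> ereal) \<Rightarrow> (nat \<Rightarrow> rat) set \<Rightarrow> (nat \<Rightarrow> complex) set" where
  "Qp_to_completion v c = the_elem ((\<lambda>s. seq_class Qcyc v (\<lambda>n. of_rat (s n))) ` c)"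


section \<open>The map and the actions\<close>

definition Hom_Qp :: "nat \<Rightarrow> (complex \<Rightarrow> (nat \<Rightarrow> rat) set) set" where
  "Hom_Qp p = ring_hom (subring_of (Fr_fixed p)) (Qp p) \<inter> extensional (Fr_fixed p)"

text \<open>
  \<open>\<beta>_map p v\<close> sends \<open>x\<close> to the element of \<open>Qp p\<close> that coincides with \<open>x\<close> inside the completion
  of \<open>Qcyc\<close> at \<open>v\<close>.
\<close>

definition \<beta>_map :: "nat \<Rightarrow> (complex \<Rightarrow> ereal) \<Rightarrow> complex \<Rightarrow> (nat \<Rightarrow> rat) set" where
  "\<beta>_map p v = (\<lambda>x\<in>Fr_fixed p.
     THE y. y \<in> carrier (Qp p) \<and> Qp_to_completion v y = Qcyc_to_completion v x)"

text \<open>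
  Both actions are by precomposition; they are homomorphisms, rather than
  antihomomorphisms, because \<open>G_p\<close> is commutative.
\<close>

definition act_Val ::
    "nat \<Rightarrow> (complex \<Rightarrow> complex) \<Rightarrow> (complex \<Rightarrow> ereal) \<Rightarrow> complex \<Rightarrow> ereal" where
  "act_Val p \<gamma> = (\<lambda>v\<in>Val_p p. compose Qcyc v (lift_gal p \<gamma>))"

definition act_Hom ::
    "nat \<Rightarrow> (complex \<Rightarrow> complex) \<Rightarrow> (complex \<Rightarrow> (nat \<Rightarrow> rat) set) \<Rightarrow> complex \<Rightarrow> (nat \<Rightarrow> rat) set" where
  "act_Hom p \<gamma> = (\<lambda>b\<in>Hom_Qp p. compose (Fr_fixed p) b \<gamma>)"

end

theory Submission
  imports
    Defs
    "HOL-Number_Theory.Number_Theory"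
    "HOL-Computational_Algebra.Polynomial_Factorial"
    "HOL-Analysis.Extended_Real_Limits"
    "Jordan_Normal_Form.Char_Poly"
begin

text \<open>
  Write \<open>L\<close> for the cyclotomic field, \<open>K\<close> for its prime-to-\<open>p\<close> part and \<open>F\<close> for the fixed field of the
  Frobenius. Conjugacy of the powers of a root of unity turns compatible exponents into automorphisms
  of \<open>L\<close>: a lift \<open>tau\<close> of the Frobenius that fixes the \<open>p\<close>-power roots, and automorphisms \<open>sig c\<close>
  that raise the \<open>p\<close>-power roots to the power \<open>c\<close> and fix \<open>K\<close>; together they cut out \<open>F\<close>.

  Let \<open>\<pi>\<close> be \<open>1\<close> minus a root of unity of order \<open>p\<^sup>k\<close>. A cyclotomic integer \<open>c\<close> of level \<open>k\<close> satisfies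
  \<open>c\<^sup>q \<equiv> c\<close> modulo \<open>\<pi>\<close> for some power \<open>q\<close> of \<open>p\<close>, so \<open>d = 1 - c\<^bsup>q-1\<^esup>\<close> satisfies \<open>d c \<equiv> 0\<close>, while
  \<open>d\<close> is a unit at any valuation that is positive on \<open>c\<close>. Hence an element of nonnegative
  valuation is a quotient of cyclotomic integers whose denominator has valuation \<open>0\<close>. Modulo \<open>\<pi>\<close> the
  map \<open>tau\<close> is the \<open>p\<close>-th power and \<open>sig c\<close> is the identity, so they preserve every valuation above
  \<open>p\<close>, which is therefore determined by its restriction to \<open>F\<close> through the norm. Conversely the norm
  extends a valuation of \<open>F\<close> to \<open>L\<close>: the ultrametric inequality follows from the same quotient
  representation, because \<open>c\<^bsup>q-1\<^esup>\<close> is idempotent modulo \<open>\<pi>\<close> and thus congruent to its norm. Finally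
  an integral element of \<open>F\<close> is a root of \<open>X\<^sup>p - X\<close> modulo the maximal ideal, hence congruent to an
  integer, so the rationals are dense in \<open>F\<close>; a homomorphism to the \<open>p\<close>-adic numbers is thus the same as
  a valuation of \<open>F\<close> above \<open>p\<close>.
\<close>

section \<open>Conjugates of roots of unity\<close>


text \<open>The arithmetic fact behind the theorem is that \<open>F\<close> is the decomposition
  field of every valuation above \<open>p\<close>. The Galois group is abelian, so all these
  valuations share one decomposition group, topologically generated by \<open>tau\<close> and the
  \<open>sig c\<close>, and the completion of its fixed field is the field of p-adic numbers. The
  obstacle is that \<open>p\<close> may split: several primes of a cyclotomic ring contain \<pi>, so
  an element of positive valuation can be a unit at another prime and then is not divisible by
  \<pi>. Modulo \<pi> the power \<open>c^(q-1)\<close> is 0 at the primes containing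
  \<open>c\<close> and 1 at the others. Hence \<open>d\<close> is supported at the primes containing
  \<open>c\<close>; multiplying by it forces divisibility by \<pi> and leaves the chosen valuation
  unchanged. As some power of \<pi> is a multiple of \<open>p\<close>, repetition removes powers of
  \<open>p\<close> from denominators. When a valuation is built from the norm, multiplicativity is
  immediate but the ultrametric inequality is not. The division argument is therefore formulated for
  a merely multiplicative function, so that it can serve to prove that inequality.\<close>

abbreviation ipoly :: "int poly \<Rightarrow> complex \<Rightarrow> complex" where
  "ipoly P z \<equiv> poly (map_poly of_int P) z"

lemma ipoly_sum: "ipoly P z = (\<Sum>i\<le>degree P. of_int (coeff P i) * z ^ i)"
  by (simp add: poly_altdef)

lemma power_mod_eq:
  fixes z :: "'a::monoid_mult"
  assumes "z ^ N = 1"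
  shows "z ^ (m mod N) = z ^ m"
proof -
  have "z ^ m = z ^ (N * (m div N) + m mod N)" by simp
  also have "\<dots> = z ^ (m mod N)" by (simp only: power_add power_mult assms power_one) simp
  finally show ?thesis by simp
qed

text \<open>The element is an eigenvalue of the integer matrix describing multiplication by it on
  \<open>1, z, \<dots>, z ^ (N - 1)\<close>.\<close>

lemma algebraic_int_ipoly_root_of_unity:
  assumes "z ^ N = 1" "N > 0"
  shows "algebraic_int (ipoly P z)"
proof -
  define B :: "int mat" where
    "B = mat N N (\<lambda>(i,j). \<Sum>k | k \<le> degree P \<and> (i + k) mod N = j. coeff P k)"
  define A :: "complex mat" where "A = map_mat of_int B"
  define w where "w = vec N (\<lambda>i. z ^ i)"
  have B: "B \<in> carrier_mat N N" and A: "A \<in> carrier_mat N N" by (auto simp: B_def A_def)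
  have "A *\<^sub>v w = ipoly P z \<cdot>\<^sub>v w"
  proof (rule eq_vecI)
    fix i assume "i < dim_vec (ipoly P z \<cdot>\<^sub>v w)"
    hence i: "i < N" by (simp add: w_def)
    have "(A *\<^sub>v w) $ i = (\<Sum>j<N. A $$ (i,j) * z ^ j)"
      using i A by (auto simp: scalar_prod_def w_def atLeast0LessThan intro!: sum.cong)
    also have "\<dots> = (\<Sum>j<N. \<Sum>k | k \<le> degree P \<and> (i + k) mod N = j. of_int (coeff P k) * z ^ j)"
      using i by (auto simp: A_def B_def sum_distrib_right intro!: sum.cong)
    also have "\<dots> = (\<Sum>j<N. \<Sum>k | k \<in> {..degree P} \<and> (i + k) mod N = j. of_int (coeff P k) * z ^ (i + k))"
      by (intro sum.cong refl) (auto simp: power_mod_eq[OF assms(1)])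
    also have "\<dots> = (\<Sum>k\<le>degree P. of_int (coeff P k) * z ^ (i + k))"
      using assms(2) by (intro sum.group) auto
    also have "\<dots> = ipoly P z * z ^ i"
      unfolding ipoly_sum by (simp add: sum_distrib_left power_add mult_ac)
    finally show "(A *\<^sub>v w) $ i = (ipoly P z \<cdot>\<^sub>v w) $ i" using i by (simp add: w_def)
  qed (use A in \<open>auto simp: w_def\<close>)
  moreover have "w \<noteq> 0\<^sub>v N"
  proof
    assume "w = 0\<^sub>v N"
    hence "w $ 0 = 0" using assms(2) by simp
    thus False using assms(2) by (simp add: w_def)
  qed
  ultimately have "eigenvalue A (ipoly P z)"
    using A by (auto simp: eigenvalue_def eigenvector_def w_def intro!: exI[of _ w])
  hence "poly (char_poly A) (ipoly P z) = 0" using eigenvalue_root_char_poly[OF A] by simp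
  moreover have "char_poly A = map_poly of_int (char_poly B)"
    unfolding A_def by (rule of_int_hom.char_poly_hom[OF B])
  moreover have "lead_coeff (char_poly B) = 1" using degree_monic_char_poly[OF B] by simp
  ultimately show ?thesis by (auto simp: algebraic_int_altdef_ipoly)
qed

text \<open>An annihilating polynomial of least degree is made primitive. Pseudo-division leaves a
  remainder of smaller degree that also vanishes at \<open>z\<close>, hence is 0; so
  \<open>m\<close> divides \<open>P\<close> over the field of fractions, and Gauss's lemma brings
  the divisibility back to the integers.\<close>

lemma int_minimal_poly:
  fixes z :: complex
  assumes "P0 \<noteq> 0" "ipoly P0 z = 0"
  obtains m where "m \<noteq> 0" "ipoly m z = 0" "\<And>P. ipoly P z = 0 \<Longrightarrow> m dvd P"
proof -
  define S where "S = {P. P \<noteq> 0 \<and> ipoly P z = 0}"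
  have "P0 \<in> S" using assms by (simp add: S_def)
  then obtain m0 where m0: "m0 \<in> S" and min: "\<And>P. P \<in> S \<Longrightarrow> degree m0 \<le> degree P"
    using ex_has_least_nat[of "\<lambda>P. P \<in> S" P0 degree] by blast
  define m where "m = primitive_part m0"
  have "m0 = smult (content m0) m" by (simp add: m_def)
  hence "ipoly m0 z = of_int (content m0) * ipoly m z"
    by (metis of_int_hom.map_poly_hom_smult poly_smult)
  with m0 have m_root: "ipoly m z = 0" and m_nz: "m \<noteq> 0"
    by (auto simp: S_def m_def)
  have cont: "content m = 1" using m_nz by (simp add: m_def)
  have min: "degree m \<le> degree P" if "P \<in> S" for P using min[OF that] by (simp add: m_def)
  have "m dvd P" if P: "ipoly P z = 0" for P
  proof -
    obtain a q where aq: "a \<noteq> 0" "smult a P = m * q + pseudo_mod P m"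
      and deg: "pseudo_mod P m = 0 \<or> degree (pseudo_mod P m) < degree m"
      using pseudo_mod[OF m_nz, of P] by auto
    have "ipoly (smult a P) z = ipoly m z * ipoly q z + ipoly (pseudo_mod P m) z"
      unfolding aq(2) by (simp add: hom_distribs)
    hence "ipoly (pseudo_mod P m) z = 0" using P m_root by (simp add: hom_distribs)
    hence "pseudo_mod P m = 0" using deg min[of "pseudo_mod P m"] by (fastforce simp: S_def)
    hence "m dvd smult a P" using aq(2) by simp
    hence "fract_poly m dvd smult (to_fract a) (fract_poly P)"
      using fract_poly_dvd[of m "smult a P"] by simp
    hence "fract_poly m dvd fract_poly P" using aq(1) by (simp add: dvd_smult_iff)
    thus ?thesis using fract_poly_dvdD cont by blast
  qed
  thus ?thesis using that m_nz m_root by blast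
qed

text \<open>Over the field with \<open>q\<close> elements the \<open>q\<close>-th power is additive
  and fixes constants. The induction splits off the constant coefficient: \<open>binom\<close> is
  the additivity, and Fermat's little theorem handles the constant.\<close>

lemma ipoly_power_prime:
  assumes "prime q"
  shows "\<exists>Q. P ^ q - pcompose P (monom 1 q) = smult (int q) Q"
proof (induction P)
  case 0
  have "q > 0" using assms by (simp add: prime_gt_0_nat)
  thus ?case by (intro exI[of _ 0]) (simp add: power_0_left)
next
  case (pCons a P)
  have q0: "q > 0" using assms by (simp add: prime_gt_0_nat)
  from pCons obtain Q where Q: "P ^ q - pcompose P (monom 1 q) = smult (int q) Q" by blast
  have binom: "\<exists>R. (x + y) ^ q - x ^ q - y ^ q = smult (int q) R" for x y :: "int poly"
  proof -
    have "(x + y) ^ q = (\<Sum>k\<le>q. of_nat (q choose k) * x ^ k * y ^ (q - k))"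
      by (rule binomial_ring)
    also have "{..q} = insert 0 (insert q {0<..<q})" using q0 by auto
    also have "(\<Sum>k\<in>insert 0 (insert q {0<..<q}). of_nat (q choose k) * x ^ k * y ^ (q - k))
        = y ^ q + x ^ q + (\<Sum>k\<in>{0<..<q}. of_nat (q choose k) * x ^ k * y ^ (q - k))"
      using q0 by simp
    also have "(\<Sum>k\<in>{0<..<q}. of_nat (q choose k) * x ^ k * y ^ (q - k))
        = (\<Sum>k\<in>{0<..<q}. smult (int q) (of_nat ((q choose k) div q) * x ^ k * y ^ (q - k)))"
    proof (rule sum.cong)
      fix k assume k: "k \<in> {0<..<q}"
      have "q dvd (q choose k)" using k assms by (intro dvd_choose_prime) auto
      hence "q choose k = q * ((q choose k) div q)" by simp
      hence "(of_nat (q choose k) :: int poly) = of_nat q * of_nat ((q choose k) div q)"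
        by (metis of_nat_mult)
      thus "of_nat (q choose k) * x ^ k * y ^ (q - k)
          = smult (int q) (of_nat ((q choose k) div q) * x ^ k * y ^ (q - k))"
        by (simp add: of_nat_poly mult.commute)
    qed simp
    finally have "(x + y) ^ q - x ^ q - y ^ q
        = smult (int q) (\<Sum>k\<in>{0<..<q}. of_nat ((q choose k) div q) * x ^ k * y ^ (q - k))"
      by (simp add: smult_sum2)
    thus ?thesis by blast
  qed
  have "[a ^ q = a] (mod int q)"
  proof -
    have "[nat (a mod int q) ^ q = nat (a mod int q)] (mod q)"
    proof (cases "q dvd nat (a mod int q)")
      case True
      hence "q dvd nat (a mod int q) ^ q" using q0 by (cases q) auto
        with True show ?thesis by (simp add: cong_def mod_0_imp_dvd)
    next
      case False
      have "[nat (a mod int q) ^ (q - 1) * nat (a mod int q) = 1 * nat (a mod int q)] (mod q)"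
        by (intro cong_mult fermat_theorem assms False cong_refl)
      thus ?thesis using q0 by (metis mult.left_neutral power_minus_mult)
    qed
    hence "[int (nat (a mod int q)) ^ q = int (nat (a mod int q))] (mod int q)"
      by (metis cong_int_iff of_nat_power)
    hence "[(a mod int q) ^ q = a mod int q] (mod int q)" using q0 by simp
    thus ?thesis by (simp add: cong_def power_mod)
  qed
  then obtain c where c: "a ^ q - a = int q * c"
    by (metis cong_iff_dvd_diff dvdE)
  obtain R where R: "([:a:] + pCons 0 P) ^ q - [:a:] ^ q - (pCons 0 P) ^ q = smult (int q) R"
    using binom by blast
  have 1: "[:a:] ^ q = [:a:] + smult (int q) [:c:]"
    using c by (simp add: poly_const_pow algebra_simps)
  have 2: "(pCons 0 P) ^ q = monom 1 q * P ^ q"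
    by (simp add: pCons_0_as_mult[of P] power_mult_distrib monom_altdef del: mult_pCons_left)
  have 3: "pcompose (pCons a P) (monom 1 q) = [:a:] + monom 1 q * pcompose P (monom 1 q)"
    by (simp add: pcompose_pCons)
  have 4: "P ^ q = pcompose P (monom 1 q) + smult (int q) Q" using Q by (simp add: algebra_simps)
  have "pCons a P = [:a:] + pCons 0 P" by simp
  hence "(pCons a P) ^ q = [:a:] ^ q + (pCons 0 P) ^ q + smult (int q) R"
    using R by (metis (no_types, lifting) add.commute diff_add_cancel diff_diff_add)
  hence "(pCons a P) ^ q - pcompose (pCons a P) (monom 1 q)
      = smult (int q) ([:c:] + monom 1 q * Q + R)"
    unfolding 1 2 3 4 by (simp add: algebra_simps smult_add_right)
  thus ?case by blast
qed

lemma ipoly_pcompose_monom: "ipoly (pcompose P (monom 1 q)) z = ipoly P (z ^ q)"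
proof -
  have "map_poly of_int (pcompose P (monom 1 q)) = pcompose (map_poly of_int P) (map_poly of_int (monom 1 q) :: complex poly)"
    by (rule of_int_hom.map_poly_pcompose)
  thus ?thesis by (simp add: poly_pcompose poly_monom)
qed

lemma ipoly_Frobenius:
  assumes "prime q"
  obtains Q where "\<And>z. ipoly P z ^ q - ipoly P (z ^ q) = of_nat q * ipoly Q z"
proof -
  obtain Q where Q: "P ^ q - pcompose P (monom 1 q) = smult (int q) Q"
    using ipoly_power_prime[OF assms] by blast
  show ?thesis
  proof
    fix z
    have "ipoly (P ^ q - pcompose P (monom 1 q)) z = ipoly (smult (int q) Q) z" by (simp only: Q)
    thus "ipoly P z ^ q - ipoly P (z ^ q) = of_nat q * ipoly Q z"
      using ipoly_pcompose_monom[of P q z] by (simp add: hom_distribs del: of_int_hom.map_poly_pcompose)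
  qed
qed

text \<open>Dedekind's argument for the irreducibility of cyclotomic polynomials. Let
  \<open>m\<close> be the minimal polynomial of \<open>z\<close> and \<open>h\<close> its cofactor
  in \<open>X^N - 1\<close>. If \<open>y = z ^ q\<close> were not a root of \<open>m\<close>, it
  would be a root of \<open>h\<close>, and differentiating \<open>m * h\<close> at \<open>y\<close>
  would make \<open>N\<close> a multiple of \<open>ipoly m y\<close>. The latter is \<open>q\<close>
  times an algebraic integer by the Frobenius congruence, so \<open>q\<close> would divide
  \<open>N\<close>.\<close>

lemma conjugate_root_of_unity_prime:
  assumes "z ^ N = 1" "N > 0" "prime q" "\<not> q dvd N" "ipoly P z = 0"
  shows "ipoly P (z ^ q) = 0"
proof -
  define Tp where "Tp = monom 1 N - (1 :: int poly)"
  have Tp: "ipoly Tp y = y ^ N - 1" for y by (simp add: Tp_def hom_distribs poly_monom)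
  have "Tp \<noteq> 0"
  proof
    assume "Tp = 0"
    hence "(0 :: complex) ^ N - 1 = 0" using Tp[of 0] by simp
    thus False using assms(2) by (simp add: power_0_left)
  qed
  then obtain m where m: "ipoly m z = 0" "\<And>P. ipoly P z = 0 \<Longrightarrow> m dvd P"
    using int_minimal_poly[of Tp z] Tp[of z] assms(1) by auto
  obtain h where h: "Tp = m * h" using m(2)[of Tp] Tp[of z] assms(1) by auto
  define y where "y = z ^ q"
  have y: "y ^ N = 1" unfolding y_def by (metis assms(1) mult.commute power_mult power_one)
  have y0: "y \<noteq> 0" using y assms(2) by (auto simp: power_0_left)
  have "ipoly m y = 0"
  proof (rule ccontr)
    assume nz: "ipoly m y \<noteq> 0"
    have "ipoly m y * ipoly h y = 0" using Tp[of y] y h by (simp add: hom_distribs)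
    hence hy: "ipoly h y = 0" using nz by simp
    have "pderiv Tp = monom (int N) (N - 1)" by (simp add: Tp_def pderiv_diff pderiv_monom)
    hence "ipoly (monom (int N) (N - 1)) y = ipoly (pderiv (m * h)) y" using h by simp
    hence "of_nat N * y ^ (N - 1) = ipoly m y * ipoly (pderiv h) y"
      using hy by (simp add: hom_distribs poly_monom pderiv_mult)
    hence "of_nat N * y ^ (N - 1) * y = ipoly m y * ipoly (pderiv h) y * y" by simp
    hence 1: "of_nat N = ipoly m y * ipoly (pderiv h) y * y"
      using y assms(2) by (metis mult.assoc mult.right_neutral power_minus_mult)
    obtain Q where Q: "\<And>z. ipoly m z ^ q - ipoly m (z ^ q) = of_nat q * ipoly Q z"
      using ipoly_Frobenius[OF assms(3)] by blast
    have "ipoly m y = of_nat q * ipoly (- Q) z"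
      using Q[of z] m(1) assms(3)
      by (simp add: y_def hom_distribs prime_gt_0_nat power_0_left) (metis minus_minus)
    with 1 have "of_nat N = of_nat q * (ipoly (- Q) z * (ipoly (pderiv h) y * y))" by simp
    \<comment> \<open>All factors are rewritten as integer polynomials in \<open>z\<close> itself,
      so that \<open>N / q\<close> is seen to be an algebraic integer.\<close>
    also have "ipoly (pderiv h) y * y = ipoly (pcompose (pderiv h) (monom 1 q) * monom 1 q) z"
      by (simp add: hom_distribs y_def poly_monom poly_pcompose)
    finally have "of_nat N = of_nat q * ipoly (- Q * (pcompose (pderiv h) (monom 1 q) * monom 1 q)) z"
      by (simp add: hom_distribs)
    hence "ipoly (- Q * (pcompose (pderiv h) (monom 1 q) * monom 1 q)) z = of_nat N / of_nat q"
      using assms(3) by (simp add: field_simps)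
    hence "algebraic_int (of_nat N / of_nat q :: complex)"
      using algebraic_int_ipoly_root_of_unity[OF assms(1,2)] by metis
    moreover have "of_nat N / of_nat q \<in> (\<rat> :: complex set)" by simp
    ultimately have "of_nat N / of_nat q \<in> (\<int> :: complex set)" by (rule rational_algebraic_int_is_int)
    then obtain k where "of_nat N / of_nat q = (of_int k :: complex)" by (auto elim: Ints_cases)
    hence "(of_int (int N) :: complex) = of_int (int q * k)"
      using assms(3) by (auto simp: field_simps)
    hence "int N = int q * k" by (simp only: of_int_eq_iff)
    hence "q dvd N" by (metis dvd_triv_left int_dvd_int_iff)
    with assms(4) show False by simp
  qed
  moreover obtain r where "P = m * r" using m(2)[OF assms(5)] by auto
  ultimately show ?thesis by (simp add: hom_distribs y_def)
qed

lemma conjugate_root_of_unity: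
  assumes "N > 0" "z ^ N = 1" "coprime a N" "ipoly P z = 0"
  shows "ipoly P (z ^ a) = 0"
proof (cases "a = 0")
  \<comment> \<open>Coprimality of 0 and \<open>N\<close> forces \<open>N = 1\<close>, hence
    \<open>z = 1\<close>.\<close>
  case True
  with assms show ?thesis by simp
next
  case False
  then have "a > 0" by simp
  thus ?thesis using assms(2-4)
  proof (induction a arbitrary: z rule: prime_divisors_induct)
    case zero
    thus ?case by simp
  next
    case (unit a)
    thus ?case by simp
  next
    case (factor q a)
    have q: "prime q" "coprime q N" "coprime a N" "a > 0" using factor by auto
    have "\<not> q dvd N" using q by (metis coprime_absorb_left not_prime_unit)
    hence "ipoly P (z ^ q) = 0"
      using conjugate_root_of_unity_prime[of z N q P] assms(1) factor.prems q by auto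
    moreover have "(z ^ q) ^ N = 1" using factor.prems by (metis mult.commute power_mult power_one)
    ultimately have "ipoly P ((z ^ q) ^ a) = 0" using factor.IH q by blast
    thus ?case by (simp add: power_mult)
  qed
qed

interpretation of_rat_poly_hom: map_poly_comm_ring_hom "of_rat :: rat \<Rightarrow> complex" ..

text \<open>The complex exponential makes the choice of primitive roots coherent:
  \<open>zeta (N * M) ^ M = zeta N\<close>. Passing to a multiple of the order is then the
  substitution of a monomial for the variable.\<close>

definition zeta :: "nat \<Rightarrow> complex" where
  "zeta N = cis (2 * pi / real N)"

lemma zeta_power_order: "N > 0 \<Longrightarrow> zeta N ^ N = 1"
  unfolding zeta_def by (simp add: DeMoivre)

lemma zeta_nonzero [simp]: "zeta N \<noteq> 0"
  by (simp add: zeta_def)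

lemma zeta_mult_power: "N > 0 \<Longrightarrow> M > 0 \<Longrightarrow> zeta (N * M) ^ M = zeta N"
  unfolding zeta_def by (simp add: DeMoivre field_simps)

lemma root_of_unity_eq_zeta_power:
  assumes "N > 0" "z ^ N = 1"
  obtains j where "z = zeta N ^ j"
proof -
  have "z \<in> (\<lambda>k. cis (2 * pi * real k / real N)) ` {..<N}"
    using bij_betw_roots_unity[OF assms(1)] assms(2) by (auto simp: bij_betw_def)
  then obtain k where "z = cis (2 * pi * real k / real N)" by auto
  also have "\<dots> = zeta N ^ k" unfolding zeta_def by (simp add: DeMoivre mult_ac)
  finally show ?thesis using that by blast
qed

lemma zeta_power_eq_1_iff:
  assumes "N > 0"
  shows "zeta N ^ j = 1 \<longleftrightarrow> N dvd j"
proof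
  assume "zeta N ^ j = 1"
  hence "zeta N ^ (j mod N) = 1" by (simp add: power_mod_eq[OF zeta_power_order[OF assms]])
  moreover have "zeta N ^ k = cis (2 * pi * real k / real N)" for k
    unfolding zeta_def by (simp add: DeMoivre mult_ac)
  ultimately have "cis (2 * pi * real (j mod N) / real N) = cis (2 * pi * real 0 / real N)" by simp
  moreover have "inj_on (\<lambda>k. cis (2 * pi * real k / real N)) {..<N}"
    using bij_betw_roots_unity[OF assms] by (auto simp: bij_betw_def)
  ultimately have "j mod N = 0"
    using assms inj_onD[of "\<lambda>k. cis (2 * pi * real k / real N)" "{..<N}" "j mod N" 0] by simp
  thus "N dvd j" by auto
next
  assume "N dvd j"
  thus "zeta N ^ j = 1" using zeta_power_order[OF assms] by (auto simp: power_mult)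
qed

lemma power_cong_exponent:
  fixes z :: "'a::monoid_mult"
  assumes "z ^ N = 1" "[a = b] (mod N)"
  shows "z ^ a = z ^ b"
  using power_mod_eq[OF assms(1), of a] power_mod_eq[OF assms(1), of b] assms(2)
  by (simp add: cong_def)

lemma zeta_power_eq_iff:
  assumes "N > 0"
  shows "zeta N ^ a = zeta N ^ b \<longleftrightarrow> [a = b] (mod N)"
proof
  have *: "[a = b] (mod N)" if "zeta N ^ a = zeta N ^ b" "a \<le> b" for a b
  proof -
    have "zeta N ^ a * zeta N ^ (b - a) = zeta N ^ a * 1" using that
      by (metis le_add_diff_inverse mult_1_right power_add)
    hence "zeta N ^ (b - a) = 1" by (metis mult_cancel_left power_not_zero zeta_nonzero)
    hence "N dvd b - a" using zeta_power_eq_1_iff[OF assms] by simp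
    thus ?thesis using that(2) by (metis cong_altdef_nat cong_sym)
  qed
  assume "zeta N ^ a = zeta N ^ b"
  thus "[a = b] (mod N)" using *[of a b] *[of b a] by (cases "a \<le> b") (auto simp: cong_sym)
qed (rule power_cong_exponent[OF zeta_power_order[OF assms]])

section \<open>Cyclotomic fields as unions of polynomial rings\<close>

abbreviation rpoly :: "rat poly \<Rightarrow> complex \<Rightarrow> complex" where
  "rpoly P z \<equiv> poly (map_poly of_rat P) z"

lemma rpoly_clear_denominator:
  fixes P :: "rat poly"
  obtains m Q where "m > (0::nat)" "\<And>z. rpoly P z = ipoly Q z / of_nat m"
proof -
  have "\<exists>m>(0::nat). \<exists>Q. \<forall>z. rpoly P z = ipoly Q z / of_nat m"
  proof (induction P)
    case 0
    show ?case by (intro exI[of _ 1] conjI exI[of _ 0]) auto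
  next
    case (pCons a P)
    then obtain m Q where m: "m > 0" "\<And>z. rpoly P z = ipoly Q z / of_nat m" by blast
    obtain c d where cd: "quotient_of a = (c, d)" by (cases "quotient_of a")
    have d: "d > 0" using quotient_of_denom_pos[OF cd] .
    have a: "(of_rat a :: complex) = of_int c / of_int d"
      using quotient_of_div[OF cd] by (simp add: of_rat_divide)
    have "rpoly (pCons a P) z = ipoly (pCons (c * int m) (smult d Q)) z / of_nat (nat d * m)" for z
      using d m a by (simp add: hom_distribs field_simps)
    moreover have "nat d * m > 0" using d m by simp
    ultimately show ?case by blast
  qed
  thus ?thesis using that by blast
qed

lemma conjugate_root_of_unity_rat:
  assumes "N > 0" "z ^ N = 1" "coprime a N" "rpoly P z = 0"
  shows "rpoly P (z ^ a) = 0"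
proof -
  obtain m Q where m: "m > (0::nat)" "\<And>z. rpoly P z = ipoly Q z / of_nat m"
    by (rule rpoly_clear_denominator[of P]) blast
  have "ipoly Q z = 0" using assms(4) m by simp
  thus ?thesis using conjugate_root_of_unity[OF assms(1-3)] m by simp
qed

lemma rpoly_pcompose_monom: "rpoly (pcompose P (monom 1 q)) z = rpoly P (z ^ q)"
  by (simp add: hom_distribs poly_pcompose poly_monom)

text \<open>Phrased with the operations of the type, where \<open>inverse 0 = 0\<close> makes
  closure under inverses unconditional. Computations stay plain complex arithmetic; the record-based
  fields are connected to it through \<open>complex_subfield_generate_field\<close>.\<close>

definition complex_subfield :: "complex set \<Rightarrow> bool" where
  "complex_subfield S \<longleftrightarrow> 1 \<in> S \<and> (\<forall>x\<in>S. - x \<in> S \<and> inverse x \<in> S) \<and>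
     (\<forall>x\<in>S. \<forall>y\<in>S. x + y \<in> S \<and> x * y \<in> S)"

lemma complex_subfieldD:
  assumes "complex_subfield S"
  shows "1 \<in> S" "0 \<in> S"
    and "\<And>x. x \<in> S \<Longrightarrow> - x \<in> S" "\<And>x. x \<in> S \<Longrightarrow> inverse x \<in> S"
    and "\<And>x y. x \<in> S \<Longrightarrow> y \<in> S \<Longrightarrow> x + y \<in> S" "\<And>x y. x \<in> S \<Longrightarrow> y \<in> S \<Longrightarrow> x * y \<in> S"
    and "\<And>x y. x \<in> S \<Longrightarrow> y \<in> S \<Longrightarrow> x - y \<in> S" "\<And>x y. x \<in> S \<Longrightarrow> y \<in> S \<Longrightarrow> x / y \<in> S"
    and "\<And>x n. x \<in> S \<Longrightarrow> x ^ n \<in> S" "\<And>f A. (\<And>i. i \<in> A \<Longrightarrow> f i \<in> S) \<Longrightarrow> prod f A \<in> S"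
    and "\<And>f A. (\<And>i. i \<in> A \<Longrightarrow> f i \<in> S) \<Longrightarrow> sum f A \<in> S"
    and "of_nat n \<in> S" "of_int k \<in> S" "of_rat q \<in> S" "\<rat> \<subseteq> S"
proof -
  show 1: "1 \<in> S" and neg: "\<And>x. x \<in> S \<Longrightarrow> - x \<in> S" and inv: "\<And>x. x \<in> S \<Longrightarrow> inverse x \<in> S"
    and add: "\<And>x y. x \<in> S \<Longrightarrow> y \<in> S \<Longrightarrow> x + y \<in> S" and mul: "\<And>x y. x \<in> S \<Longrightarrow> y \<in> S \<Longrightarrow> x * y \<in> S"
    using assms by (auto simp: complex_subfield_def)
  show 0: "0 \<in> S" using add[OF 1 neg[OF 1]] by simp
  show "\<And>x y. x \<in> S \<Longrightarrow> y \<in> S \<Longrightarrow> x - y \<in> S" using add neg by (metis add_uminus_conv_diff)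
  show div: "\<And>x y. x \<in> S \<Longrightarrow> y \<in> S \<Longrightarrow> x / y \<in> S" using mul inv by (metis divide_inverse)
  show "x ^ n \<in> S" if "x \<in> S" for x n using that by (induction n) (auto intro: 1 mul)
  show "prod f A \<in> S" if "\<And>i. i \<in> A \<Longrightarrow> f i \<in> S" for f and A :: "'a set"
    using that by (induction A rule: infinite_finite_induct) (auto intro: 1 mul)
  show "sum f A \<in> S" if "\<And>i. i \<in> A \<Longrightarrow> f i \<in> S" for f and A :: "'b set"
    using that by (induction A rule: infinite_finite_induct) (auto intro: 0 add)
  have nat: "of_nat n \<in> S" for n by (induction n) (auto intro: 0 1 add)
  thus "of_nat n \<in> S" .
  have int: "of_int k \<in> S" for k by (cases k rule: int_cases2) (auto intro: nat neg)
  thus "of_int k \<in> S" .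
  have rat: "of_rat q \<in> S" for q
  proof -
    obtain a b where "quotient_of q = (a, b)" by (cases "quotient_of q")
    hence "(of_rat q :: complex) = of_rat (of_int a / of_int b)" using quotient_of_div by metis
    hence "(of_rat q :: complex) = of_int a / of_int b" by (simp add: of_rat_divide)
    thus ?thesis using int div by metis
  qed
  thus "of_rat q \<in> S" .
  show "\<rat> \<subseteq> S" using rat by (auto elim: Rats_cases)
qed

lemma ring_of_type_algebra_simps [simp]:
  "carrier (ring_of_type_algebra :: 'a::ring_1 ring) = UNIV"
  "\<zero>\<^bsub>(ring_of_type_algebra :: 'a ring)\<^esub> = 0"
  "\<one>\<^bsub>(ring_of_type_algebra :: 'a ring)\<^esub> = 1"
  "x \<oplus>\<^bsub>(ring_of_type_algebra :: 'a ring)\<^esub> y = x + y"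
  "x \<otimes>\<^bsub>(ring_of_type_algebra :: 'a ring)\<^esub> y = x * y"
  by (simp_all add: ring_of_type_algebra_def)

lemma ring_of_type_algebra_a_inv [simp]:
  "\<ominus>\<^bsub>(ring_of_type_algebra :: 'a::ring_1 ring)\<^esub> x = - x"
proof -
  interpret R: ring "ring_of_type_algebra :: 'a ring"
    by (standard) (auto simp: ring_of_type_algebra_def algebra_simps Units_def intro: exI[of _ "- _"])
  show ?thesis by (rule R.minus_equality) auto
qed

lemma ring_of_type_algebra_m_inv [simp]:
  assumes "x \<noteq> 0"
  shows "inv\<^bsub>(ring_of_type_algebra :: 'a::field ring)\<^esub> x = inverse x"
proof -
  interpret R: field "ring_of_type_algebra :: 'a ring" by (rule field_from_type_algebra)
  show ?thesis by (rule R.comm_inv_char) (use assms in auto)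
qed

lemma complex_subfield_generate_field:
  "complex_subfield (generate_field ring_of_type_algebra H)"
proof -
  let ?R = "ring_of_type_algebra :: complex ring"
  have 1: "1 \<in> generate_field ?R H" using generate_field.one[of ?R H] by simp
  have neg: "- x \<in> generate_field ?R H" if "x \<in> generate_field ?R H" for x
    using generate_field.a_inv[OF that] by simp
  have add: "x + y \<in> generate_field ?R H" if "x \<in> generate_field ?R H" "y \<in> generate_field ?R H" for x y
    using generate_field.eng_add[OF that] by simp
  have mul: "x * y \<in> generate_field ?R H" if "x \<in> generate_field ?R H" "y \<in> generate_field ?R H" for x y
    using generate_field.eng_mult[OF that] by simp
  have inv: "inverse x \<in> generate_field ?R H" if "x \<in> generate_field ?R H" for x
  proof (cases "x = 0")
    case True
    thus ?thesis using that by simp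
  next
    case False
    thus ?thesis using generate_field.m_inv[OF that] by simp
  qed
  show ?thesis using 1 neg add mul inv by (auto simp: complex_subfield_def)
qed

lemma generate_field_least:
  assumes "complex_subfield S" "H \<subseteq> S"
  shows "generate_field ring_of_type_algebra H \<subseteq> S"
proof
  fix x assume "x \<in> generate_field ring_of_type_algebra H"
  thus "x \<in> S"
    by (induction rule: generate_field.induct)
       (use assms(2) in \<open>auto intro: complex_subfieldD[OF assms(1)]\<close>)
qed

text \<open>As \<open>t\<close> is nonzero, factors \<open>X\<close> can be stripped from
  \<open>R\<close> until its constant coefficient is nonzero; the equation then exhibits that
  constant as a multiple of \<open>t\<close>.\<close>

lemma int_root_inverse:
  assumes "R \<noteq> 0" "ipoly R t = 0" "t \<noteq> 0"
  obtains G c where "c \<noteq> (0::int)" "t * ipoly G t = of_int c"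
proof -
  have "\<exists>G c. c \<noteq> (0::int) \<and> t * ipoly G t = of_int c"
    using assms(1,2)
  proof (induction R)
    case 0
    thus ?case by simp
  next
    case (pCons a R)
    have eq: "of_int a + t * ipoly R t = 0" using pCons.prems by (simp add: hom_distribs)
    show ?case
    proof (cases "a = 0")
      case True
      thus ?thesis using pCons eq assms(3) by auto
    next
      case False
      thus ?thesis using eq by (intro exI[of _ R] exI[of _ "- a"]) (auto simp: add_eq_0_iff)
    qed
  qed
  thus ?thesis using that by blast
qed

definition cyc :: "nat \<Rightarrow> complex set" where
  "cyc N = range (\<lambda>P. rpoly P (zeta N))"

text \<open>Only inverses require an argument. After clearing denominators the element is an
  algebraic integer, and its own equation writes its inverse as a rational polynomial in it.\<close>

lemma complex_subfield_cyc:
  assumes "N > 0"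
  shows "complex_subfield (cyc N)"
  unfolding complex_subfield_def
proof (intro conjI ballI)
  show "1 \<in> cyc N" unfolding cyc_def by (rule range_eqI[of _ _ 1]) simp
  fix x assume "x \<in> cyc N"
  then obtain P where P: "x = rpoly P (zeta N)" by (auto simp: cyc_def)
  show "- x \<in> cyc N" unfolding cyc_def by (rule range_eqI[of _ _ "- P"]) (simp add: P of_rat_poly_hom.hom_uminus)
  show "inverse x \<in> cyc N"
  proof (cases "x = 0")
    case True
    thus ?thesis unfolding cyc_def by (intro range_eqI[of _ _ 0]) simp
  next
    case False
    obtain m Q where m: "m > (0::nat)" "\<And>z. rpoly P z = ipoly Q z / of_nat m"
      by (rule rpoly_clear_denominator[of P]) blast
    define t where "t = ipoly Q (zeta N)"
    have t: "t \<noteq> 0" using False P m by (simp add: t_def)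
    have "algebraic_int t"
      unfolding t_def by (rule algebraic_int_ipoly_root_of_unity[OF zeta_power_order]) (use assms in auto)
    then obtain R where R: "ipoly R t = 0" "lead_coeff R = 1" by (auto simp: algebraic_int_altdef_ipoly)
    have R0: "R \<noteq> 0" using R(2) by auto
    obtain G c where c: "c \<noteq> (0::int)" "t * ipoly G t = of_int c"
      by (rule int_root_inverse[OF R0 R(1) t])
    have "inverse x = of_nat m * (inverse t)" using P m(2)[of "zeta N"] by (simp add: t_def divide_inverse)
    also have "inverse t = ipoly G t / of_int c" using c t by (simp add: field_simps)
    also have "of_nat m * (ipoly G t / of_int c)
        = rpoly (smult (of_nat m / of_int c) (map_poly of_int (pcompose G Q))) (zeta N)"
      by (simp add: hom_distribs t_def poly_pcompose of_rat_divide map_poly_map_poly o_def)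
    finally show ?thesis by (auto simp: cyc_def)
  qed
next
  fix x y assume "x \<in> cyc N" "y \<in> cyc N"
  then obtain P Q where P: "x = rpoly P (zeta N)" "y = rpoly Q (zeta N)" by (auto simp: cyc_def)
  show "x + y \<in> cyc N" unfolding cyc_def by (rule range_eqI[of _ _ "P + Q"]) (simp add: P hom_distribs)
  show "x * y \<in> cyc N" unfolding cyc_def by (rule range_eqI[of _ _ "P * Q"]) (simp add: P hom_distribs)
qed

lemma cyc_mono:
  assumes "N > 0" "M > 0"
  shows "cyc N \<subseteq> cyc (N * M)"
proof
  fix x assume "x \<in> cyc N"
  then obtain P where "x = rpoly P (zeta N)" by (auto simp: cyc_def)
  hence "x = rpoly (pcompose P (monom 1 M)) (zeta (N * M))"
    by (simp add: rpoly_pcompose_monom zeta_mult_power assms)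
  thus "x \<in> cyc (N * M)" by (auto simp: cyc_def)
qed

text \<open>Closure of \<open>D\<close> under products makes the union of the fields
  \<open>cyc N\<close> directed, hence a field. Taking all positive orders gives
  \<open>Qcyc\<close>, taking those prime to \<open>p\<close> gives
  \<open>Qcyc_prime_to p\<close>.\<close>

lemma generate_field_roots_of_unity:
  assumes "\<And>N. N \<in> D \<Longrightarrow> N > 0" "1 \<in> D" "\<And>N M. N \<in> D \<Longrightarrow> M \<in> D \<Longrightarrow> N * M \<in> D"
  shows "generate_field ring_of_type_algebra {z::complex. \<exists>N\<in>D. z ^ N = 1} = (\<Union>N\<in>D. cyc N)"
    (is "?G = ?C")
proof
  have common: "\<exists>N\<in>D. x \<in> cyc N \<and> y \<in> cyc N" if "x \<in> ?C" "y \<in> ?C" for x y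
  proof -
    from that obtain N M where "N \<in> D" "M \<in> D" "x \<in> cyc N" "y \<in> cyc M" by auto
    moreover from this have "cyc N \<subseteq> cyc (N * M)" "cyc M \<subseteq> cyc (N * M)"
      using cyc_mono[of N M] cyc_mono[of M N] assms(1) by (simp_all add: mult.commute)
    ultimately show ?thesis using assms(3)[of N M] by blast
  qed
  have "complex_subfield ?C"
    unfolding complex_subfield_def
  proof (intro conjI ballI)
    show "1 \<in> ?C" using assms(2) complex_subfieldD(1)[OF complex_subfield_cyc[of 1]] by auto
    fix x assume "x \<in> ?C"
    then obtain N where N: "N \<in> D" "x \<in> cyc N" by blast
    thus "- x \<in> ?C" "inverse x \<in> ?C"
      using complex_subfieldD(3,4)[OF complex_subfield_cyc[OF assms(1)[OF N(1)]] N(2)] by blast+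
  next
    fix x y assume "x \<in> ?C" "y \<in> ?C"
    then obtain N where N: "N \<in> D" "x \<in> cyc N" "y \<in> cyc N" using common by blast
    thus "x + y \<in> ?C" "x * y \<in> ?C"
      using complex_subfieldD(5,6)[OF complex_subfield_cyc[OF assms(1)[OF N(1)]] N(2,3)] by blast+
  qed
  moreover have "{z::complex. \<exists>N\<in>D. z ^ N = 1} \<subseteq> ?C"
  proof safe
    fix z :: complex and N assume N: "N \<in> D" "z ^ N = 1"
    then obtain j where "z = zeta N ^ j" using root_of_unity_eq_zeta_power assms(1) by metis
    hence "z = rpoly (monom 1 j) (zeta N)" by (simp add: hom_distribs poly_monom)
    hence "z \<in> cyc N" unfolding cyc_def by (rule range_eqI)
    thus "z \<in> ?C" using N(1) by blast
  qed
  ultimately show "?G \<subseteq> ?C" by (rule generate_field_least)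
  show "?C \<subseteq> ?G"
  proof safe
    fix N x assume N: "N \<in> D" "x \<in> cyc N"
    have G: "complex_subfield ?G" by (rule complex_subfield_generate_field)
    obtain P where P: "x = rpoly P (zeta N)" using N by (auto simp: cyc_def)
    have "zeta N \<in> ?G"
      using N(1) assms(1) zeta_power_order by (intro generate_field.incl) blast
    thus "x \<in> ?G" unfolding P poly_altdef
      by (auto intro!: complex_subfieldD[OF G] simp: coeff_map_poly)
  qed
qed

lemma Qcyc_eq: "Qcyc = (\<Union>N\<in>{0<..}. cyc N)"
proof -
  have "roots_of_unity = {z. \<exists>N\<in>{0<..}. z ^ N = 1}" by (auto simp: roots_of_unity_def)
  thus ?thesis unfolding Qcyc_def using generate_field_roots_of_unity[of "{0<..}"] by simp
qed

lemma Qcyc_prime_to_eq: "Qcyc_prime_to p = (\<Union>N\<in>{N. N > 0 \<and> coprime N p}. cyc N)"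
proof -
  have "roots_prime_to p = {z. \<exists>N\<in>{N. N > 0 \<and> coprime N p}. z ^ N = 1}"
    by (auto simp: roots_prime_to_def)
  thus ?thesis unfolding Qcyc_prime_to_def
    using generate_field_roots_of_unity[of "{N. N > 0 \<and> coprime N p}"] by simp
qed

lemma complex_subfield_Qcyc: "complex_subfield Qcyc"
  unfolding Qcyc_def by (rule complex_subfield_generate_field)

lemma complex_subfield_Qcyc_prime_to: "complex_subfield (Qcyc_prime_to p)"
  unfolding Qcyc_prime_to_def by (rule complex_subfield_generate_field)

lemmas Qcyc_closed = complex_subfieldD[OF complex_subfield_Qcyc]
lemmas Qcyc_prime_to_closed = complex_subfieldD[OF complex_subfield_Qcyc_prime_to]

lemma Qcyc_prime_to_subset: "Qcyc_prime_to p \<subseteq> Qcyc"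
  by (auto simp: Qcyc_eq Qcyc_prime_to_eq)

lemma root_of_unity_in_Qcyc: "z ^ N = 1 \<Longrightarrow> N > 0 \<Longrightarrow> z \<in> Qcyc"
  unfolding Qcyc_def by (rule generate_field.incl) (auto simp: roots_of_unity_def)

lemma root_of_unity_in_Qcyc_prime_to:
  "z ^ N = 1 \<Longrightarrow> N > 0 \<Longrightarrow> coprime N p \<Longrightarrow> z \<in> Qcyc_prime_to p"
  unfolding Qcyc_prime_to_def by (rule generate_field.incl) (auto simp: roots_prime_to_def)

section \<open>Homomorphisms and the extension of power maps\<close>

text \<open>An embedding of \<open>S\<close> into the complex numbers, with no condition on the
  image. For the cyclotomic fields the image is afterwards shown to be the field itself.\<close>

definition complex_hom :: "complex set \<Rightarrow> (complex \<Rightarrow> complex) \<Rightarrow> bool" where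
  "complex_hom S \<sigma> \<longleftrightarrow> \<sigma> 1 = 1 \<and> (\<forall>x\<in>S. \<forall>y\<in>S. \<sigma> (x + y) = \<sigma> x + \<sigma> y \<and> \<sigma> (x * y) = \<sigma> x * \<sigma> y)"

lemma complex_homD:
  assumes S: "complex_subfield S" and h: "complex_hom S \<sigma>"
  shows "\<sigma> 1 = 1" "\<sigma> 0 = 0"
    and "\<And>x y. x \<in> S \<Longrightarrow> y \<in> S \<Longrightarrow> \<sigma> (x + y) = \<sigma> x + \<sigma> y" "\<And>x y. x \<in> S \<Longrightarrow> y \<in> S \<Longrightarrow> \<sigma> (x * y) = \<sigma> x * \<sigma> y"
    and "\<And>x. x \<in> S \<Longrightarrow> \<sigma> (- x) = - \<sigma> x" "\<And>x y. x \<in> S \<Longrightarrow> y \<in> S \<Longrightarrow> \<sigma> (x - y) = \<sigma> x - \<sigma> y"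
    and "\<And>x. x \<in> S \<Longrightarrow> \<sigma> (inverse x) = inverse (\<sigma> x)" "\<And>x y. x \<in> S \<Longrightarrow> y \<in> S \<Longrightarrow> \<sigma> (x / y) = \<sigma> x / \<sigma> y"
    and "\<And>x n. x \<in> S \<Longrightarrow> \<sigma> (x ^ n) = \<sigma> x ^ n"
    and "\<And>f A. (\<And>i. i \<in> A \<Longrightarrow> f i \<in> S) \<Longrightarrow> \<sigma> (prod f A) = (\<Prod>i\<in>A. \<sigma> (f i))"
    and "\<And>f A. (\<And>i. i \<in> A \<Longrightarrow> f i \<in> S) \<Longrightarrow> \<sigma> (sum f A) = (\<Sum>i\<in>A. \<sigma> (f i))"
    and "\<sigma> (of_nat n) = of_nat n" "\<sigma> (of_int k) = of_int k" "\<sigma> (of_rat q) = of_rat q"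
    and "\<And>x. x \<in> S \<Longrightarrow> \<sigma> x = 0 \<longleftrightarrow> x = 0" "inj_on \<sigma> S"
proof -
  note cl = complex_subfieldD[OF S]
  show 1: "\<sigma> 1 = 1" using h by (simp add: complex_hom_def)
  show add: "\<And>x y. x \<in> S \<Longrightarrow> y \<in> S \<Longrightarrow> \<sigma> (x + y) = \<sigma> x + \<sigma> y"
    and mul: "\<And>x y. x \<in> S \<Longrightarrow> y \<in> S \<Longrightarrow> \<sigma> (x * y) = \<sigma> x * \<sigma> y"
    using h by (auto simp: complex_hom_def)
  show 0: "\<sigma> 0 = 0" using add[of 0 0] cl by simp
  show neg: "\<sigma> (- x) = - \<sigma> x" if "x \<in> S" for x
  proof -
    have "\<sigma> x + \<sigma> (- x) = 0" using add[of x "- x"] that cl 0 by simp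
    thus ?thesis by (metis minus_unique)
  qed
  show dif: "\<sigma> (x - y) = \<sigma> x - \<sigma> y" if "x \<in> S" "y \<in> S" for x y
    using add[of x "- y"] that cl neg by simp
  have prod1: "\<sigma> x * \<sigma> (inverse x) = 1" if "x \<in> S" "x \<noteq> 0" for x
    using mul[of x "inverse x"] that cl 1 by simp
  show inv: "\<sigma> (inverse x) = inverse (\<sigma> x)" if "x \<in> S" for x
    using prod1[of x] that 0 by (cases "x = 0") (auto simp: inverse_unique)
  show div: "\<sigma> (x / y) = \<sigma> x / \<sigma> y" if "x \<in> S" "y \<in> S" for x y
    using that mul inv cl by (simp add: divide_inverse)
  show "\<sigma> (x ^ n) = \<sigma> x ^ n" if "x \<in> S" for x n
    using that cl by (induction n) (auto simp: 1 mul)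
  show "\<sigma> (prod f A) = (\<Prod>i\<in>A. \<sigma> (f i))" if "\<And>i. i \<in> A \<Longrightarrow> f i \<in> S" for f and A :: "'a set"
    using that cl(10)[of _ f] by (induction A rule: infinite_finite_induct) (auto simp: 1 mul)
  show "\<sigma> (sum f A) = (\<Sum>i\<in>A. \<sigma> (f i))" if "\<And>i. i \<in> A \<Longrightarrow> f i \<in> S" for f and A :: "'b set"
    using that cl(11)[of _ f] by (induction A rule: infinite_finite_induct) (auto simp: 0 add)
  have nat: "\<sigma> (of_nat n) = of_nat n" for n by (induction n) (auto simp: 0 1 add cl)
  thus "\<sigma> (of_nat n) = of_nat n" .
  have int: "\<sigma> (of_int k) = of_int k" for k by (cases k rule: int_cases2) (auto simp: nat neg cl)
  thus "\<sigma> (of_int k) = of_int k" .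
  show "\<sigma> (of_rat q) = of_rat q"
  proof -
    obtain a b where "quotient_of q = (a, b)" by (cases "quotient_of q")
    hence "(of_rat q :: complex) = of_rat (of_int a / of_int b)" using quotient_of_div by metis
    hence "(of_rat q :: complex) = of_int a / of_int b" by (simp add: of_rat_divide)
    thus ?thesis using int div cl by metis
  qed
  show z: "\<sigma> x = 0 \<longleftrightarrow> x = 0" if "x \<in> S" for x
    using prod1[of x] that 0 by (metis mult_zero_left zero_neq_one)
  show "inj_on \<sigma> S"
  proof (rule inj_onI)
    fix x y assume xy: "x \<in> S" "y \<in> S" "\<sigma> x = \<sigma> y"
    hence "\<sigma> (x - y) = 0" using dif by simp
    thus "x = y" using z[of "x - y"] xy cl by simp
  qed
qed

lemma complex_hom_rpoly:
  assumes "complex_subfield S" "complex_hom S \<sigma>" "z \<in> S"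
  shows "\<sigma> (rpoly P z) = rpoly P (\<sigma> z)"
proof -
  note cl = complex_subfieldD[OF assms(1)] and h = complex_homD[OF assms(1,2)]
  show ?thesis using assms(3) unfolding poly_altdef
    by (subst h) (auto simp: coeff_map_poly h cl)
qed

lemma complex_hom_eq_generate_field:
  assumes h: "complex_hom (generate_field ring_of_type_algebra H) \<sigma>"
    "complex_hom (generate_field ring_of_type_algebra H) \<rho>"
    and eq: "\<And>z. z \<in> H \<Longrightarrow> \<sigma> z = \<rho> z"
    and x: "x \<in> generate_field ring_of_type_algebra H"
  shows "\<sigma> x = \<rho> x"
proof -
  note S = complex_subfield_generate_field[of H]
  note h1 = complex_homD[OF S h(1)] and h2 = complex_homD[OF S h(2)]
  show ?thesis using x
    by (induction rule: generate_field.induct) (auto simp: eq h1 h2)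
qed

text \<open>The group of \<open>N\<close>-th roots of unity is cyclic, so \<open>\<sigma>\<close>
  acts on it as a power map. If \<open>a\<close> and \<open>N\<close> had a common divisor
  \<open>d > 1\<close>, the nontrivial root \<open>zeta N ^ (N div d)\<close> would be sent to 1,
  contradicting injectivity.\<close>

lemma root_of_unity_hom_exponent:
  assumes S: "complex_subfield S" and h: "complex_hom S \<sigma>" and N: "N > 0" "zeta N \<in> S"
  obtains a where "coprime a N" "\<And>z. z ^ N = 1 \<Longrightarrow> \<sigma> z = z ^ a"
proof -
  note hD = complex_homD[OF S h] and cl = complex_subfieldD[OF S]
  have "\<sigma> (zeta N) ^ N = 1" using hD(9)[OF N(2), of N] hD(1) by (simp add: zeta_power_order N)
  then obtain a where a: "\<sigma> (zeta N) = zeta N ^ a" using root_of_unity_eq_zeta_power N by metis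
  have "\<sigma> z = z ^ a" if z: "z ^ N = 1" for z
  proof -
    obtain j where "z = zeta N ^ j" using root_of_unity_eq_zeta_power z N by metis
    thus ?thesis using hD(9)[OF N(2), of j] a by (simp flip: power_mult add: mult.commute)
  qed
  moreover have "coprime a N"
  proof (rule ccontr)
    assume "\<not> coprime a N"
    define d where "d = gcd a N"
    have d: "d dvd a" "d dvd N" by (simp_all add: d_def)
    have "d \<noteq> 1" using \<open>\<not> coprime a N\<close> coprime_iff_gcd_eq_1[of a N] by (simp only: d_def not_False_eq_True)
    obtain n where n: "N = d * n" using d(2) by (rule dvdE)
    obtain b where b: "a = d * b" using d(1) by (rule dvdE)
    note nb = n b
    have "\<sigma> (zeta N ^ n) = zeta N ^ (a * n)" using hD(9)[OF N(2), of n] a by (simp add: power_mult)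
    also have "a * n = N * b" using nb by simp
    also have "zeta N ^ (N * b) = \<sigma> 1" by (simp add: power_mult zeta_power_order N hD)
    finally have "zeta N ^ n = 1" using hD(16) N cl by (auto dest!: inj_onD)
    hence "N dvd n" using zeta_power_eq_1_iff N by simp
    moreover have "n > 0" using N(1) n by auto
    ultimately have "d * n \<le> n" using n by (intro dvd_imp_le) simp_all
    hence "d \<le> 1" using \<open>n > 0\<close> by simp
    thus False using \<open>d \<noteq> 1\<close> n N(1) by (cases d) auto
  qed
  ultimately show ?thesis using that by blast
qed

text \<open>The relation \<open>rel\<close> sends a polynomial in \<open>zeta N\<close> to the same
  polynomial in \<open>zeta N ^ A N\<close>. Compatibility of the exponents moves two
  representations of one number to the common order \<open>N * M\<close>; there the difference
  vanishes at a root of unity, hence at its conjugate, so the two values agree.\<close>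

lemma power_map_extends:
  assumes cop: "\<And>N. N > 0 \<Longrightarrow> coprime (A N) N"
    and compat: "\<And>N M. M > 0 \<Longrightarrow> N dvd M \<Longrightarrow> [A M = A N] (mod N)"
  shows "\<exists>\<sigma>. complex_hom Qcyc \<sigma> \<and> (\<forall>N z. N > 0 \<longrightarrow> z ^ N = 1 \<longrightarrow> \<sigma> z = z ^ A N)"
proof -
  define rel where "rel x y \<longleftrightarrow> (\<exists>N>0. \<exists>P. x = rpoly P (zeta N) \<and> y = rpoly P (zeta N ^ A N))" for x y
  have lift: "rpoly P (zeta N) = rpoly (pcompose P (monom 1 M)) (zeta (N * M))"
    "rpoly P (zeta N ^ A N) = rpoly (pcompose P (monom 1 M)) (zeta (N * M) ^ A (N * M))"
    if "N > 0" "M > 0" for P N M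
  proof -
    show "rpoly P (zeta N) = rpoly (pcompose P (monom 1 M)) (zeta (N * M))"
      by (simp add: rpoly_pcompose_monom zeta_mult_power that)
    have "(zeta (N * M) ^ A (N * M)) ^ M = zeta N ^ A (N * M)"
      using zeta_mult_power[OF that] by (metis mult.commute power_mult)
    also have "\<dots> = zeta N ^ A N"
      by (rule power_cong_exponent[OF zeta_power_order compat]) (use that in auto)
    finally show "rpoly P (zeta N ^ A N) = rpoly (pcompose P (monom 1 M)) (zeta (N * M) ^ A (N * M))"
      by (simp add: rpoly_pcompose_monom)
  qed
  have uniq: "y = y'" if r: "rel x y" "rel x y'" for x y y'
  proof -
    obtain N P where N: "N > 0" "x = rpoly P (zeta N)" "y = rpoly P (zeta N ^ A N)"
      using r(1) unfolding rel_def by blast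
    obtain M Q where M: "M > 0" "x = rpoly Q (zeta M)" "y' = rpoly Q (zeta M ^ A M)"
      using r(2) unfolding rel_def by blast
    define P' Q' where "P' = pcompose P (monom 1 M)" and "Q' = pcompose Q (monom 1 N)"
    have "rpoly (P' - Q') (zeta (N * M)) = 0"
      using lift(1)[of N M P] lift(1)[of M N Q] N M
      by (simp add: P'_def Q'_def of_rat_poly_hom.hom_minus mult.commute)
    hence "rpoly (P' - Q') (zeta (N * M) ^ A (N * M)) = 0"
      by (intro conjugate_root_of_unity_rat[of "N * M"] zeta_power_order cop) (use N M in auto)
    thus "y = y'"
      using lift(2)[of N M P] lift(2)[of M N Q] N M
      by (simp add: P'_def Q'_def of_rat_poly_hom.hom_minus mult.commute)
  qed
  define \<sigma> where "\<sigma> x = (THE y. rel x y)" for x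
  have \<sigma>: "\<sigma> (rpoly P (zeta N)) = rpoly P (zeta N ^ A N)" if "N > 0" for N P
  proof -
    have *: "rel (rpoly P (zeta N)) (rpoly P (zeta N ^ A N))" unfolding rel_def using that by blast
    show ?thesis unfolding \<sigma>_def by (rule the_equality, rule *) (rule uniq[OF _ *])
  qed
  have rep: "\<exists>N>0. \<exists>P. x = rpoly P (zeta N)" if "x \<in> Qcyc" for x
    using that by (auto simp: Qcyc_eq cyc_def)
  have rep2: "\<exists>N>0. \<exists>P Q. x = rpoly P (zeta N) \<and> y = rpoly Q (zeta N)" if xy: "x \<in> Qcyc" "y \<in> Qcyc" for x y
  proof -
    obtain N P where N: "N > 0" "x = rpoly P (zeta N)" using rep[OF xy(1)] by blast
    obtain M Q where M: "M > 0" "y = rpoly Q (zeta M)" using rep[OF xy(2)] by blast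
    have "x = rpoly (pcompose P (monom 1 M)) (zeta (N * M))" using lift(1)[of N M P] N M by simp
    moreover have "y = rpoly (pcompose Q (monom 1 N)) (zeta (N * M))"
      using lift(1)[of M N Q] N M by (simp add: mult.commute)
    moreover have "N * M > 0" using N M by simp
    ultimately show ?thesis by blast
  qed
  have hom: "complex_hom Qcyc \<sigma>"
    unfolding complex_hom_def
  proof (intro conjI ballI)
    show "\<sigma> 1 = 1" using \<sigma>[of 1 1] by simp
  next
    fix x y assume "x \<in> Qcyc" "y \<in> Qcyc"
    then obtain N P Q where N: "N > 0" and xy: "x = rpoly P (zeta N)" "y = rpoly Q (zeta N)"
      using rep2 by blast
    show "\<sigma> (x + y) = \<sigma> x + \<sigma> y"
      using \<sigma>[OF N, of P] \<sigma>[OF N, of Q] \<sigma>[OF N, of "P + Q"] by (simp add: xy hom_distribs)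
    show "\<sigma> (x * y) = \<sigma> x * \<sigma> y"
      using \<sigma>[OF N, of P] \<sigma>[OF N, of Q] \<sigma>[OF N, of "P * Q"] by (simp add: xy hom_distribs)
  qed
  have root: "\<sigma> z = z ^ A N" if Nz: "N > 0" "z ^ N = 1" for N z
  proof -
    obtain j where j: "z = zeta N ^ j" using root_of_unity_eq_zeta_power Nz by metis
    thus ?thesis using \<sigma>[OF Nz(1), of "monom 1 j"]
      by (simp add: hom_distribs poly_monom) (metis mult.commute power_mult)
  qed
  show ?thesis using hom root by blast
qed

text \<open>On \<open>cyc N\<close> the homomorphism is the substitution of
  \<open>zeta N ^ a\<close> for \<open>zeta N\<close>, which is undone by the exponent
  \<open>b\<close> inverse to \<open>a\<close> modulo \<open>N\<close>.\<close>

lemma complex_hom_image_Qcyc_prime_to: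
  assumes h: "complex_hom (Qcyc_prime_to p) \<sigma>"
  shows "\<sigma> ` Qcyc_prime_to p = Qcyc_prime_to p"
proof -
  note S = complex_subfield_Qcyc_prime_to[of p]
  have *: "\<sigma> ` cyc N = cyc N" if N: "N > 0" "coprime N p" for N
  proof -
    have zeta: "zeta N \<in> Qcyc_prime_to p"
      using root_of_unity_in_Qcyc_prime_to[OF zeta_power_order] N by blast
    then obtain a where a: "coprime a N" "\<And>z. z ^ N = 1 \<Longrightarrow> \<sigma> z = z ^ a"
      using root_of_unity_hom_exponent[OF S h N(1)] by blast
    have \<sigma>: "\<sigma> (rpoly P (zeta N)) = rpoly P (zeta N ^ a)" for P
      using complex_hom_rpoly[OF S h zeta, of P] a(2)[OF zeta_power_order[OF N(1)]] by simp
    obtain b where b: "[a * b = 1] (mod N)" using cong_solve_coprime_nat[OF a(1)] by auto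
    have ab: "(zeta N ^ a) ^ b = zeta N"
      using power_cong_exponent[OF zeta_power_order[OF N(1)] b] by (simp add: power_mult)
    show ?thesis
    proof
      show "\<sigma> ` cyc N \<subseteq> cyc N"
      proof safe
        fix x assume "x \<in> cyc N"
        then obtain P where "x = rpoly P (zeta N)" by (auto simp: cyc_def)
        hence "\<sigma> x = rpoly (pcompose P (monom 1 a)) (zeta N)" using \<sigma> by (simp add: rpoly_pcompose_monom)
        thus "\<sigma> x \<in> cyc N" unfolding cyc_def by (rule range_eqI)
      qed
      show "cyc N \<subseteq> \<sigma> ` cyc N"
      proof
        fix x assume "x \<in> cyc N"
        then obtain P where P: "x = rpoly P (zeta N)" by (auto simp: cyc_def)
        have "x = \<sigma> (rpoly (pcompose P (monom 1 b)) (zeta N))"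
          unfolding \<sigma> P by (simp add: rpoly_pcompose_monom ab)
        moreover have "rpoly (pcompose P (monom 1 b)) (zeta N) \<in> cyc N"
          unfolding cyc_def by (rule rangeI)
        ultimately show "x \<in> \<sigma> ` cyc N" by (rule image_eqI)
      qed
    qed
  qed
  show ?thesis unfolding Qcyc_prime_to_eq image_UN using * by auto
qed

text \<open>For \<open>p = 1\<close> the coprimality condition is void, so facts about the
  prime-to-\<open>p\<close> field specialise to the full field.\<close>

lemma Qcyc_prime_to_1: "Qcyc_prime_to 1 = Qcyc"
  by (simp add: Qcyc_prime_to_eq Qcyc_eq greaterThan_def)

lemma complex_hom_image_Qcyc: "complex_hom Qcyc \<sigma> \<Longrightarrow> \<sigma> ` Qcyc = Qcyc"
  using complex_hom_image_Qcyc_prime_to[of 1 \<sigma>] by (simp only: Qcyc_prime_to_1)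

lemma complex_hom_subset: "complex_hom S \<sigma> \<Longrightarrow> T \<subseteq> S \<Longrightarrow> complex_hom T \<sigma>"
  by (auto simp: complex_hom_def subset_iff)

text \<open>A homomorphism between fields automatically fixes the rationals and is injective, so of
  the conditions in \<open>gal\<close> only surjectivity remains.\<close>

lemma gal_eq:
  assumes S: "complex_subfield S"
  shows "gal S \<rat> = {\<sigma> \<in> extensional S. complex_hom S \<sigma> \<and> \<sigma> ` S = S}"
proof (intro Set.set_eqI iffI)
  fix \<sigma> assume "\<sigma> \<in> gal S \<rat>"
  thus "\<sigma> \<in> {\<sigma> \<in> extensional S. complex_hom S \<sigma> \<and> \<sigma> ` S = S}"
    by (simp add: gal_def Ring.ring_hom_def Bij_def bij_betw_def complex_hom_def)
next
  fix \<sigma> assume *: "\<sigma> \<in> {\<sigma> \<in> extensional S. complex_hom S \<sigma> \<and> \<sigma> ` S = S}"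
  hence hom: "complex_hom S \<sigma>" by simp
  note h = complex_homD[OF S hom]
  have "\<sigma> x = x" if "x \<in> \<rat>" for x
    using that h(14) by (auto elim!: Rats_cases)
  moreover have "\<sigma> \<in> Bij S" using * h(16) by (simp add: Bij_def bij_betw_def)
  moreover have "\<sigma> \<in> Ring.ring_hom (subring_of S) (subring_of S)"
    using * h(1,3,4) by (auto simp: Ring.ring_hom_def)
  ultimately show "\<sigma> \<in> gal S \<rat>" by (simp add: gal_def)
qed

lemma carrier_Gal [simp]: "carrier (Gal L K) = gal L K"
  by (simp add: Gal_def)

section \<open>Splitting roots of unity at \<open>p\<close>; Frobenius and inertia
  automorphisms\<close>

locale cyclotomic_prime =
  fixes p :: nat
  assumes prime_p: "prime p"
begin

abbreviation "L \<equiv> Qcyc"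
abbreviation "K \<equiv> Qcyc_prime_to p"

lemma p_gt_1: "p > 1" and p_pos: "p > 0"
  using prime_p by (simp_all add: prime_gt_Suc_0_nat prime_gt_0_nat)

lemma order_decompose:
  assumes "N > 0"
  obtains n k where "N = n * p ^ k" "n > 0" "coprime n p"
proof -
  obtain n where n: "N = p ^ multiplicity p N * n" "\<not> p dvd n"
    using multiplicity_decompose'[of N p] assms prime_p p_gt_1 by auto
  hence "coprime n p" using prime_p by (metis coprime_commute prime_imp_coprime)
  moreover have "n > 0" using n assms by (cases n) auto
  ultimately show ?thesis using that n by (metis mult.commute)
qed

lemma order_decompose_unique_dvd:
  assumes "n * p ^ k dvd m * p ^ l" "coprime n p" "coprime m p"
  shows "n dvd m" "k \<le> l"
proof -
  have 1: "n dvd m * p ^ l" "p ^ k dvd m * p ^ l" using assms(1) by (auto dest: dvd_mult_left dvd_mult_right)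
  thus "n dvd m" using assms(2) by (simp add: coprime_dvd_mult_left_iff)
  have "coprime (p ^ k) m" using assms(3) by (simp add: coprime_commute)
  hence "p ^ k dvd p ^ l" using 1(2) by (simp add: coprime_dvd_mult_right_iff)
  thus "k \<le> l" using p_gt_1 by (simp add: power_dvd_imp_le)
qed

text \<open>The exponents \<open>a\<close> and \<open>b\<close> are the Chinese remainder
  idempotents for \<open>n\<close> and \<open>p ^ k\<close>; since \<open>a + b\<close> is 1 modulo
  the order, \<open>z\<close> is the product of \<open>z ^ a\<close> and
  \<open>z ^ b\<close>.\<close>

lemma root_decompose:
  assumes "n > 0" "coprime n p" "z ^ (n * p ^ k) = (1 :: complex)"
  obtains u w where "u ^ n = 1" "w ^ (p ^ k) = 1" "z = u * w"
proof -
  have cop: "coprime n (p ^ k)" using assms(2) by simp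
  obtain a where a: "[a = 1] (mod n)" "[a = 0] (mod p ^ k)"
    using binary_chinese_remainder_nat[OF cop] by blast
  obtain b where b: "[b = 0] (mod n)" "[b = 1] (mod p ^ k)"
    using binary_chinese_remainder_nat[OF cop] by blast
  have "[a + b = 1] (mod n)" "[a + b = 1] (mod p ^ k)" using cong_add[OF a(1) b(1)] cong_add[OF a(2) b(2)] by simp_all
  hence "[a + b = 1] (mod n * p ^ k)" using cop by (rule coprime_cong_mult_nat)
  hence "z ^ (a + b) = z ^ 1" by (rule power_cong_exponent[OF assms(3)])
  hence 1: "z = z ^ a * z ^ b" by (simp add: power_add)
  have 2: "(z ^ a) ^ n = 1"
  proof -
    obtain c where c: "a = p ^ k * c" using a(2) unfolding cong_0_iff by (rule dvdE)
    hence "(z ^ a) ^ n = (z ^ (n * p ^ k)) ^ c" by (simp add: mult_ac flip: power_mult)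
    thus ?thesis using assms(3) by simp
  qed
  have 3: "(z ^ b) ^ (p ^ k) = 1"
  proof -
    obtain c where c: "b = n * c" using b(1) unfolding cong_0_iff by (rule dvdE)
    hence "(z ^ b) ^ (p ^ k) = (z ^ (n * p ^ k)) ^ c" by (simp add: mult_ac flip: power_mult)
    thus ?thesis using assms(3) by simp
  qed
  show ?thesis by (rule that[OF 2 3 1])
qed

lemma root_power_swap: "z ^ n = (1 :: complex) \<Longrightarrow> (z ^ m) ^ n = 1"
  by (metis mult.commute power_mult power_one)

lemma hom_eq_Qcyc:
  assumes h: "complex_hom L \<sigma>" "complex_hom L \<rho>"
    and e1: "\<And>z. z \<in> roots_prime_to p \<Longrightarrow> \<sigma> z = \<rho> z"
    and e2: "\<And>z. z \<in> roots_p_power p \<Longrightarrow> \<sigma> z = \<rho> z"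
    and x: "x \<in> L"
  shows "\<sigma> x = \<rho> x"
  using h[unfolded Qcyc_def] _ x[unfolded Qcyc_def]
proof (rule complex_hom_eq_generate_field)
  fix z assume "z \<in> roots_of_unity"
  then obtain N where N: "N > 0" "z ^ N = 1" by (auto simp: roots_of_unity_def)
  obtain n k where nk: "N = n * p ^ k" "n > 0" "coprime n p" using order_decompose N(1) by blast
  obtain u w where uw: "u ^ n = 1" "w ^ (p ^ k) = 1" "z = u * w"
    using root_decompose[of n z k] nk N by metis
  have R: "u \<in> roots_prime_to p" "w \<in> roots_p_power p"
    using uw nk by (auto simp: roots_prime_to_def roots_p_power_def)
  have U: "u \<in> L" "w \<in> L"
    using root_of_unity_in_Qcyc[OF uw(1) nk(2)] root_of_unity_in_Qcyc[OF uw(2)] p_pos by auto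
  show "\<sigma> z = \<rho> z"
    using complex_homD(4)[OF complex_subfield_Qcyc h(1) U] complex_homD(4)[OF complex_subfield_Qcyc h(2) U]
      e1[OF R(1)] e2[OF R(2)] uw(3) by simp
qed

text \<open>The prime-to-\<open>p\<close> exponents vary with the order through \<open>g\<close>,
  whereas one natural number \<open>c\<close> acts on all \<open>p\<close>-power roots at once. It
  stands for a p-adic unit; natural numbers coprime to \<open>p\<close> are dense among these, and
  every finite level only sees a residue class.\<close>

definition galois_ext :: "(nat \<Rightarrow> nat) \<Rightarrow> nat \<Rightarrow> (complex \<Rightarrow> complex) \<Rightarrow> bool" where
  "galois_ext g c \<sigma> \<longleftrightarrow> complex_hom L \<sigma> \<and>
     (\<forall>n z. n > 0 \<longrightarrow> coprime n p \<longrightarrow> z ^ n = 1 \<longrightarrow> \<sigma> z = z ^ g n) \<and>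
     (\<forall>k z. z ^ (p ^ k) = 1 \<longrightarrow> \<sigma> z = z ^ c)"

lemma galois_extD:
  assumes "galois_ext g c \<sigma>"
  shows "complex_hom L \<sigma>" "n > 0 \<Longrightarrow> coprime n p \<Longrightarrow> z ^ n = 1 \<Longrightarrow> \<sigma> z = z ^ g n"
    "z ^ (p ^ k) = 1 \<Longrightarrow> \<sigma> z = z ^ c"
  using assms unfolding galois_ext_def by blast+

text \<open>At order \<open>n * p ^ k\<close> the exponent is glued from \<open>g n\<close> and
  \<open>c\<close> by the Chinese remainder theorem. The predicate \<open>good\<close> quantifies
  over all decompositions of the order, so that the choice of an exponent does not depend on a
  chosen decomposition.\<close>

lemma galois_ext_exists:
  assumes g: "\<And>n. n > 0 \<Longrightarrow> coprime n p \<Longrightarrow> coprime (g n) n"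
    and compat: "\<And>n m. m > 0 \<Longrightarrow> coprime m p \<Longrightarrow> n dvd m \<Longrightarrow> [g m = g n] (mod n)"
    and c: "coprime c p"
  shows "\<exists>\<sigma>. galois_ext g c \<sigma>"
proof -
  define good where "good N a \<longleftrightarrow>
    (\<forall>n k. N = n * p ^ k \<longrightarrow> coprime n p \<longrightarrow> [a = g n] (mod n) \<and> [a = c] (mod p ^ k))" for N a
  have ex: "\<exists>a. good N a" if N: "N > 0" for N
  proof -
    obtain n k where nk: "N = n * p ^ k" "n > 0" "coprime n p" using order_decompose N by blast
    have "coprime n (p ^ k)" using nk(3) by simp
    then obtain a where a: "[a = g n] (mod n)" "[a = c] (mod p ^ k)"
      using binary_chinese_remainder_nat by blast
    have "good N a"
      unfolding good_def
    proof (intro allI impI)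
      fix m l assume ml: "N = m * p ^ l" "coprime m p"
      have "n dvd m" "k \<le> l"
        by (rule order_decompose_unique_dvd[of n k m l]; use ml nk in simp)+
      moreover have "m dvd n" "l \<le> k"
        by (rule order_decompose_unique_dvd[of m l n k]; use ml nk in simp)+
      ultimately have "m = n" "l = k" by (auto intro: dvd_antisym)
      thus "[a = g m] (mod m) \<and> [a = c] (mod p ^ l)" using a by simp
    qed
    thus ?thesis by blast
  qed
  define A where "A N = (SOME a. good N a)" for N
  have A: "[A (n * p ^ k) = g n] (mod n)" "[A (n * p ^ k) = c] (mod p ^ k)"
    if nk: "n > 0" "coprime n p" for n k
  proof -
    have "n * p ^ k > 0" using nk(1) p_pos by simp
    hence "good (n * p ^ k) (A (n * p ^ k))" unfolding A_def by (rule someI_ex[OF ex])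
    thus "[A (n * p ^ k) = g n] (mod n)" "[A (n * p ^ k) = c] (mod p ^ k)"
      using nk(2) unfolding good_def by blast+
  qed
  have cop: "coprime (A N) N" if N: "N > 0" for N
  proof -
    obtain n k where nk: "N = n * p ^ k" "n > 0" "coprime n p" using order_decompose N by blast
    have "coprime (A N) n"
      using A(1)[OF nk(2,3), of k] g[OF nk(2,3)] nk(1) by (metis cong_imp_coprime cong_sym)
    moreover have "coprime c (p ^ k)" using c by simp
    hence "coprime (A N) (p ^ k)"
      using A(2)[OF nk(2,3), of k] nk(1) by (metis cong_imp_coprime cong_sym)
    ultimately show ?thesis using nk(1) by simp
  qed
  have cmp: "[A M = A N] (mod N)" if M: "M > 0" "N dvd M" for N M
  proof -
    have N: "N > 0" using M by (cases N) auto
    obtain n k where nk: "N = n * p ^ k" "n > 0" "coprime n p" using order_decompose N by blast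
    obtain m l where ml: "M = m * p ^ l" "m > 0" "coprime m p" using order_decompose M(1) by blast
    have dvd: "n dvd m" "k \<le> l"
      by (rule order_decompose_unique_dvd[of n k m l]; use M(2) nk ml in simp)+
    have "[A M = g m] (mod n)" using A(1)[OF ml(2,3), of l] dvd(1) ml(1) cong_dvd_modulus_nat by blast
    also have "[g m = g n] (mod n)" using compat ml dvd by blast
    also have "[g n = A N] (mod n)" using A(1)[OF nk(2,3), of k] nk(1) cong_sym by blast
    finally have 1: "[A M = A N] (mod n)" .
    have "p ^ k dvd p ^ l" using dvd(2) by (rule le_imp_power_dvd)
    hence "[A M = c] (mod p ^ k)" using A(2)[OF ml(2,3), of l] ml(1) cong_dvd_modulus_nat by blast
    also have "[c = A N] (mod p ^ k)" using A(2)[OF nk(2,3), of k] nk(1) cong_sym by blast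
    finally have "[A M = A N] (mod p ^ k)" .
    thus ?thesis using 1 nk by (simp add: coprime_cong_mult_nat)
  qed
  obtain \<sigma> where \<sigma>: "complex_hom Qcyc \<sigma>" "\<And>N z. N > 0 \<Longrightarrow> z ^ N = 1 \<Longrightarrow> \<sigma> z = z ^ A N"
    using power_map_extends[of A, OF cop cmp] by blast
  have "\<sigma> z = z ^ g n" if z: "n > 0" "coprime n p" "z ^ n = 1" for n z
    using \<sigma>(2)[OF z(1,3)] power_cong_exponent[OF z(3) A(1)[OF z(1,2), of 0, simplified]] by simp
  moreover have "\<sigma> z = z ^ c" if z: "z ^ (p ^ k) = 1" for k z
    using \<sigma>(2)[OF _ z] power_cong_exponent[OF z, of "A (p ^ k)" c] A(2)[of 1 k] p_pos by simp
  ultimately show ?thesis using \<sigma>(1) unfolding galois_ext_def by blast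
qed

text \<open>The predicate \<open>galois_ext\<close> determines values on \<open>L\<close> only, and
  the choice is arbitrary elsewhere. Hence the equations for \<open>tau\<close> and
  \<open>sig\<close> carry membership in \<open>L\<close>.\<close>

definition tau :: "complex \<Rightarrow> complex" where
  "tau = (SOME \<sigma>. galois_ext (\<lambda>_. p) 1 \<sigma>)"

definition sig :: "nat \<Rightarrow> complex \<Rightarrow> complex" where
  "sig c = (SOME \<sigma>. galois_ext (\<lambda>_. 1) c \<sigma>)"

lemma tau_galois_ext: "galois_ext (\<lambda>_. p) 1 tau"
  unfolding tau_def
  by (rule someI_ex[of "galois_ext (\<lambda>_. p) 1"], rule galois_ext_exists) (simp_all add: coprime_commute)

lemma sig_galois_ext: "coprime c p \<Longrightarrow> galois_ext (\<lambda>_. 1) c (sig c)"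
  unfolding sig_def
  by (rule someI_ex[of "galois_ext (\<lambda>_. 1) c"], rule galois_ext_exists) simp_all

lemmas tau_hom = galois_extD(1)[OF tau_galois_ext]
lemmas tau_prime_to = galois_extD(2)[OF tau_galois_ext]
lemmas tau_p_power = galois_extD(3)[OF tau_galois_ext, unfolded power_one_right]
lemmas sig_hom = galois_extD(1)[OF sig_galois_ext]
lemmas sig_prime_to = galois_extD(2)[OF sig_galois_ext, unfolded power_one_right]
lemmas sig_p_power = galois_extD(3)[OF sig_galois_ext]

lemmas tauD = complex_homD[OF complex_subfield_Qcyc tau_hom]
lemmas sigD = complex_homD[OF complex_subfield_Qcyc sig_hom]

lemma tau_in [simp]: "x \<in> L \<Longrightarrow> tau x \<in> L"
  using complex_hom_image_Qcyc[OF tau_hom] by blast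

lemma sig_in [simp]: "coprime c p \<Longrightarrow> x \<in> L \<Longrightarrow> sig c x \<in> L"
  using complex_hom_image_Qcyc[OF sig_hom] by blast

lemma complex_hom_compose:
  assumes "complex_hom L \<sigma>" "complex_hom L \<rho>"
  shows "complex_hom L (\<lambda>x. \<sigma> (\<rho> x))"
proof -
  have "\<rho> x \<in> L" if "x \<in> L" for x using complex_hom_image_Qcyc[OF assms(2)] that by blast
  thus ?thesis using assms by (simp add: complex_hom_def)
qed

lemma sig_tau:
  assumes "coprime c p" "x \<in> L"
  shows "sig c (tau x) = tau (sig c x)"
proof (rule hom_eq_Qcyc[of "\<lambda>x. sig c (tau x)" "\<lambda>x. tau (sig c x)", OF _ _ _ _ assms(2)])
  show "complex_hom L (\<lambda>x. sig c (tau x))" "complex_hom L (\<lambda>x. tau (sig c x))"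
    using complex_hom_compose[OF sig_hom[OF assms(1)] tau_hom]
      complex_hom_compose[OF tau_hom sig_hom[OF assms(1)]] by blast+
next
  fix z assume "z \<in> roots_prime_to p"
  then obtain n where n: "n > 0" "coprime n p" "z ^ n = 1" by (auto simp: roots_prime_to_def)
  thus "sig c (tau z) = tau (sig c z)"
    using root_power_swap[OF n(3), of p] by (simp add: tau_prime_to[of n] sig_prime_to[of _ n] assms)
next
  fix z assume "z \<in> roots_p_power p"
  then obtain k where k: "z ^ (p ^ k) = 1" by (auto simp: roots_p_power_def)
  thus "sig c (tau z) = tau (sig c z)"
    using root_power_swap[OF k, of c] by (simp add: tau_p_power[of _ k] sig_p_power[of _ _ k] assms)
qed

lemma sig_sig:
  assumes "coprime c p" "coprime d p" "x \<in> L"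
  shows "sig c (sig d x) = sig (c * d) x"
proof (rule hom_eq_Qcyc[of "\<lambda>x. sig c (sig d x)", OF _ _ _ _ assms(3)])
  show "complex_hom L (\<lambda>x. sig c (sig d x))" "complex_hom L (sig (c * d))"
    using complex_hom_compose[OF sig_hom[OF assms(1)] sig_hom[OF assms(2)]] sig_hom[of "c * d"] assms
    by simp_all
next
  fix z assume "z \<in> roots_prime_to p"
  then obtain n where n: "n > 0" "coprime n p" "z ^ n = 1" by (auto simp: roots_prime_to_def)
  thus "sig c (sig d z) = sig (c * d) z" using assms by (simp add: sig_prime_to[of _ n])
next
  fix z assume "z \<in> roots_p_power p"
  then obtain k where k: "z ^ (p ^ k) = 1" by (auto simp: roots_p_power_def)
  thus "sig c (sig d z) = sig (c * d) z"
    using assms root_power_swap[OF k, of d]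
    by (simp add: sig_p_power[of _ _ k] mult.commute flip: power_mult)
qed

lemma K_subset_L: "x \<in> K \<Longrightarrow> x \<in> L"
  using Qcyc_prime_to_subset by blast

lemma hom_eq_K:
  assumes "complex_hom K \<sigma>" "complex_hom K \<rho>"
    and "\<And>z. z \<in> roots_prime_to p \<Longrightarrow> \<sigma> z = \<rho> z" and "x \<in> K"
  shows "\<sigma> x = \<rho> x"
  using assms unfolding Qcyc_prime_to_def by (rule complex_hom_eq_generate_field)

lemma root_prime_to_in_K: "z \<in> roots_prime_to p \<Longrightarrow> z \<in> K"
  using root_of_unity_in_Qcyc_prime_to by (auto simp: roots_prime_to_def)

lemma root_p_power_in_L: "z \<in> roots_p_power p \<Longrightarrow> z \<in> L"
  using root_of_unity_in_Qcyc p_pos by (auto simp: roots_p_power_def)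

lemma sig_K:
  assumes c: "coprime c p" and x: "x \<in> K"
  shows "sig c x = x"
proof (rule hom_eq_K[of "sig c" "\<lambda>x. x", OF _ _ _ x])
  show "complex_hom K (sig c)" by (rule complex_hom_subset[OF sig_hom[OF c] Qcyc_prime_to_subset])
  show "complex_hom K (\<lambda>x. x)" by (simp add: complex_hom_def)
  fix z assume "z \<in> roots_prime_to p"
  then obtain n where "n > 0" "coprime n p" "z ^ n = 1" by (auto simp: roots_prime_to_def)
  thus "sig c z = z" by (rule sig_prime_to[OF c])
qed

lemma p_power_root_sum_Rats:
  assumes "w ^ (p ^ k) = (1 :: complex)"
  shows "(\<Sum>a<p ^ k. w ^ a) \<in> \<rat>"
proof (cases "w = 1")
  case False
  have "(\<Sum>a<p ^ k. w ^ a) = 0" using assms False by (simp add: geometric_sum)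
  thus ?thesis by simp
qed simp

text \<open>The sum over the units is the sum over all residues minus the sum over the multiples of
  \<open>p\<close>. Both are full geometric sums over \<open>p\<close>-power roots of unity, hence
  rational.\<close>

lemma Ramanujan_sum_Rats:
  assumes "w ^ (p ^ Suc k) = (1 :: complex)"
  shows "(\<Sum>a | a < p ^ Suc k \<and> coprime a p. w ^ a) \<in> \<rat>"
proof -
  have inj: "inj_on (\<lambda>b. p * b) {..<p ^ k}" using p_pos by (auto simp: inj_on_def)
  have eq: "{a. a < p ^ Suc k \<and> coprime a p} = {..<p ^ Suc k} - (\<lambda>b. p * b) ` {..<p ^ k}"
  proof (intro Set.set_eqI iffI)
    fix a assume "a \<in> {a. a < p ^ Suc k \<and> coprime a p}"
    thus "a \<in> {..<p ^ Suc k} - (\<lambda>b. p * b) ` {..<p ^ k}" using p_gt_1 by auto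
  next
    fix a assume a: "a \<in> {..<p ^ Suc k} - (\<lambda>b. p * b) ` {..<p ^ k}"
    have "\<not> p dvd a"
    proof
      assume "p dvd a"
      then obtain b where "a = p * b" by (rule dvdE)
      thus False using a p_pos by auto
    qed
    hence "coprime p a" using prime_p by (rule prime_imp_coprime[rotated])
    thus "a \<in> {a. a < p ^ Suc k \<and> coprime a p}" using a by (simp add: coprime_commute)
  qed
  have sub: "(\<lambda>b. p * b) ` {..<p ^ k} \<subseteq> {..<p ^ Suc k}" using p_pos by auto
  have "(\<Sum>a | a < p ^ Suc k \<and> coprime a p. w ^ a)
      = (\<Sum>a<p ^ Suc k. w ^ a) - (\<Sum>a\<in>(\<lambda>b. p * b) ` {..<p ^ k}. w ^ a)"
    unfolding eq by (rule sum_diff) (use sub in auto)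
  also have "(\<Sum>a\<in>(\<lambda>b. p * b) ` {..<p ^ k}. w ^ a) = (\<Sum>b<p ^ k. (w ^ p) ^ b)"
    by (subst sum.reindex[OF inj]) (simp add: power_mult)
  finally show ?thesis
    using p_power_root_sum_Rats[OF assms] p_power_root_sum_Rats[of "w ^ p" k] assms
    by (simp add: power_mult)
qed

text \<open>Averaging over the inertia group projects onto the prime-to-\<open>p\<close> part.\<close>

lemma sig_fixed_in_K:
  assumes x: "x \<in> L" and fixed: "\<And>c. coprime c p \<Longrightarrow> sig c x = x"
  shows "x \<in> K"
proof -
  obtain N where N: "N > 0" "x \<in> cyc N" using x by (auto simp: Qcyc_eq)
  obtain n l where nl: "N = n * p ^ l" "n > 0" "coprime n p" using order_decompose N(1) by blast
  \<comment> \<open>The extra factor \<open>p\<close> keeps the exponent of \<open>p\<close>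
    positive, so that the set of units averaged over is nonempty even when \<open>N\<close> is prime
    to \<open>p\<close>.\<close>
  define M where "M = n * p ^ Suc l"
  have M0: "M > 0" using nl p_pos by (simp add: M_def)
  have "M = N * p" by (simp add: M_def nl mult_ac)
  hence "x \<in> cyc M" using cyc_mono[OF N(1) p_pos] N(2) by auto
  then obtain P where P: "x = rpoly P (zeta M)" by (auto simp: cyc_def)
  define U where "U = {a. a < p ^ Suc l \<and> coprime a p}"
  have U: "finite U" "\<And>a. a \<in> U \<Longrightarrow> coprime a p" by (auto simp: U_def)
  have "1 < p ^ Suc l" using p_gt_1 by (rule one_less_power) simp
  hence "1 \<in> U" by (simp add: U_def)
  hence card: "card U > 0" using U by (auto simp: card_gt_0_iff)
  have zL: "zeta M \<in> L" using root_of_unity_in_Qcyc[OF zeta_power_order] M0 by blast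
  have tr: "(\<Sum>a\<in>U. sig a (zeta M ^ i)) \<in> K" for i
  proof -
    have "(zeta M ^ i) ^ (n * p ^ Suc l) = 1"
      using root_power_swap[OF zeta_power_order[OF M0]] unfolding M_def by blast
    then obtain u w where uw: "u ^ n = 1" "w ^ (p ^ Suc l) = 1" "zeta M ^ i = u * w"
      using root_decompose[OF nl(2,3)] by blast
    have L: "u \<in> L" "w \<in> L"
      using root_of_unity_in_Qcyc[OF uw(1) nl(2)] root_of_unity_in_Qcyc[OF uw(2)] p_pos by auto
    have "(\<Sum>a\<in>U. sig a (zeta M ^ i)) = (\<Sum>a\<in>U. u * w ^ a)"
    proof (rule sum.cong)
      fix a assume "a \<in> U"
      hence a: "coprime a p" using U by blast
      show "sig a (zeta M ^ i) = u * w ^ a"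
        unfolding uw(3) using sigD(4)[OF a L] sig_prime_to[OF a nl(2,3) uw(1)] sig_p_power[OF a uw(2)] by simp
    qed simp
    also have "\<dots> = u * (\<Sum>a\<in>U. w ^ a)" by (simp add: sum_distrib_left)
    finally have *: "(\<Sum>a\<in>U. sig a (zeta M ^ i)) = u * (\<Sum>a\<in>U. w ^ a)" .
    have "(\<Sum>a\<in>U. w ^ a) \<in> K"
      using Ramanujan_sum_Rats[OF uw(2)] Qcyc_prime_to_closed(15) unfolding U_def by blast
    thus ?thesis unfolding *
      using root_of_unity_in_Qcyc_prime_to[OF uw(1) nl(2,3)] Qcyc_prime_to_closed(6) by blast
  qed
  have "of_nat (card U) * x = (\<Sum>a\<in>U. sig a x)" using fixed U by simp
  also have "\<dots> = (\<Sum>a\<in>U. \<Sum>i\<le>degree P. of_rat (coeff P i) * sig a (zeta M ^ i))"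
  proof (rule sum.cong)
    fix a assume "a \<in> U"
    note h = sigD[OF U(2)[OF this]]
    have *: "x = (\<Sum>i\<le>degree P. of_rat (coeff P i) * zeta M ^ i)"
      unfolding P poly_altdef by simp
    have "sig a x = (\<Sum>i\<le>degree P. sig a (of_rat (coeff P i) * zeta M ^ i))"
      unfolding * by (rule h(11)) (intro Qcyc_closed zL)
    also have "\<dots> = (\<Sum>i\<le>degree P. of_rat (coeff P i) * sig a (zeta M ^ i))"
      by (intro sum.cong refl) (subst h(4), auto intro: Qcyc_closed zL simp: h(14))
    finally show "sig a x = \<dots>" .
  qed simp
  also have "\<dots> = (\<Sum>i\<le>degree P. of_rat (coeff P i) * (\<Sum>a\<in>U. sig a (zeta M ^ i)))"
    by (subst sum.swap) (simp add: sum_distrib_left)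
  finally have "of_nat (card U) * x = \<dots>" .
  moreover have "\<dots> \<in> K" by (intro Qcyc_prime_to_closed(11) Qcyc_prime_to_closed(6) Qcyc_prime_to_closed(14) tr)
  ultimately have "of_nat (card U) * x / of_nat (card U) \<in> K"
    using Qcyc_prime_to_closed(8) Qcyc_prime_to_closed(12) by metis
  thus ?thesis using card by simp
qed

abbreviation "F \<equiv> Fr_fixed p"

lemma Fr_eq: "Fr p = restrict tau K"
  unfolding Fr_def
proof (rule the_equality)
  have h: "complex_hom K (restrict tau K)"
    using complex_hom_subset[OF tau_hom Qcyc_prime_to_subset] Qcyc_prime_to_closed(1,5,6)
    by (simp add: complex_hom_def)
  have z: "restrict tau K z = z ^ p" if r: "z \<in> roots_prime_to p" for z
  proof -
    obtain n where "n > 0" "coprime n p" "z ^ n = 1" using r by (auto simp: roots_prime_to_def)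
    hence "tau z = z ^ p" by (rule tau_prime_to)
    thus ?thesis using root_prime_to_in_K[OF r] by simp
  qed
  show "restrict tau K \<in> carrier (G_p p) \<and> (\<forall>z\<in>roots_prime_to p. restrict tau K z = z ^ p)"
    using h z complex_hom_image_Qcyc_prime_to[OF h]
    by (simp add: gal_eq[OF complex_subfield_Qcyc_prime_to])
  fix \<sigma> assume "\<sigma> \<in> carrier (G_p p) \<and> (\<forall>z\<in>roots_prime_to p. \<sigma> z = z ^ p)"
  hence \<sigma>: "\<sigma> \<in> extensional K" "complex_hom K \<sigma>" "\<And>z. z \<in> roots_prime_to p \<Longrightarrow> \<sigma> z = z ^ p"
    by (auto simp: gal_eq[OF complex_subfield_Qcyc_prime_to])
  show "\<sigma> = restrict tau K"
  proof (rule extensionalityI[OF \<sigma>(1)])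
    fix x assume "x \<in> K"
    thus "\<sigma> x = restrict tau K x"
      by (rule hom_eq_K[OF \<sigma>(2) h, rotated]) (simp only: \<sigma>(3) z)
  qed simp
qed

lemma F_eq_K: "F = {x \<in> K. tau x = x}"
  by (auto simp: Fr_fixed_def Fr_eq)

lemma F_eq: "F = {x \<in> L. tau x = x \<and> (\<forall>c. coprime c p \<longrightarrow> sig c x = x)}"
proof -
  have "x \<in> K \<longleftrightarrow> x \<in> L \<and> (\<forall>c. coprime c p \<longrightarrow> sig c x = x)" for x
    using sig_fixed_in_K[of x] sig_K[of _ x] K_subset_L[of x] by metis
  thus ?thesis unfolding F_eq_K by blast
qed

lemma complex_subfield_F: "complex_subfield F"
  unfolding complex_subfield_def F_eq_K
  using K_subset_L by (simp add: Qcyc_prime_to_closed(1,3-6) tauD)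

lemmas F_closed = complex_subfieldD[OF complex_subfield_F]

lemma F_subset_K: "x \<in> F \<Longrightarrow> x \<in> K" and F_subset_L: "x \<in> F \<Longrightarrow> x \<in> L"
  by (auto simp: F_eq_K K_subset_L)

text \<open>The automorphism supplies an exponent for each order prime to \<open>p\<close>. These
  are compatible because \<open>zeta n\<close> is also a root of unity of every order that is a
  multiple of \<open>n\<close>. Exponent 1 on the \<open>p\<close>-power roots then gives the
  lift.\<close>

lemma galois_ext_of_gal:
  assumes "\<gamma> \<in> carrier (G_p p)"
  shows "\<exists>g \<sigma>. galois_ext g 1 \<sigma> \<and> (\<forall>x\<in>K. \<sigma> x = \<gamma> x)"
proof -
  have \<gamma>: "complex_hom K \<gamma>" using assms by (simp add: gal_eq[OF complex_subfield_Qcyc_prime_to])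
  have zeta: "zeta n \<in> K" if "n > 0" "coprime n p" for n
    using root_of_unity_in_Qcyc_prime_to[OF zeta_power_order] that by blast
  have "\<exists>a. coprime a n \<and> (\<forall>z. z ^ n = 1 \<longrightarrow> \<gamma> z = z ^ a)" if n: "n > 0" "coprime n p" for n
    using root_of_unity_hom_exponent[OF complex_subfield_Qcyc_prime_to \<gamma> n(1) zeta[OF n]] by blast
  then obtain g where g: "\<And>n. n > 0 \<Longrightarrow> coprime n p \<Longrightarrow> coprime (g n) n"
    "\<And>n z. n > 0 \<Longrightarrow> coprime n p \<Longrightarrow> z ^ n = 1 \<Longrightarrow> \<gamma> z = z ^ g n"
    by metis
  have compat: "[g m = g n] (mod n)" if m: "m > 0" "coprime m p" "n dvd m" for m n
  proof -
    have n: "n > 0" "coprime n p" using m by (auto intro: Nat.gr0I coprime_divisors[OF m(3) dvd_refl])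
    obtain q where q: "m = n * q" using m(3) by (rule dvdE)
    have "zeta n ^ m = 1" by (simp add: q power_mult zeta_power_order n)
    hence "zeta n ^ g m = zeta n ^ g n"
      using g(2)[OF m(1,2)] g(2)[OF n zeta_power_order[OF n(1)]] by simp
    thus ?thesis using zeta_power_eq_iff[OF n(1)] by simp
  qed
  obtain \<sigma> where \<sigma>: "galois_ext g 1 \<sigma>" using galois_ext_exists[OF g(1) compat, of 1] by auto
  have eq: "\<sigma> x = \<gamma> x" if "x \<in> K" for x
  proof (rule hom_eq_K[OF _ \<gamma> _ that])
    show "complex_hom K \<sigma>"
      by (rule complex_hom_subset[OF galois_extD(1)[OF \<sigma>] Qcyc_prime_to_subset])
    fix z assume "z \<in> roots_prime_to p"
    then obtain n where n: "n > 0" "coprime n p" "z ^ n = 1" by (auto simp: roots_prime_to_def)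
    show "\<sigma> z = \<gamma> z" using galois_extD(2)[OF \<sigma> n] g(2)[OF n] by simp
  qed
  show ?thesis using \<sigma> eq by blast
qed

text \<open>Gives the definite description \<open>lift_gal\<close> its content: existence comes from
  gluing exponents, uniqueness from the fact that the two kinds of roots generate
  \<open>L\<close>.\<close>

lemma
  assumes \<gamma>: "\<gamma> \<in> carrier (G_p p)"
  shows lift_gal_carrier: "lift_gal p \<gamma> \<in> carrier (Gal L \<rat>)"
    and lift_gal_K: "\<And>x. x \<in> K \<Longrightarrow> lift_gal p \<gamma> x = \<gamma> x"
    and lift_gal_p_power: "\<And>z. z \<in> roots_p_power p \<Longrightarrow> lift_gal p \<gamma> z = z"
    and lift_gal_unique: "\<And>\<sigma>. \<sigma> \<in> carrier (Gal L \<rat>) \<Longrightarrow> (\<And>x. x \<in> K \<Longrightarrow> \<sigma> x = \<gamma> x) \<Longrightarrow>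
      (\<And>z. z \<in> roots_p_power p \<Longrightarrow> \<sigma> z = z) \<Longrightarrow> \<sigma> = lift_gal p \<gamma>"
proof -
  define Q where "Q \<sigma> \<longleftrightarrow> \<sigma> \<in> carrier (Gal L \<rat>) \<and> (\<forall>x\<in>K. \<sigma> x = \<gamma> x) \<and> (\<forall>z\<in>roots_p_power p. \<sigma> z = z)" for \<sigma>
  have uniq: "\<sigma> = \<rho>" if Q: "Q \<sigma>" "Q \<rho>" for \<sigma> \<rho>
  proof -
    have e: "\<sigma> \<in> extensional L" "\<rho> \<in> extensional L" and h: "complex_hom L \<sigma>" "complex_hom L \<rho>"
      using Q by (simp_all add: Q_def gal_eq[OF complex_subfield_Qcyc])
    have "\<sigma> x = \<rho> x" if "x \<in> L" for x
      by (rule hom_eq_Qcyc[OF h _ _ that]) (use Q root_prime_to_in_K in \<open>simp_all add: Q_def\<close>)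
    thus ?thesis by (rule extensionalityI[OF e])
  qed
  obtain g \<sigma> where \<sigma>: "galois_ext g 1 \<sigma>" "\<And>x. x \<in> K \<Longrightarrow> \<sigma> x = \<gamma> x"
    using galois_ext_of_gal[OF \<gamma>] by blast
  have h: "complex_hom L (restrict \<sigma> L)"
    using galois_extD(1)[OF \<sigma>(1)] Qcyc_closed(1,5,6) by (simp add: complex_hom_def)
  have "\<sigma> z = z" if "z \<in> roots_p_power p" for z
    using that galois_extD(3)[OF \<sigma>(1), of z] by (auto simp: roots_p_power_def)
  hence Q0: "Q (restrict \<sigma> L)"
    using h complex_hom_image_Qcyc[OF h] \<sigma>(2) K_subset_L root_p_power_in_L
    by (simp add: Q_def gal_eq[OF complex_subfield_Qcyc])
  have "Q (THE \<sigma>. Q \<sigma>)" by (rule theI[of Q, OF Q0]) (rule uniq[OF _ Q0])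
  moreover have "(THE \<sigma>. Q \<sigma>) = lift_gal p \<gamma>" unfolding lift_gal_def Q_def ..
  ultimately have Q: "Q (lift_gal p \<gamma>)" by simp
  thus "lift_gal p \<gamma> \<in> carrier (Gal L \<rat>)" "\<And>x. x \<in> K \<Longrightarrow> lift_gal p \<gamma> x = \<gamma> x"
    "\<And>z. z \<in> roots_p_power p \<Longrightarrow> lift_gal p \<gamma> z = z"
    by (auto simp: Q_def)
  show "\<sigma> = lift_gal p \<gamma>" if "\<sigma> \<in> carrier (Gal L \<rat>)" "\<And>x. x \<in> K \<Longrightarrow> \<sigma> x = \<gamma> x"
      "\<And>z. z \<in> roots_p_power p \<Longrightarrow> \<sigma> z = z" for \<sigma>
    by (rule uniq[OF _ Q]) (use that in \<open>simp add: Q_def\<close>)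
qed

end

lemma complex_subfield_ipoly: "complex_subfield S \<Longrightarrow> z \<in> S \<Longrightarrow> ipoly P z \<in> S"
  by (induction P) (simp_all add: hom_distribs complex_subfieldD)

lemma complex_hom_ipoly:
  assumes "complex_subfield S" "complex_hom S \<sigma>" "z \<in> S"
  shows "\<sigma> (ipoly P z) = ipoly P (\<sigma> z)"
proof -
  note cl = complex_subfieldD[OF assms(1)] and h = complex_homD[OF assms(1,2)]
  show ?thesis
    by (induction P) (simp_all add: hom_distribs h cl assms(3) complex_subfield_ipoly[OF assms(1,3)])
qed

section \<open>Cyclotomic integers whose order has a prescribed \<open>p\<close>-part\<close>

context cyclotomic_prime
begin

text \<open>The union over all \<open>n\<close> prime to \<open>p\<close> of the rings of integer
  polynomials in \<open>zeta (n * p ^ k)\<close>. Only the \<open>p\<close>-part of the order is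
  fixed, because the uniformiser \<open>unif k\<close> depends on nothing else.\<close>

definition integers :: "nat \<Rightarrow> complex set" where
  "integers k = {ipoly P (zeta (n * p ^ k)) | n P. n > 0 \<and> coprime n p}"

lemma integersE:
  assumes "x \<in> integers k"
  obtains n P where "n > 0" "coprime n p" "x = ipoly P (zeta (n * p ^ k))"
  using assms unfolding integers_def by blast

lemma integers_lift:
  assumes "m > 0" "n > 0"
  shows "\<exists>Q. ipoly P (zeta (n * p ^ k)) = ipoly Q (zeta (n * m * p ^ (k + l)))"
proof -
  have "zeta (n * p ^ k) = zeta (n * p ^ k * (m * p ^ l)) ^ (m * p ^ l)"
    by (rule zeta_mult_power[symmetric]) (use assms p_pos in auto)
  also have "n * p ^ k * (m * p ^ l) = n * m * p ^ (k + l)" by (simp add: power_add mult_ac)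
  finally have "ipoly P (zeta (n * p ^ k)) = ipoly (pcompose P (monom 1 (m * p ^ l))) (zeta (n * m * p ^ (k + l)))"
    by (simp only: ipoly_pcompose_monom)
  thus ?thesis by blast
qed

lemma integers_common:
  assumes "x \<in> integers k" "y \<in> integers k"
  obtains n P Q where "n > 0" "coprime n p" "x = ipoly P (zeta (n * p ^ k))" "y = ipoly Q (zeta (n * p ^ k))"
proof -
  obtain n P where n: "n > 0" "coprime n p" "x = ipoly P (zeta (n * p ^ k))" using assms(1) by (rule integersE)
  obtain m Q where m: "m > 0" "coprime m p" "y = ipoly Q (zeta (m * p ^ k))" using assms(2) by (rule integersE)
  obtain P' where P': "x = ipoly P' (zeta (n * m * p ^ k))"
    using integers_lift[of m n P k 0] n m by auto
  obtain Q' where Q': "y = ipoly Q' (zeta (n * m * p ^ k))"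
    using integers_lift[of n m Q k 0] n m by (auto simp: mult.commute)
  show ?thesis using that[of "n * m" P' Q'] n m P' Q' by simp
qed

lemma integers_add [intro]: "x \<in> integers k \<Longrightarrow> y \<in> integers k \<Longrightarrow> x + y \<in> integers k"
  and integers_mult [intro]: "x \<in> integers k \<Longrightarrow> y \<in> integers k \<Longrightarrow> x * y \<in> integers k"
proof -
  assume "x \<in> integers k" "y \<in> integers k"
  then obtain n P Q where n: "n > 0" "coprime n p"
    and eq: "x = ipoly P (zeta (n * p ^ k))" "y = ipoly Q (zeta (n * p ^ k))" by (rule integers_common)
  have "x + y = ipoly (P + Q) (zeta (n * p ^ k))" "x * y = ipoly (P * Q) (zeta (n * p ^ k))"
    by (simp_all add: eq hom_distribs)
  thus "x + y \<in> integers k" "x * y \<in> integers k" unfolding integers_def using n by blast+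
qed

lemma integers_of_int [simp, intro]: "of_int a \<in> integers k"
proof -
  have "of_int a = ipoly [:a:] (zeta (1 * p ^ k))" by (simp add: hom_distribs)
  moreover have "(0::nat) < 1" "coprime 1 p" by simp_all
  ultimately show ?thesis unfolding integers_def by blast
qed

lemma integers_of_nat [simp, intro]: "of_nat a \<in> integers k"
  using integers_of_int[of "int a" k] by simp

lemma integers_0 [simp, intro]: "0 \<in> integers k" and integers_1 [simp, intro]: "1 \<in> integers k"
  using integers_of_int[of 0 k] integers_of_int[of 1 k] by simp_all

lemma integers_uminus [intro]: "x \<in> integers k \<Longrightarrow> - x \<in> integers k"
  using integers_mult[of "of_int (- 1)" k x] integers_of_int[of "- 1" k] by simp

lemma integers_diff [intro]: "x \<in> integers k \<Longrightarrow> y \<in> integers k \<Longrightarrow> x - y \<in> integers k"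
  using integers_add[of x k "- y"] integers_uminus by simp

lemma integers_power [intro]: "x \<in> integers k \<Longrightarrow> x ^ n \<in> integers k"
  by (induction n) auto

lemma integers_prod [intro]: "(\<And>i. i \<in> A \<Longrightarrow> f i \<in> integers k) \<Longrightarrow> prod f A \<in> integers k"
  by (induction A rule: infinite_finite_induct) auto

lemma integers_ipoly: "x \<in> integers k \<Longrightarrow> ipoly P x \<in> integers k"
  by (induction P) (auto simp: hom_distribs)

lemma integers_root: "n > 0 \<Longrightarrow> coprime n p \<Longrightarrow> z ^ (n * p ^ k) = 1 \<Longrightarrow> z \<in> integers k"
proof -
  assume n: "n > 0" "coprime n p" and z: "z ^ (n * p ^ k) = 1"
  have "n * p ^ k > 0" using n p_pos by simp
  then obtain j where "z = zeta (n * p ^ k) ^ j" using root_of_unity_eq_zeta_power z by blast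
  hence "z = ipoly (monom 1 j) (zeta (n * p ^ k))" by (simp add: hom_distribs poly_monom)
  thus "z \<in> integers k" unfolding integers_def using n by blast
qed

lemma integers_root_prime_to: "n > 0 \<Longrightarrow> coprime n p \<Longrightarrow> u ^ n = 1 \<Longrightarrow> u \<in> integers k"
  by (rule integers_root[of n]) (simp_all add: power_mult)

lemma integers_root_p_power: "w ^ (p ^ k) = 1 \<Longrightarrow> w \<in> integers k"
  by (rule integers_root[of 1]) simp_all

lemma zeta_decompose:
  assumes "n > 0" "coprime n p"
  obtains u w where "u ^ n = 1" "w ^ (p ^ k) = 1" "zeta (n * p ^ k) = u * w"
proof -
  have "n * p ^ k > 0" using assms p_pos by simp
  hence "zeta (n * p ^ k) ^ (n * p ^ k) = 1" by (rule zeta_power_order)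
  thus ?thesis using root_decompose[OF assms] that by blast
qed

lemma zeta_in_L: "n > 0 \<Longrightarrow> zeta n \<in> L"
  using root_of_unity_in_Qcyc[OF zeta_power_order] by blast

lemma integers_subset_L: "x \<in> integers k \<Longrightarrow> x \<in> L"
proof (elim integersE)
  fix n P assume n: "n > 0" and x: "x = ipoly P (zeta (n * p ^ k))"
  have "zeta (n * p ^ k) \<in> L" using n p_pos by (intro zeta_in_L) simp
  thus "x \<in> L" unfolding x by (rule complex_subfield_ipoly[OF complex_subfield_Qcyc])
qed

lemma integers_algebraic_int: "x \<in> integers k \<Longrightarrow> algebraic_int x"
proof (elim integersE)
  fix n P assume n: "n > 0" and x: "x = ipoly P (zeta (n * p ^ k))"
  have "n * p ^ k > 0" using n p_pos by simp
  thus "algebraic_int x" unfolding x using algebraic_int_ipoly_root_of_unity[OF zeta_power_order] by blast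
qed

text \<open>\<open>unif 0 = p\<close> lets the unramified case share the arguments for the ramified one.\<close>

definition unif :: "nat \<Rightarrow> complex" where
  "unif k = (if k = 0 then of_nat p else 1 - zeta (p ^ k))"

lemma unif_in [simp, intro]: "unif k \<in> integers k"
  using integers_root_p_power[OF zeta_power_order, of k] p_pos by (auto simp: unif_def)

lemma zeta_neq_1: "n > 1 \<Longrightarrow> zeta n \<noteq> 1"
  using zeta_power_eq_1_iff[of n 1] by auto

lemma unif_nonzero: "unif k \<noteq> 0"
proof (cases k)
  case 0
  thus ?thesis using p_pos by (simp add: unif_def)
next
  case (Suc l)
  have "1 < p ^ k" using p_gt_1 Suc by (intro one_less_power) auto
  thus ?thesis using zeta_neq_1[of "p ^ k"] Suc by (simp add: unif_def)
qed

section \<open>Congruences modulo \<open>p\<close> and modulo the uniformiser\<close>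

definition congr :: "nat \<Rightarrow> complex \<Rightarrow> complex \<Rightarrow> complex \<Rightarrow> bool" where
  "congr k m x y \<longleftrightarrow> (\<exists>c\<in>integers k. x - y = m * c)"

lemma congr_refl [simp, intro]: "congr k m x x"
  unfolding congr_def by (intro bexI[of _ 0]) auto

lemma congr_sym: "congr k m x y \<Longrightarrow> congr k m y x"
proof -
  assume "congr k m x y"
  then obtain c where c: "c \<in> integers k" "x - y = m * c" by (auto simp: congr_def)
  have "y - x = m * (- c)" using c(2) by (simp add: algebra_simps)
  thus ?thesis unfolding congr_def using c(1) by blast
qed

lemma congr_trans [trans]:
  assumes "congr k m x y" "congr k m y z" shows "congr k m x z"
proof -
  obtain c d where c: "c \<in> integers k" "x - y = m * c" and d: "d \<in> integers k" "y - z = m * d"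
    using assms by (auto simp: congr_def)
  have "x - z = m * (c + d)" using c(2) d(2) by (simp add: algebra_simps)
  thus ?thesis unfolding congr_def using c(1) d(1) by blast
qed

lemma congr_add:
  assumes "congr k m x y" "congr k m x' y'" shows "congr k m (x + x') (y + y')"
proof -
  obtain c d where c: "c \<in> integers k" "x - y = m * c" and d: "d \<in> integers k" "x' - y' = m * d"
    using assms by (auto simp: congr_def)
  have "x + x' - (y + y') = m * (c + d)" using c(2) d(2) by (simp add: algebra_simps)
  thus ?thesis unfolding congr_def using c(1) d(1) by blast
qed

lemma congr_mult:
  assumes "congr k m x y" "congr k m x' y'" "x' \<in> integers k" "y \<in> integers k"
  shows "congr k m (x * x') (y * y')"
proof -
  obtain c d where c: "c \<in> integers k" "x - y = m * c" and d: "d \<in> integers k" "x' - y' = m * d"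
    using assms by (auto simp: congr_def)
  have "x * x' - y * y' = (x - y) * x' + y * (x' - y')" by (simp add: algebra_simps)
  also have "\<dots> = m * (c * x' + y * d)" unfolding c d by (simp add: algebra_simps)
  finally show ?thesis unfolding congr_def using c(1) d(1) assms(3,4) by blast
qed

lemma congr_diff:
  assumes "congr k m x y" "congr k m x' y'" shows "congr k m (x - x') (y - y')"
proof -
  obtain c d where c: "c \<in> integers k" "x - y = m * c" and d: "d \<in> integers k" "x' - y' = m * d"
    using assms by (auto simp: congr_def)
  have "x - x' - (y - y') = m * (c - d)" using c(2) d(2) by (simp add: algebra_simps)
  thus ?thesis unfolding congr_def using c(1) d(1) by blast
qed

lemma congr_power:
  assumes "congr k m x y" "x \<in> integers k" "y \<in> integers k"
  shows "congr k m (x ^ n) (y ^ n)"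
  using assms by (induction n) (auto intro!: congr_mult)

lemma congr_sum: "(\<And>i. i \<in> A \<Longrightarrow> congr k m (f i) (g i)) \<Longrightarrow> congr k m (sum f A) (sum g A)"
  by (induction A rule: infinite_finite_induct) (auto intro!: congr_add)

lemma congr_prod:
  assumes "\<And>i. i \<in> A \<Longrightarrow> congr k m (f i) (g i)" "\<And>i. i \<in> A \<Longrightarrow> f i \<in> integers k"
    "\<And>i. i \<in> A \<Longrightarrow> g i \<in> integers k"
  shows "congr k m (prod f A) (prod g A)"
  using assms by (induction A rule: infinite_finite_induct) (auto intro!: congr_mult)

lemma congr_ipoly:
  assumes "congr k m x y" "x \<in> integers k" "y \<in> integers k"
  shows "congr k m (ipoly P x) (ipoly P y)"
  by (induction P) (auto simp: hom_distribs assms integers_ipoly intro!: congr_add congr_mult)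

lemma congr_weaken:
  assumes "congr k m x y" "congr k m' m 0"
  shows "congr k m' x y"
proof -
  obtain c d where c: "c \<in> integers k" "x - y = m * c" and d: "d \<in> integers k" "m - 0 = m' * d"
    using assms by (auto simp: congr_def)
  have "x - y = m' * (d * c)" using c(2) d(2) by simp
  thus ?thesis unfolding congr_def using c(1) d(1) by blast
qed

text \<open>For positive \<open>k\<close> the root \<open>w\<close> is a power of
  \<open>zeta (p ^ k)\<close>, which equals \<open>1 - unif k\<close>. For \<open>k = 0\<close> it
  is 1 itself.\<close>

lemma congr_p_root_1:
  assumes "w ^ (p ^ k) = 1"
  shows "congr k (unif k) w 1"
proof (cases "k = 0")
  case True
  thus ?thesis using assms by simp
next
  case False
  have pk: "p ^ k > 0" using p_pos by simp
  then obtain j where j: "w = zeta (p ^ k) ^ j" using root_of_unity_eq_zeta_power assms by blast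
  have z: "zeta (p ^ k) \<in> integers k" by (rule integers_root_p_power[OF zeta_power_order[OF pk]])
  have "zeta (p ^ k) - 1 = unif k * (- 1)" using False by (simp add: unif_def)
  hence "congr k (unif k) (zeta (p ^ k)) 1" unfolding congr_def using integers_uminus[OF integers_1] by blast
  from congr_power[OF this z integers_1, of j] show ?thesis by (simp add: j)
qed

text \<open>The \<open>p\<close> powers of a root of unity of exact order \<open>p\<close> sum to 0,
  while each of them is 1 modulo the uniformiser; comparing the two values of the sum gives
  \<open>p\<close>.\<close>

lemma congr_p_0: "congr k (unif k) (of_nat p) 0"
proof (cases k)
  case 0
  have "of_nat p - 0 = unif k * 1" by (simp add: unif_def 0)
  thus ?thesis unfolding congr_def using integers_1 by blast
next
  case (Suc l)
  have pk: "p ^ k > 0" using p_pos by simp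
  define y where "y = zeta (p ^ k) ^ (p ^ l)"
  have "y ^ p = zeta (p ^ k) ^ (p ^ k)" by (simp add: y_def Suc mult.commute flip: power_mult)
  hence yp: "y ^ p = 1" using zeta_power_order[OF pk] by simp
  have "y \<noteq> 1"
  proof
    assume "y = 1"
    hence "p ^ k dvd p ^ l" using zeta_power_eq_1_iff[OF pk] by (simp add: y_def)
    hence "k \<le> l" using p_gt_1 by (simp add: power_dvd_imp_le)
    thus False using Suc by simp
  qed
  hence sum0: "(\<Sum>i<p. y ^ i) = 0" using yp by (simp add: geometric_sum)
  have "y ^ (p ^ k) = 1" using yp by (simp add: Suc power_mult)
  hence y: "congr k (unif k) y 1" "y \<in> integers k" by (auto intro: congr_p_root_1 integers_root_p_power)
  have "congr k (unif k) (\<Sum>i<p. y ^ i) (\<Sum>i<p. 1 ^ i)"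
    by (intro congr_sum congr_power y integers_1)
  hence "congr k (unif k) 0 (of_nat p)" by (simp add: sum0)
  thus ?thesis by (rule congr_sym)
qed

lemma Frobenius_power_congr:
  assumes "z \<in> integers k"
  shows "congr k (of_nat p) (ipoly P z ^ (p ^ f)) (ipoly P (z ^ (p ^ f)))"
proof (induction f)
  case 0
  show ?case by simp
next
  case (Suc f)
  have in1: "ipoly P z \<in> integers k" "ipoly P (z ^ (p ^ f)) \<in> integers k"
    using assms by (auto intro: integers_ipoly)
  have "ipoly P z ^ (p ^ Suc f) = (ipoly P z ^ (p ^ f)) ^ p" by (simp only: power_Suc2 power_mult)
  also have "congr k (of_nat p) \<dots> (ipoly P (z ^ (p ^ f)) ^ p)"
    by (intro congr_power Suc in1 integers_power)
  also have "congr k (of_nat p) \<dots> (ipoly P ((z ^ (p ^ f)) ^ p))"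
  proof -
    obtain Q where "\<And>z. ipoly P z ^ p - ipoly P (z ^ p) = of_nat p * ipoly Q z"
      using ipoly_Frobenius[OF prime_p] by blast
    thus ?thesis unfolding congr_def using integers_ipoly[OF integers_power[OF assms]] by blast
  qed
  also have "(z ^ (p ^ f)) ^ p = z ^ (p ^ Suc f)" by (simp only: power_Suc2 power_mult)
  finally show ?case .
qed

text \<open>The form of total ramification that the division argument uses. Modulo \<open>p\<close>
  the power \<open>(1 - zeta (p ^ k)) ^ (p ^ k)\<close> may be computed termwise and becomes
  \<open>1 - 1\<close>.\<close>

lemma unif_power: "\<exists>M>0. congr k (of_nat p) (unif k ^ M) 0"
proof (cases "k = 0")
  case True
  have "unif k ^ 1 - 0 = of_nat p * 1" by (simp add: unif_def True)
  hence "congr k (of_nat p) (unif k ^ 1) 0" unfolding congr_def using integers_1 by blast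
  moreover have "(0::nat) < 1" by simp
  ultimately show ?thesis by blast
next
  case False
  have pk: "p ^ k > 0" using p_pos by simp
  have "unif k = ipoly [:1, -1:] (zeta (p ^ k))" using False by (simp add: unif_def hom_distribs)
  moreover have "congr k (of_nat p) (ipoly [:1, -1:] (zeta (p ^ k)) ^ (p ^ k)) (ipoly [:1, -1:] (zeta (p ^ k) ^ (p ^ k)))"
    by (rule Frobenius_power_congr[OF integers_root_p_power[OF zeta_power_order[OF pk]]])
  ultimately have "congr k (of_nat p) (unif k ^ (p ^ k)) 0"
    using zeta_power_order[OF pk] by (simp add: hom_distribs)
  thus ?thesis using pk by blast
qed

text \<open>With \<open>f = totient n\<close>, Euler's theorem makes the power \<open>p ^ f\<close>
  fix the prime-to-\<open>p\<close> part \<open>u\<close> of the root of unity. The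
  \<open>p\<close>-part \<open>w\<close> is 1 modulo the uniformiser, and so is each of its
  powers.\<close>

lemma Frobenius_power_fixed:
  assumes "c \<in> integers k"
  shows "\<exists>f>0. congr k (unif k) (c ^ (p ^ f)) c"
proof -
  obtain n P where n: "n > 0" "coprime n p" and c: "c = ipoly P (zeta (n * p ^ k))"
    using assms by (rule integersE)
  obtain u w where uw: "u ^ n = 1" "w ^ (p ^ k) = 1" "zeta (n * p ^ k) = u * w"
    using zeta_decompose[OF n] by blast
  have O: "u \<in> integers k" "w \<in> integers k"
    using integers_root_prime_to[OF n uw(1)] integers_root_p_power[OF uw(2)] .
  define f where "f = totient n"
  have f: "f > 0" using n by (simp add: f_def)
  have "[p ^ f = 1] (mod n)" unfolding f_def using n by (intro euler_theorem) (simp add: coprime_commute)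
  hence uf: "u ^ (p ^ f) = u" using power_cong_exponent[OF uw(1), of "p ^ f" 1] by simp
  have zO: "u * w \<in> integers k" using O by blast
  have "congr k (unif k) (c ^ (p ^ f)) (ipoly P ((u * w) ^ (p ^ f)))"
    unfolding c uw(3) by (rule congr_weaken[OF Frobenius_power_congr[OF zO] congr_p_0])
  also have "(u * w) ^ (p ^ f) = u * w ^ (p ^ f)" by (simp add: power_mult_distrib uf)
  also have "congr k (unif k) (ipoly P (u * w ^ (p ^ f))) (ipoly P (u * w))"
  proof (intro congr_ipoly congr_mult congr_refl O integers_mult integers_power)
    have "congr k (unif k) (w ^ (p ^ f)) 1"
      by (rule congr_p_root_1) (rule root_power_swap[OF uw(2)])
    thus "congr k (unif k) (w ^ (p ^ f)) w" using congr_p_root_1[OF uw(2)] congr_sym congr_trans by blast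
  qed
  finally show ?thesis using f unfolding c uw(3) by blast
qed

text \<open>Both automorphisms substitute into the polynomial that represents \<open>c\<close>:
  \<open>tau\<close> replaces \<open>u\<close> by \<open>u ^ p\<close>, and \<open>sig a\<close>
  replaces \<open>w\<close> by \<open>w ^ a\<close>. Since all powers of \<open>w\<close> are
  congruent to 1, the first becomes the Frobenius and the second becomes trivial.\<close>

lemma tau_sig_congr:
  assumes "c \<in> integers k"
  shows "congr k (unif k) (tau c) (c ^ p)" "coprime a p \<Longrightarrow> congr k (unif k) (sig a c) c"
    "tau c \<in> integers k" "coprime a p \<Longrightarrow> sig a c \<in> integers k"
proof -
  obtain n P where n: "n > 0" "coprime n p" and c: "c = ipoly P (zeta (n * p ^ k))"
    using assms by (rule integersE)
  obtain u w where uw: "u ^ n = 1" "w ^ (p ^ k) = 1" "zeta (n * p ^ k) = u * w"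
    using zeta_decompose[OF n] by blast
  have O: "u \<in> integers k" "w \<in> integers k"
    using integers_root_prime_to[OF n uw(1)] integers_root_p_power[OF uw(2)] .
  have UL: "u \<in> L" "w \<in> L" using O integers_subset_L by blast+
  have zO: "u * w \<in> integers k" using O by blast
  have zL: "u * w \<in> L" using zO integers_subset_L by blast
  have c': "c = ipoly P (u * w)" using c uw by simp
  have tau: "tau c = ipoly P (u ^ p * w)"
    unfolding c' complex_hom_ipoly[OF complex_subfield_Qcyc tau_hom zL]
    using tau_prime_to[OF n uw(1)] tau_p_power[OF uw(2)] tauD(4)[OF UL] by simp
  thus "tau c \<in> integers k" using O by (simp add: integers_ipoly integers_mult integers_power)
  have "congr k (unif k) (c ^ (p ^ 1)) (ipoly P ((u * w) ^ (p ^ 1)))"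
    unfolding c' by (rule congr_weaken[OF Frobenius_power_congr[OF zO] congr_p_0])
  also have "(u * w) ^ (p ^ 1) = u ^ p * w ^ p" by (simp add: power_mult_distrib)
  also have "congr k (unif k) (ipoly P (u ^ p * w ^ p)) (ipoly P (u ^ p * w))"
  proof (intro congr_ipoly congr_mult congr_refl O integers_mult integers_power)
    have "congr k (unif k) (w ^ p) 1" by (rule congr_p_root_1) (rule root_power_swap[OF uw(2)])
    thus "congr k (unif k) (w ^ p) w" using congr_p_root_1[OF uw(2)] congr_sym congr_trans by blast
  qed
  finally show "congr k (unif k) (tau c) (c ^ p)" unfolding tau using congr_sym by simp
  assume a: "coprime a p"
  have sig: "sig a c = ipoly P (u * w ^ a)"
    unfolding c' complex_hom_ipoly[OF complex_subfield_Qcyc sig_hom[OF a] zL]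
    using sig_prime_to[OF a n uw(1)] sig_p_power[OF a uw(2)] sigD(4)[OF a UL] by simp
  thus "sig a c \<in> integers k" using O by (simp add: integers_ipoly integers_mult integers_power)
  show "congr k (unif k) (sig a c) c" unfolding sig unfolding c'
  proof (intro congr_ipoly congr_mult congr_refl O integers_mult integers_power)
    have "congr k (unif k) (w ^ a) 1" by (rule congr_p_root_1) (rule root_power_swap[OF uw(2)])
    thus "congr k (unif k) (w ^ a) w" using congr_p_root_1[OF uw(2)] congr_sym congr_trans by blast
  qed
qed

lemma integers_mono: "x \<in> integers k \<Longrightarrow> x \<in> integers (k + l)"
proof (elim integersE)
  fix n P assume n: "n > 0" "coprime n p" and x: "x = ipoly P (zeta (n * p ^ k))"
  obtain Q where "x = ipoly Q (zeta (n * 1 * p ^ (k + l)))"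
    using integers_lift[of 1 n P k l] n x by auto
  thus "x \<in> integers (k + l)" unfolding integers_def using n by auto
qed

text \<open>The level is raised by one to make it positive, as the norms from finite level
  require.\<close>

lemma L_integers_quotient:
  assumes "x \<in> L"
  obtains k m where "m > (0::nat)" "of_nat m * x \<in> integers (Suc k)"
proof -
  obtain N P where N: "N > 0" "x = rpoly P (zeta N)" using assms by (auto simp: Qcyc_eq cyc_def)
  obtain n k where nk: "N = n * p ^ k" "n > 0" "coprime n p" using order_decompose N(1) by blast
  obtain m Q where m: "m > (0::nat)" "\<And>z. rpoly P z = ipoly Q z / of_nat m"
    by (rule rpoly_clear_denominator[of P]) blast
  have "of_nat m * x = ipoly Q (zeta (n * p ^ k))" using m N nk by simp
  hence "of_nat m * x \<in> integers k" unfolding integers_def using nk by blast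
  hence "of_nat m * x \<in> integers (k + 1)" by (rule integers_mono)
  thus ?thesis using that m(1) by simp
qed

lemma K_integers_quotient:
  assumes "x \<in> K"
  obtains m where "m > (0::nat)" "of_nat m * x \<in> integers 0"
proof -
  obtain n P where n: "n > 0" "coprime n p" "x = rpoly P (zeta n)"
    using assms by (auto simp: Qcyc_prime_to_eq cyc_def)
  obtain m Q where m: "m > (0::nat)" "\<And>z. rpoly P z = ipoly Q z / of_nat m"
    by (rule rpoly_clear_denominator[of P]) blast
  have "of_nat m * x = ipoly Q (zeta (n * p ^ 0))" using m n by simp
  hence "of_nat m * x \<in> integers 0" unfolding integers_def using n by blast
  thus ?thesis using that m(1) by blast
qed

end

section \<open>Real valuations\<close>

text \<open>Frees the valuation from the reduced fraction of \<open>quotient_of\<close>: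
  cross-multiplication and additivity of multiplicities give the same difference for every
  fraction.\<close>

lemma padic_val_quotient:
  assumes "prime p" "a \<noteq> 0" "b \<noteq> 0"
  shows "padic_val p (of_int a / of_int b) =
    ereal (real (multiplicity (int p) a) - real (multiplicity (int p) b))"
proof -
  obtain c d where cd: "quotient_of (of_int a / of_int b) = (c, d)"
    by (cases "quotient_of (of_int a / of_int b :: rat)")
  have d: "d > 0" using quotient_of_denom_pos[OF cd] .
  have eq: "(of_int a / of_int b :: rat) = of_int c / of_int d" using quotient_of_div[OF cd] .
  have "(of_int (a * d) :: rat) = of_int (c * b)" using eq d assms(3) by (simp add: field_simps)
  hence ad: "a * d = c * b" by (simp only: of_int_eq_iff)
  have c: "c \<noteq> 0" using ad assms(2) d by auto
  have p: "prime_elem (int p)" using assms(1) by auto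
  have "multiplicity (int p) a + multiplicity (int p) d = multiplicity (int p) c + multiplicity (int p) b"
    using prime_elem_multiplicity_mult_distrib[OF p] assms(2,3) c d ad by (metis less_irrefl)
  hence "real (multiplicity (int p) a) - real (multiplicity (int p) b)
      = real (multiplicity (int p) c) - real (multiplicity (int p) d)" by linarith
  moreover have "of_int a / of_int b \<noteq> (0 :: rat)" using assms by simp
  ultimately show ?thesis using cd by (simp add: padic_val_def)
qed

lemma padic_val_of_int:
  assumes "prime p" "a \<noteq> 0"
  shows "padic_val p (of_int a) = ereal (real (multiplicity (int p) a))"
  using padic_val_quotient[OF assms(1), of a 1] assms(2) by simp

lemma padic_val_prime: "prime p \<Longrightarrow> padic_val p (of_nat p) = 1"
  using padic_val_of_int[of p "int p"] by (auto simp: one_ereal_def multiplicity_self)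

lemma padic_val_coprime:
  assumes "prime p" "\<not> int p dvd a"
  shows "padic_val p (of_int a) = 0"
proof -
  have "a \<noteq> 0" using assms(2) by auto
  thus ?thesis using padic_val_of_int[OF assms(1)] assms(2)
    by (simp add: not_dvd_imp_multiplicity_0)
qed

lemma real_valuation_padic:
  assumes p: "prime p"
  shows "real_valuation UNIV (padic_val p)"
proof -
  have pe: "prime_elem (int p)" using p by auto
  have rep: "\<exists>a b. a \<noteq> 0 \<and> b \<noteq> 0 \<and> x = of_int a / of_int b" if x: "x \<noteq> 0" for x :: rat
  proof -
    obtain a b where ab: "quotient_of x = (a, b)" by (cases "quotient_of x")
    have "x = of_int a / of_int b" "b > 0" using quotient_of_div[OF ab] quotient_of_denom_pos[OF ab] by auto
    thus ?thesis using x by (intro exI[of _ a] exI[of _ b]) auto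
  qed
  have mult: "padic_val p (x * y) = padic_val p x + padic_val p y" for x y
  proof (cases "x = 0 \<or> y = 0")
    case True
    thus ?thesis by (auto simp: padic_val_def)
  next
    case False
    then obtain a b c d where r: "a \<noteq> 0" "b \<noteq> 0" "x = of_int a / of_int b" "c \<noteq> 0" "d \<noteq> 0" "y = of_int c / of_int d"
      using rep by metis
    have "x * y = of_int (a * c) / of_int (b * d)" using r by simp
    hence "padic_val p (x * y) = ereal (real (multiplicity (int p) (a * c)) - real (multiplicity (int p) (b * d)))"
      using padic_val_quotient[OF p, of "a * c" "b * d"] r by simp
    also have "\<dots> = padic_val p x + padic_val p y"
      using padic_val_quotient[OF p r(1,2)] padic_val_quotient[OF p r(4,5)] r
      by (simp add: prime_elem_multiplicity_mult_distrib[OF pe])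
    finally show ?thesis .
  qed
  have add: "min (padic_val p x) (padic_val p y) \<le> padic_val p (x + y)" for x y
  proof (cases "x = 0 \<or> y = 0 \<or> x + y = 0")
    case True
    thus ?thesis by (auto simp: padic_val_def)
  next
    case False
    then obtain a b c d where r: "a \<noteq> 0" "b \<noteq> 0" "x = of_int a / of_int b" "c \<noteq> 0" "d \<noteq> 0" "y = of_int c / of_int d"
      using rep by metis
    define s t where "s = a * d" and "t = c * b"
    have nz: "s \<noteq> 0" "t \<noteq> 0" "b * d \<noteq> 0" using r by (auto simp: s_def t_def)
    have xy: "x = of_int s / of_int (b * d)" "y = of_int t / of_int (b * d)"
      using r by (simp_all add: s_def t_def)
    have xy': "x + y = of_int (s + t) / of_int (b * d)" using xy by (simp add: add_divide_distrib)
    hence st: "s + t \<noteq> 0" using False by auto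
    define m where "m = min (multiplicity (int p) s) (multiplicity (int p) t)"
    have "int p ^ m dvd s" "int p ^ m dvd t" by (auto simp: m_def intro: multiplicity_dvd')
    hence "int p ^ m dvd s + t" by simp
    hence "m \<le> multiplicity (int p) (s + t)"
      using st p by (intro multiplicity_geI) (use pe in \<open>auto simp: prime_elem_def\<close>)
    thus ?thesis
      using padic_val_quotient[OF p nz(1,3)] padic_val_quotient[OF p nz(2,3)] padic_val_quotient[OF p st nz(3)]
      unfolding xy' unfolding xy by (auto simp: m_def min_def split: if_splits)
  qed
  show ?thesis unfolding real_valuation_def using mult add by (auto simp: padic_val_def)
qed

text \<open>The carrier is a subset of a field type, so that one development covers \<open>L\<close>
  and \<open>F\<close> inside the complex numbers as well as the rationals with their p-adic
  valuation.\<close>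

locale valued_field =
  fixes S :: "'a::field set" and v :: "'a \<Rightarrow> ereal"
  assumes one_in [simp, intro]: "1 \<in> S"
    and neg_in [simp, intro]: "x \<in> S \<Longrightarrow> - x \<in> S"
    and inv_in [simp, intro]: "x \<in> S \<Longrightarrow> inverse x \<in> S"
    and add_in [simp, intro]: "x \<in> S \<Longrightarrow> y \<in> S \<Longrightarrow> x + y \<in> S"
    and mult_in [simp, intro]: "x \<in> S \<Longrightarrow> y \<in> S \<Longrightarrow> x * y \<in> S"
    and valuation: "real_valuation S v"
begin

lemma zero_in [simp, intro]: "0 \<in> S" using add_in[OF one_in neg_in[OF one_in]] by simp

lemma diff_in [simp, intro]: "x \<in> S \<Longrightarrow> y \<in> S \<Longrightarrow> x - y \<in> S"
  using add_in[of x "- y"] by simp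

lemma power_in [simp, intro]: "x \<in> S \<Longrightarrow> x ^ n \<in> S"
  by (induction n) auto

lemma sum_in: "(\<And>i. i \<in> A \<Longrightarrow> f i \<in> S) \<Longrightarrow> sum f A \<in> S"
  by (induction A rule: infinite_finite_induct) auto

lemma prod_in: "(\<And>i. i \<in> A \<Longrightarrow> f i \<in> S) \<Longrightarrow> prod f A \<in> S"
  by (induction A rule: infinite_finite_induct) auto

lemma of_nat_in [simp, intro]: "of_nat n \<in> S"
  by (induction n) auto

lemma of_int_in [simp, intro]: "of_int n \<in> S"
  by (cases n rule: int_cases2) auto

lemma v_not_MInf [simp]: "x \<in> S \<Longrightarrow> v x \<noteq> - \<infinity>"
  and v_eq_PInf_iff [simp]: "x \<in> S \<Longrightarrow> v x = \<infinity> \<longleftrightarrow> x = 0"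
  and v_mult: "x \<in> S \<Longrightarrow> y \<in> S \<Longrightarrow> v (x * y) = v x + v y"
  and v_add: "x \<in> S \<Longrightarrow> y \<in> S \<Longrightarrow> min (v x) (v y) \<le> v (x + y)"
  using valuation by (auto simp: real_valuation_def)

lemma v_0 [simp]: "v 0 = \<infinity>" by simp

lemma v_real:
  assumes "x \<in> S" "x \<noteq> 0" obtains r where "v x = ereal r"
  using assms v_not_MInf[of x] v_eq_PInf_iff[of x] by (cases "v x") auto

lemma v_1 [simp]: "v 1 = 0"
proof -
  obtain r where r: "v 1 = ereal r" using v_real[of 1] by auto
  have "v 1 = v 1 + v 1" using v_mult[of 1 1] by simp
  thus ?thesis using r by (simp add: zero_ereal_def)
qed

lemma v_minus [simp]: assumes "x \<in> S" shows "v (- x) = v x"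
proof -
  obtain r where r: "v (- 1) = ereal r" using v_real[of "- 1"] by auto
  have "v 1 = v (- 1) + v (- 1)" using v_mult[of "- 1" "- 1"] by simp
  hence "v (- 1) = 0" using r by (simp add: zero_ereal_def)
  thus ?thesis using v_mult[of "- 1" x] assms by simp
qed

lemma v_minus_commute: "x \<in> S \<Longrightarrow> y \<in> S \<Longrightarrow> v (x - y) = v (y - x)"
  using v_minus[of "x - y"] by simp

lemma v_add_gt: "x \<in> S \<Longrightarrow> y \<in> S \<Longrightarrow> c < v x \<Longrightarrow> c < v y \<Longrightarrow> c < v (x + y)"
  using v_add[of x y] by (metis min_less_iff_conj order.strict_trans2)

lemma v_diff_gt: "x \<in> S \<Longrightarrow> y \<in> S \<Longrightarrow> c < v x \<Longrightarrow> c < v y \<Longrightarrow> c < v (x - y)"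
  using v_add_gt[of x "- y"] by simp

lemma v_add_ge: "x \<in> S \<Longrightarrow> y \<in> S \<Longrightarrow> c \<le> v x \<Longrightarrow> c \<le> v y \<Longrightarrow> c \<le> v (x + y)"
  using v_add[of x y] by (metis min.bounded_iff order.trans)

lemma v_diff_ge: "x \<in> S \<Longrightarrow> y \<in> S \<Longrightarrow> c \<le> v x \<Longrightarrow> c \<le> v y \<Longrightarrow> c \<le> v (x - y)"
  using v_add_ge[of x "- y"] by simp

lemma v_add_eq:
  assumes "x \<in> S" "y \<in> S" "v x < v y"
  shows "v (x + y) = v x"
proof (rule antisym)
  show "v x \<le> v (x + y)" using v_add[of x y] assms by (simp add: min_def split: if_splits)
  show "v (x + y) \<le> v x"
  proof (rule ccontr)
    assume "\<not> v (x + y) \<le> v x"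
    hence "v x < v (x + y - y)" using assms by (intro v_diff_gt) auto
    thus False by simp
  qed
qed

lemma v_eq_if_close:
  assumes "x \<in> S" "y \<in> S" "v x < v (y - x)"
  shows "v y = v x"
  using v_add_eq[of x "y - x"] assms by simp

lemma v_power: "x \<in> S \<Longrightarrow> v (x ^ n) = ereal (real n) * v x"
proof (induction n)
  case (Suc n)
  have "v (x ^ Suc n) = v x + ereal (real n) * v x" using Suc v_mult[of x "x ^ n"] by simp
  also have "\<dots> = ereal (real (Suc n)) * v x"
  proof (cases "x = 0")
    case True
    thus ?thesis by (cases n) auto
  next
    case False
    then obtain r where "v x = ereal r" using v_real Suc by blast
    thus ?thesis by (simp add: algebra_simps)
  qed
  finally show ?case .
qed simp

lemma v_power_pos: "x \<in> S \<Longrightarrow> 0 < v x \<Longrightarrow> n > 0 \<Longrightarrow> 0 < v (x ^ n)"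
  by (simp add: v_power ereal_zero_less_0_iff)

lemma v_power_eq_0: "x \<in> S \<Longrightarrow> v x = 0 \<Longrightarrow> v (x ^ n) = 0"
  by (simp add: v_power)

lemma v_inverse: assumes "x \<in> S" "x \<noteq> 0" shows "v (inverse x) = - v x"
proof -
  obtain r where r: "v x = ereal r" using v_real assms by blast
  obtain s where s: "v (inverse x) = ereal s" using v_real[of "inverse x"] assms by auto
  have "v x + v (inverse x) = 0" using v_mult[of x "inverse x"] assms by simp
  thus ?thesis using r s by (simp add: zero_ereal_def)
qed

lemma v_of_nat_nonneg [simp]: "0 \<le> v (of_nat n)"
  by (induction n) (auto intro!: v_add_ge)

lemma v_of_int_nonneg [simp]: "0 \<le> v (of_int n)"
  by (cases n rule: int_cases2) auto

lemma v_sum_gt: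
  assumes "\<And>i. i \<in> A \<Longrightarrow> f i \<in> S" "\<And>i. i \<in> A \<Longrightarrow> ereal c < v (f i)"
  shows "ereal c < v (sum f A)"
  using assms by (induction A rule: infinite_finite_induct) (auto intro!: v_add_gt sum_in)

lemma v_mult_nonneg: "x \<in> S \<Longrightarrow> y \<in> S \<Longrightarrow> 0 \<le> v x \<Longrightarrow> 0 \<le> v y \<Longrightarrow> 0 \<le> v (x * y)"
  by (simp add: v_mult)

lemma v_mult_pos: "x \<in> S \<Longrightarrow> y \<in> S \<Longrightarrow> 0 < v x \<Longrightarrow> 0 \<le> v y \<Longrightarrow> 0 < v (x * y)"
  by (simp add: v_mult add_pos_nonneg)

lemma v_mult_pos': "x \<in> S \<Longrightarrow> y \<in> S \<Longrightarrow> 0 \<le> v x \<Longrightarrow> 0 < v y \<Longrightarrow> 0 < v (x * y)"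
  by (simp add: v_mult add_nonneg_pos)

lemma v_one_minus: "x \<in> S \<Longrightarrow> 0 < v x \<Longrightarrow> v (1 - x) = 0"
  using v_add_eq[of 1 "- x"] by simp

lemma v_prod:
  assumes "\<And>i. i \<in> A \<Longrightarrow> f i \<in> S"
  shows "v (prod f A) = (\<Sum>i\<in>A. v (f i))"
  using assms by (induction A rule: infinite_finite_induct) (auto simp: v_mult prod_in)

text \<open>If \<open>v t\<close> were negative, the leading term \<open>t ^ n\<close> would have
  strictly smaller value than all the lower terms together, contradicting that they cancel
  it.\<close>

lemma v_integral:
  assumes "lead_coeff P = 1" "poly (map_poly of_int P) t = 0" "t \<in> S"
  shows "0 \<le> v t"
proof (rule ccontr)
  assume neg: "\<not> 0 \<le> v t"
  hence t0: "t \<noteq> 0" by auto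
  then obtain r where r: "v t = ereal r" using v_real assms(3) by blast
  have r0: "r < 0" using neg r by simp
  define n where "n = degree P"
  have nz: "n \<noteq> 0"
  proof
    assume "n = 0"
    then obtain c where "P = [:c:]" unfolding n_def by (rule degree_eq_zeroE)
    thus False using assms(1,2) by simp
  qed
  have coef: "coeff (map_poly of_int P) i = (of_int (coeff P i) :: 'a)" for i by (simp add: coeff_map_poly)
  have degle: "degree (map_poly of_int P :: 'a poly) \<le> n" unfolding n_def by (rule degree_map_poly_le)
  have "0 = (\<Sum>i\<le>degree (map_poly of_int P :: 'a poly). of_int (coeff P i) * t ^ i)"
    using assms(2) by (simp add: poly_altdef coef)
  also have "\<dots> = (\<Sum>i\<le>n. of_int (coeff P i) * t ^ i)"
  proof (rule sum.mono_neutral_left)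
    show "\<forall>i\<in>{..n} - {..degree (map_poly of_int P :: 'a poly)}. of_int (coeff P i) * t ^ i = 0"
    proof
      fix i assume "i \<in> {..n} - {..degree (map_poly of_int P :: 'a poly)}"
      hence "coeff (map_poly of_int P :: 'a poly) i = 0" by (intro coeff_eq_0) simp
      thus "of_int (coeff P i) * t ^ i = 0" using coef[of i] by simp
    qed
  qed (use degle in auto)
  also have "\<dots> = t ^ n + (\<Sum>i<n. of_int (coeff P i) * t ^ i)"
    using assms(1) by (simp add: n_def lessThan_Suc_atMost[symmetric] add.commute)
  finally have eq: "(\<Sum>i<n. of_int (coeff P i) * t ^ i) = - (t ^ n)" by (simp add: eq_neg_iff_add_eq_0 add.commute)
  have "ereal (real n * r) < v (\<Sum>i<n. of_int (coeff P i) * t ^ i)"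
  proof (rule v_sum_gt)
    fix i assume i: "i \<in> {..<n}"
    have "ereal (real n * r) < ereal (real i * r)" using i r0 by (simp add: mult_less_cancel_right)
    also have "\<dots> = 0 + v (t ^ i)" using assms(3) by (simp add: v_power r)
    also have "\<dots> \<le> v (of_int (coeff P i)) + v (t ^ i)" by (intro add_right_mono) simp
    also have "\<dots> = v (of_int (coeff P i) * t ^ i)" using assms(3) by (simp add: v_mult)
    finally show "ereal (real n * r) < v (of_int (coeff P i) * t ^ i)" .
  qed (use assms(3) in auto)
  also have "\<dots> = ereal (real n * r)" unfolding eq using assms(3) by (simp add: v_power r)
  finally show False by simp
qed

text \<open>A polynomial with more roots modulo the maximal ideal than its degree vanishes modulo it.\<close>

lemma v_coeff_pos_if_many_roots:
  assumes "\<And>i. coeff P i \<in> S" "\<And>i. 0 \<le> v (coeff P i)" "degree P \<le> n"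
    and "finite A" "card A = Suc n" "A \<subseteq> S" "\<And>a. a \<in> A \<Longrightarrow> 0 \<le> v a"
    and "\<And>a b. a \<in> A \<Longrightarrow> b \<in> A \<Longrightarrow> a \<noteq> b \<Longrightarrow> v (a - b) = 0"
    and "\<And>a. a \<in> A \<Longrightarrow> 0 < v (poly P a)"
  shows "0 < v (coeff P i)"
  using assms
proof (induction n arbitrary: P A i)
  case 0
  obtain c where c: "P = [:c:]" using 0(3) by (auto elim: degree_eq_zeroE)
  obtain a where a: "a \<in> A" using 0(5) by fastforce
  have "0 < v c" using 0(9)[OF a] c by simp
  thus ?case using c by (cases i) auto
next
  case (Suc n)
  obtain a where a: "a \<in> A" using Suc.prems(5) by fastforce
  have aS: "a \<in> S" "0 \<le> v a" using a Suc.prems by auto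
  have polyS: "poly Q a \<in> S \<and> 0 \<le> v (poly Q a)"
    if "\<And>i. coeff Q i \<in> S" "\<And>i. 0 \<le> v (coeff Q i)" for Q
    using that
  proof (induction Q)
    case (pCons c Q)
    have "c \<in> S" "0 \<le> v c" using pCons.prems[of 0] by auto
    moreover have "poly Q a \<in> S \<and> 0 \<le> v (poly Q a)"
      using pCons.prems[of "Suc _"] by (intro pCons.IH) auto
    ultimately show ?case using aS by (auto intro!: v_add_ge v_mult_nonneg)
  qed simp
  have synS: "coeff (synthetic_div Q a) i \<in> S \<and> 0 \<le> v (coeff (synthetic_div Q a) i)"
    if "\<And>i. coeff Q i \<in> S" "\<And>i. 0 \<le> v (coeff Q i)" for Q i
    using that
  proof (induction Q arbitrary: i)
    case (pCons c Q)
    have *: "coeff Q i \<in> S" "0 \<le> v (coeff Q i)" for i using pCons.prems[of "Suc i"] by auto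
    show ?case using polyS[OF *] pCons.IH[OF *] by (cases i) auto
  qed simp
  \<comment> \<open>Division by \<open>X - a\<close> keeps the coefficients integral. The remaining
    points stay roots of the quotient modulo the maximal ideal because their differences with
    \<open>a\<close> are units.\<close>
  define Q where "Q = synthetic_div P a"
  have Q: "\<And>i. coeff Q i \<in> S" "\<And>i. 0 \<le> v (coeff Q i)"
    using synS[of P] Suc.prems(1,2) by (auto simp: Q_def)
  have PQ: "P = [:- a, 1:] * Q + [:poly P a:]"
    unfolding Q_def using synthetic_div_correct'[of a P] by simp
  have PaS: "poly P a \<in> S" "0 < v (poly P a)" using polyS[of P] Suc.prems a by auto
  have polyQ: "poly Q b \<in> S" if b: "b \<in> S" for b
    unfolding poly_altdef using Q b by (intro sum_in) auto
  have posQ: "0 < v (coeff Q i)" for i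
  proof (rule Suc.IH[of Q "A - {a}"])
    show "degree Q \<le> n" using Suc.prems(3) by (simp add: Q_def degree_synthetic_div)
    show "card (A - {a}) = Suc n" using Suc.prems(4,5) a by simp
    fix b assume b: "b \<in> A - {a}"
    have "poly P b = (b - a) * poly Q b + poly P a" by (subst PQ) (simp add: algebra_simps)
    hence "(b - a) * poly Q b = poly P b - poly P a" by simp
    moreover have bS: "b \<in> S" using b Suc.prems by auto
    moreover have "poly P b \<in> S" unfolding poly_altdef using Suc.prems(1) bS by (intro sum_in) auto
    hence "0 < v (poly P b - poly P a)" using PaS Suc.prems(9) b by (intro v_diff_gt) auto
    ultimately have "0 < v ((b - a) * poly Q b)" by simp
    thus "0 < v (poly Q b)" using Suc.prems(8)[of b a] b a aS bS polyQ by (simp add: v_mult)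
  qed (use Q Suc.prems in auto)
  have "coeff P i = coeff (pCons 0 Q) i - a * coeff Q i + coeff [:poly P a:] i"
    by (subst PQ, cases i) (simp_all add: algebra_simps)
  moreover have "0 < v (coeff (pCons 0 Q) i)" "coeff (pCons 0 Q) i \<in> S"
    using posQ Q by (cases i; simp)+
  moreover have "0 < v (a * coeff Q i)" using posQ Q aS by (intro v_mult_pos') auto
  moreover have "0 < v (coeff [:poly P a:] i)" "coeff [:poly P a:] i \<in> S" using PaS by (cases i; simp)+
  ultimately show ?case using Q aS by (simp add: v_add_gt v_diff_gt)
qed

end

text \<open>Real valuations with nested valuation rings differ by a scaling, which the common value
  at \<open>a\<close> fixes. If \<open>v y\<close> exceeded \<open>v' y\<close>, a rational
  \<open>m / n\<close> in between would give an element \<open>y ^ n / a ^ m\<close> that is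
  integral for \<open>v\<close> only. Applying this to \<open>x\<close> and to its inverse yields
  both inequalities.\<close>

lemma valuations_eq_if_ring_subset:
  assumes "valued_field S v" "valued_field S v'"
    and a: "a \<in> S" "v a = 1" "v' a = 1"
    and sub: "\<And>x. x \<in> S \<Longrightarrow> 0 \<le> v x \<Longrightarrow> 0 \<le> v' x"
    and x: "x \<in> S"
  shows "v x = v' x"
proof (cases "x = 0")
  case True
  interpret v: valued_field S v by fact
  interpret v': valued_field S v' by fact
  show ?thesis using True by simp
next
  case False
  interpret v: valued_field S v by fact
  interpret v': valued_field S v' by fact
  have a0: "a \<noteq> 0" using a(2) by auto
  have le: "r \<le> r'" if y: "y \<in> S" "y \<noteq> 0" "v y = ereal r" "v' y = ereal r'" for y r r'
  proof (rule ccontr)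
    assume "\<not> r \<le> r'"
    then obtain q where q: "r' < of_rat q" "of_rat q < r" using of_rat_dense[of r' r] by auto
    obtain m n where mn: "quotient_of q = (m, n)" by (cases "quotient_of q")
    have n: "n > 0" using quotient_of_denom_pos[OF mn] .
    have "(of_rat q :: real) = of_rat (of_int m / of_int n)" using quotient_of_div[OF mn] by simp
    hence qq: "(of_rat q :: real) = of_int m / of_int n" by (simp add: of_rat_divide)
    \<comment> \<open>The element \<open>b\<close> has value \<open>- m\<close> under both
      valuations; the case distinction expresses an integer power by natural exponents.\<close>
    define b where "b = (if m \<ge> 0 then inverse a ^ nat m else a ^ nat (- m))"
    have b: "b \<in> S" "v b = ereal (- of_int m)" "v' b = ereal (- of_int m)"
      using a a0 by (auto simp: b_def v.v_power v'.v_power v.v_inverse v'.v_inverse one_ereal_def)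
    have "v (y ^ nat n * b) = ereal (of_int n * r - of_int m)" "v' (y ^ nat n * b) = ereal (of_int n * r' - of_int m)"
      using y b n by (simp_all add: v.v_mult v'.v_mult v.v_power v'.v_power)
    moreover have "of_int n * r - of_int m \<ge> 0" "of_int n * r' - of_int m < 0"
      using q n unfolding qq by (simp_all add: field_simps)
    ultimately show False using sub[of "y ^ nat n * b"] y(1) b(1) by auto
  qed
  obtain r where r: "v x = ereal r" using v.v_real x False by blast
  obtain r' where r': "v' x = ereal r'" using v'.v_real x False by blast
  have "- r \<le> - r'"
    using le[of "inverse x" "- r" "- r'"] x False r r' by (simp add: v.v_inverse v'.v_inverse)
  moreover have "r \<le> r'" using le[OF x False r r'] .
  ultimately show ?thesis using r r' by simp
qed

text \<open>Each use of \<open>step\<close> extracts one factor \<open>\<pi>\<close> at the price of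
  a multiplier of value 0. Only multiplicativity and nonnegativity of \<open>V\<close> enter, not
  the ultrametric inequality, so the lemma applies both to a valuation and to a valuation composed
  with a norm.\<close>

lemma integral_quotient:
  fixes V :: "'a::field \<Rightarrow> ereal" and R :: "'a set"
  assumes R: "1 \<in> R" "\<And>x y. x \<in> R \<Longrightarrow> y \<in> R \<Longrightarrow> x * y \<in> R"
    and Vm: "\<And>x y. x \<in> R \<Longrightarrow> y \<in> R \<Longrightarrow> V (x * y) = V x + V y"
    and Vn: "\<And>x. x \<in> R \<Longrightarrow> 0 \<le> V x" and V0: "\<And>x. x \<in> R \<Longrightarrow> V x = \<infinity> \<longleftrightarrow> x = 0"
    and pi: "\<pi> \<in> R" "\<pi> \<noteq> 0" "\<pi> ^ M = q * u" and u: "u \<in> R" and q: "q \<in> R" "0 < V q"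
    and step: "\<And>c. c \<in> R \<Longrightarrow> 0 < V c \<Longrightarrow> \<exists>d\<in>R. V d = 0 \<and> (\<exists>c'\<in>R. d * c = \<pi> * c')"
    and c: "c \<in> R" "V (q ^ j) \<le> V c"
  shows "\<exists>d\<in>R. \<exists>c'\<in>R. V d = 0 \<and> d * c = q ^ j * c'"
proof -
  have Rp: "x ^ n \<in> R" if "x \<in> R" for x n using that R by (induction n) auto
  have "V 1 = V 1 + V 1" using Vm[of 1 1] R by simp
  moreover have "V 1 \<noteq> \<infinity>" "0 \<le> V 1" using V0[of 1] Vn[of 1] R by auto
  ultimately have V1: "V 1 = 0" by (cases "V 1") (auto simp: zero_ereal_def)
  have "V \<pi> \<noteq> 0"
  proof
    assume "V \<pi> = 0"
    hence "V (\<pi> ^ n) = 0" for n by (induction n) (simp_all add: V1 Vm pi Rp)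
    hence "V (q * u) = 0" using pi(3) by metis
    hence "V q + V u = 0" using Vm u q by simp
    moreover have "0 < V q + V u" using q(2) Vn[OF u] by (rule add_pos_nonneg)
    ultimately show False by simp
  qed
  hence pos: "0 < V \<pi>" using Vn[OF pi(1)] by simp
  have fin: "V \<pi> \<noteq> \<infinity>" using V0 pi by simp
  have claim: "\<exists>d\<in>R. \<exists>c'\<in>R. V d = 0 \<and> d * c = \<pi> ^ i * c'" if "c \<in> R" "V (\<pi> ^ i) \<le> V c" for i c
    using that
  proof (induction i arbitrary: c)
    case 0
    show ?case by (intro bexI[of _ 1] bexI[of _ c]) (use 0 R V1 in auto)
  next
    case (Suc i)
    have "0 < V \<pi> + V (\<pi> ^ i)" using pos Vn[OF Rp[OF pi(1)]] by (rule add_pos_nonneg)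
    hence "0 < V c" using Suc.prems(2) Vm[OF pi(1) Rp[OF pi(1)], of i] by simp
    then obtain d1 c1 where d1: "d1 \<in> R" "V d1 = 0" "c1 \<in> R" "d1 * c = \<pi> * c1"
      using step Suc.prems(1) by blast
    have "V \<pi> + V (\<pi> ^ i) \<le> V c" using Suc.prems(2) Vm[OF pi(1) Rp[OF pi(1)], of i] by simp
    also have "V c = V (d1 * c)" using Vm[OF d1(1) Suc.prems(1)] d1(2) by simp
    also have "\<dots> = V \<pi> + V c1" using d1 Vm pi by simp
    finally have "V (\<pi> ^ i) \<le> V c1" using pos fin by (cases "V \<pi>") (auto simp: ereal_add_le_add_iff)
    then obtain d2 c2 where d2: "d2 \<in> R" "V d2 = 0" "c2 \<in> R" "d2 * c1 = \<pi> ^ i * c2"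
      using Suc.IH d1(3) by blast
    have "d2 * d1 * c = \<pi> * (d2 * c1)" using d1(4) by (simp add: mult_ac)
    also have "\<dots> = \<pi> ^ Suc i * c2" using d2(4) by (simp add: mult_ac)
    finally have "d2 * d1 * c = \<pi> ^ Suc i * c2" .
    moreover have "V (d2 * d1) = 0" using Vm d1 d2 by simp
    ultimately show ?case using R(2)[OF d2(1) d1(1)] d2(3) by blast
  qed
  have uj: "u ^ j \<in> R" and qj: "q ^ j \<in> R" using Rp u q by auto
  \<comment> \<open>The extraction works with powers of \<open>\<pi>\<close>, while the target is a
    power of \<open>q\<close>. Multiplying \<open>c\<close> by \<open>u ^ j\<close> raises its value
    to that of \<open>\<pi> ^ (M * j)\<close>, and \<open>u ^ j\<close> is cancelled
    afterwards.\<close>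
  have "\<pi> ^ (M * j) = q ^ j * u ^ j" by (simp add: power_mult pi(3) power_mult_distrib)
  hence "V (\<pi> ^ (M * j)) = V (q ^ j) + V (u ^ j)" using Vm uj qj by simp
  also have "\<dots> \<le> V c + V (u ^ j)" using c(2) by (rule add_right_mono)
  also have "\<dots> = V (c * u ^ j)" using Vm c(1) uj by simp
  finally obtain d c' where d: "d \<in> R" "c' \<in> R" "V d = 0" "d * (c * u ^ j) = \<pi> ^ (M * j) * c'"
    using claim[of "c * u ^ j" "M * j"] R(2)[OF c(1) uj] by blast
  have "d * c * u ^ j = q ^ j * c' * u ^ j"
    using d(4) \<open>\<pi> ^ (M * j) = q ^ j * u ^ j\<close> by (simp add: mult_ac)
  moreover have "u \<noteq> 0" using pi by auto
  ultimately have "d * c = q ^ j * c'" by simp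
  thus ?thesis using d by blast
qed

lemma complex_subfield_valued_field:
  assumes "complex_subfield S" "real_valuation S v"
  shows "valued_field S v"
  using complex_subfieldD[OF assms(1)] assms(2) by unfold_locales auto

lemma prod_periodic:
  fixes h :: "nat \<Rightarrow> 'a::comm_monoid_mult"
  assumes "\<And>a. h (a + m) = h a"
  shows "(\<Prod>a<g * m. h a) = (\<Prod>a<m. h a) ^ g"
proof -
  have shift: "h (a + j * m) = h a" for a j
  proof (induction j)
    case (Suc j)
    have "h (a + Suc j * m) = h (a + j * m + m)" by (simp add: algebra_simps)
    thus ?case using assms Suc by simp
  qed simp
  have "(\<Prod>a<g * m. h a) = (\<Prod>j<g. prod h {j * m..<j * m + m})" by (rule prod.nat_group[symmetric])
  also have "\<dots> = (\<Prod>j<g. \<Prod>a<m. h a)"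
  proof (rule prod.cong)
    fix j
    have "prod h {j * m..<j * m + m} = prod h {0 + j * m..<m + j * m}" by (simp add: add.commute)
    also have "\<dots> = (\<Prod>a\<in>{0..<m}. h (a + j * m))" by (rule prod.shift_bounds_nat_ivl)
    finally show "prod h {j * m..<j * m + m} = (\<Prod>a<m. h a)" by (simp add: shift atLeast0LessThan)
  qed simp
  finally show ?thesis by simp
qed

section \<open>Extensions of the p-adic valuation to subfields\<close>

context cyclotomic_prime
begin

definition padic_ext :: "complex set \<Rightarrow> (complex \<Rightarrow> ereal) \<Rightarrow> bool" where
  "padic_ext S v \<longleftrightarrow> real_valuation S v \<and> (\<forall>q. v (of_rat q) = padic_val p q)"

lemma Val_p_eq: "Val_p p = {v \<in> extensional L. padic_ext L v}"
  by (auto simp: Val_p_def padic_ext_def)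

lemma padic_ext_valued_field: "complex_subfield S \<Longrightarrow> padic_ext S v \<Longrightarrow> valued_field S v"
  by (simp add: padic_ext_def complex_subfield_valued_field)

lemma padic_ext_p: "padic_ext S v \<Longrightarrow> v (of_nat p) = 1"
  using padic_val_prime[OF prime_p] unfolding padic_ext_def by (metis of_rat_of_nat_eq)

lemma padic_ext_coprime:
  assumes "padic_ext S v" "coprime r p"
  shows "v (of_nat r) = 0"
proof -
  have "\<not> int p dvd int r" using assms(2) p_gt_1 coprime_common_divisor_nat[of r p p] by auto
  hence "padic_val p (of_int (int r)) = 0" by (rule padic_val_coprime[OF prime_p])
  moreover have "v (of_rat (of_nat r)) = padic_val p (of_nat r)" using assms(1) unfolding padic_ext_def by blast
  ultimately show ?thesis by simp
qed

lemma padic_ext_int: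
  assumes "padic_ext S v" "\<not> int p dvd a"
  shows "v (of_int a) = 0"
proof -
  have "v (of_rat (of_int a)) = padic_val p (of_int a)" using assms(1) unfolding padic_ext_def by blast
  thus ?thesis using padic_val_coprime[OF prime_p assms(2)] by simp
qed

lemma v_integers_nonneg:
  assumes "complex_subfield S" "padic_ext S v" "t \<in> S" "t \<in> integers k"
  shows "0 \<le> v t"
proof -
  interpret valued_field S v using padic_ext_valued_field assms by blast
  obtain P where "poly (map_poly of_int P) t = 0" "lead_coeff P = 1"
    using integers_algebraic_int[OF assms(4)] by (auto simp: algebraic_int_altdef_ipoly)
  thus ?thesis using v_integral assms(3) by blast
qed

section \<open>Frobenius levels\<close>

lemma tau_funpow_hom: "complex_hom L (tau ^^ f)"
proof (induction f)
  case 0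
  show ?case by (simp add: complex_hom_def)
next
  case (Suc f)
  have "complex_hom L (\<lambda>x. tau ((tau ^^ f) x))" by (rule complex_hom_compose[OF tau_hom Suc])
  thus ?case by (simp add: o_def)
qed

lemmas tau_funpowD = complex_homD[OF complex_subfield_Qcyc tau_funpow_hom]

lemma tau_funpow_in [simp]: "x \<in> L \<Longrightarrow> (tau ^^ f) x \<in> L"
  by (induction f) auto

lemma sig_tau_funpow: "coprime a p \<Longrightarrow> x \<in> L \<Longrightarrow> sig a ((tau ^^ f) x) = (tau ^^ f) (sig a x)"
  by (induction f) (auto simp: sig_tau)

lemma tau_funpow_integers: "c \<in> integers k \<Longrightarrow> (tau ^^ f) c \<in> integers k"
  by (induction f) (auto intro: tau_sig_congr(3))

text \<open>On the prime-to-\<open>p\<close> part \<open>u\<close> the iterates of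
  \<open>tau\<close> are powers \<open>p ^ f\<close>, which return to \<open>u\<close> by Euler's
  theorem. On the \<open>p\<close>-part only the exponent modulo \<open>p ^ k\<close> is
  visible.\<close>

lemma integers_levels:
  assumes "c \<in> integers k"
  shows "\<exists>f>0. (tau ^^ f) c = c"
    and "coprime a p \<Longrightarrow> coprime b p \<Longrightarrow> [a = b] (mod p ^ k) \<Longrightarrow> sig a c = sig b c"
proof -
  obtain n P where n: "n > 0" "coprime n p" and c: "c = ipoly P (zeta (n * p ^ k))"
    using assms by (rule integersE)
  obtain u w where uw: "u ^ n = 1" "w ^ (p ^ k) = 1" "zeta (n * p ^ k) = u * w"
    using zeta_decompose[OF n] by blast
  have UL: "u \<in> L" "w \<in> L"
    using integers_root_prime_to[OF n uw(1)] integers_root_p_power[OF uw(2)] integers_subset_L by blast+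
  have zL: "u * w \<in> L" using UL Qcyc_closed(6) by blast
  have c': "c = ipoly P (u * w)" using c uw by simp
  have tau_u: "(tau ^^ f) u = u ^ (p ^ f)" for f
  proof (induction f)
    case (Suc f)
    have "(tau ^^ Suc f) u = tau (u ^ (p ^ f))" by (simp add: Suc)
    also have "\<dots> = (u ^ (p ^ f)) ^ p" by (rule tau_prime_to[OF n root_power_swap[OF uw(1)]])
    also have "\<dots> = u ^ (p ^ Suc f)" by (simp only: power_Suc2 power_mult)
    finally show ?case .
  qed simp
  have tau_w: "(tau ^^ f) w = w" for f by (induction f) (auto simp: tau_p_power[OF uw(2)])
  have "[p ^ totient n = 1] (mod n)" using n by (intro euler_theorem) (simp add: coprime_commute)
  hence "u ^ (p ^ totient n) = u" using power_cong_exponent[OF uw(1), of "p ^ totient n" 1] by simp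
  hence "(tau ^^ totient n) (u * w) = u * w"
    using tau_funpowD(4)[OF UL] tau_u tau_w by simp
  hence "(tau ^^ totient n) c = c"
    unfolding c' by (simp add: complex_hom_ipoly[OF complex_subfield_Qcyc tau_funpow_hom zL])
  thus "\<exists>f>0. (tau ^^ f) c = c" using n by (intro exI[of _ "totient n"]) simp
  assume a: "coprime a p" "coprime b p" "[a = b] (mod p ^ k)"
  have "sig a (u * w) = sig b (u * w)"
    using sigD(4)[OF a(1) UL] sigD(4)[OF a(2) UL] sig_prime_to[OF a(1) n uw(1)]
      sig_prime_to[OF a(2) n uw(1)] sig_p_power[OF a(1) uw(2)] sig_p_power[OF a(2) uw(2)]
      power_cong_exponent[OF uw(2) a(3)] by simp
  thus "sig a c = sig b c"
    unfolding c' by (simp add: complex_hom_ipoly[OF complex_subfield_Qcyc sig_hom zL] a)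
qed

text \<open>For \<open>f = 0\<close> the condition is void, so \<open>lev 0 k\<close> is the whole
  ring. One division lemma can thus treat valuations on \<open>L\<close> and norms, the latter being
  usable only on elements fixed by a given iterate of \<open>tau\<close>.\<close>

definition lev :: "nat \<Rightarrow> nat \<Rightarrow> complex set" where
  "lev f k = {x \<in> integers k. (tau ^^ f) x = x}"

lemma lev_0: "lev 0 k = integers k"
  by (simp add: lev_def)

lemma tau_unif: "tau (unif k) = unif k"
proof (cases "k = 0")
  case True
  thus ?thesis by (simp add: unif_def tauD)
next
  case False
  have pk: "p ^ k > 0" using p_pos by simp
  have "tau (1 - zeta (p ^ k)) = 1 - zeta (p ^ k)"
    using tau_p_power[OF zeta_power_order[OF pk]] tauD(6)[OF Qcyc_closed(1) zeta_in_L[OF pk]] tauD(1) by simp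
  thus ?thesis using False by (simp add: unif_def)
qed

lemma lev_closed:
  shows "1 \<in> lev f k" "of_nat n \<in> lev f k" "unif k \<in> lev f k"
    "\<And>x y. x \<in> lev f k \<Longrightarrow> y \<in> lev f k \<Longrightarrow> x + y \<in> lev f k"
    "\<And>x y. x \<in> lev f k \<Longrightarrow> y \<in> lev f k \<Longrightarrow> x - y \<in> lev f k"
    "\<And>x y. x \<in> lev f k \<Longrightarrow> y \<in> lev f k \<Longrightarrow> x * y \<in> lev f k"
    "\<And>x n. x \<in> lev f k \<Longrightarrow> x ^ n \<in> lev f k"
    "\<And>x. x \<in> lev f k \<Longrightarrow> x \<in> L" "\<And>x. x \<in> lev f k \<Longrightarrow> x \<in> integers k"
proof -
  show "1 \<in> lev f k" "of_nat n \<in> lev f k" by (simp_all add: lev_def tau_funpowD)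
  have "(tau ^^ f) (unif k) = unif k" by (induction f) (simp_all add: tau_unif)
  thus "unif k \<in> lev f k" by (simp add: lev_def)
  fix x y n assume x: "x \<in> lev f k"
  thus "x \<in> L" "x \<in> integers k" "x ^ n \<in> lev f k"
    using integers_subset_L[of x k] by (auto simp: lev_def tau_funpowD)
  assume "y \<in> lev f k"
  thus "x + y \<in> lev f k" "x - y \<in> lev f k" "x * y \<in> lev f k"
    using x integers_subset_L[of x k] integers_subset_L[of y k]
    by (auto simp: lev_def tau_funpowD)
qed

lemma lev_cancel:
  assumes "x = m * c" "x \<in> lev f k" "m \<in> lev f k" "c \<in> integers k" "m \<noteq> 0"
  shows "c \<in> lev f k"
proof -
  have "m \<in> L" "c \<in> L" using lev_closed(8)[OF assms(3)] integers_subset_L[OF assms(4)] .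
  hence "(tau ^^ f) x = (tau ^^ f) m * (tau ^^ f) c" by (simp add: assms(1) tau_funpowD)
  moreover have "(tau ^^ f) x = x" "(tau ^^ f) m = m" using assms(2,3) by (simp_all add: lev_def)
  ultimately have "m * c = m * (tau ^^ f) c" using assms(1) by (metis assms(1))
  hence "(tau ^^ f) c = c" using assms(5) by simp
  thus ?thesis using assms(4) by (simp add: lev_def)
qed

text \<open>The denominator splits as \<open>m = r * p ^ j\<close>: the factor \<open>r\<close> has
  value 0 and passes into \<open>d\<close>, while \<open>p ^ j\<close> is divided out by
  \<open>integral_quotient\<close> with the uniformiser as \<open>\<pi>\<close>. All auxiliary
  quotients remain fixed by \<open>tau ^^ f\<close> because numerators and denominators are.\<close>

lemma lev_quotient:
  fixes V :: "complex \<Rightarrow> ereal"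
  assumes Vm: "\<And>x y. x \<in> lev f k \<Longrightarrow> y \<in> lev f k \<Longrightarrow> V (x * y) = V x + V y"
    and Vn: "\<And>x. x \<in> lev f k \<Longrightarrow> 0 \<le> V x" and V0: "\<And>x. x \<in> lev f k \<Longrightarrow> V x = \<infinity> \<longleftrightarrow> x = 0"
    and Vp: "0 < V (of_nat p)" and Vr: "\<And>r. coprime r p \<Longrightarrow> V (of_nat r) = 0"
    and step: "\<And>c. c \<in> lev f k \<Longrightarrow> 0 < V c \<Longrightarrow> \<exists>d\<in>lev f k. V d = 0 \<and> congr k (unif k) (d * c) 0"
    and z: "m > 0" "of_nat m * z \<in> lev f k" "V (of_nat m) \<le> V (of_nat m * z)"
  shows "\<exists>d\<in>lev f k. \<exists>c\<in>lev f k. V d = 0 \<and> d * z = c"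
proof -
  obtain M where M: "congr k (of_nat p) (unif k ^ M) 0" using unif_power by blast
  then obtain u where u: "u \<in> integers k" "unif k ^ M = of_nat p * u" by (auto simp: congr_def)
  have uR: "u \<in> lev f k"
    using lev_cancel[OF u(2) _ _ u(1)] lev_closed(2,3,7) p_pos by simp
  have step': "\<exists>d\<in>lev f k. V d = 0 \<and> (\<exists>c'\<in>lev f k. d * c = unif k * c')"
    if c: "c \<in> lev f k" "0 < V c" for c
  proof -
    obtain d where d: "d \<in> lev f k" "V d = 0" "congr k (unif k) (d * c) 0" using step c by blast
    obtain c' where c': "c' \<in> integers k" "d * c = unif k * c'" using d(3) by (auto simp: congr_def)
    have "c' \<in> lev f k"
      using lev_cancel[OF c'(2) _ _ c'(1) unif_nonzero] lev_closed(3,6) d(1) c(1) by simp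
    thus ?thesis using d c' by blast
  qed
  obtain r j where m: "m = r * p ^ j" "r > 0" "coprime r p" using order_decompose z(1) by blast
  have nat: "of_nat n \<in> lev f k" for n by (rule lev_closed(2))
  have "V (of_nat m) = V (of_nat r * of_nat p ^ j)" by (simp add: m)
  also have "\<dots> = V (of_nat p ^ j)" using Vm[OF nat lev_closed(7)[OF nat], of r p j] Vr[OF m(3)] by simp
  finally have Vpj: "V (of_nat p ^ j) \<le> V (of_nat m * z)" using z(3) by simp
  have "\<exists>d\<in>lev f k. \<exists>c'\<in>lev f k. V d = 0 \<and> d * (of_nat m * z) = of_nat p ^ j * c'"
    by (rule integral_quotient[OF lev_closed(1) lev_closed(6) Vm Vn V0 lev_closed(3) unif_nonzero u(2) uR nat Vp step' z(2) Vpj])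
  then obtain d c where d: "d \<in> lev f k" "c \<in> lev f k" "V d = 0" "d * (of_nat m * z) = of_nat p ^ j * c"
    by blast
  have "of_nat p ^ j * (d * of_nat r * z) = of_nat p ^ j * c" using d(4) by (simp add: m mult_ac)
  hence "d * of_nat r * z = c" using p_pos by simp
  moreover have "V (d * of_nat r) = 0" using Vm[OF d(1) nat] d(3) Vr[OF m(3)] by simp
  ultimately show ?thesis using lev_closed(6)[OF d(1) nat] d(2) by blast
qed

section \<open>Valuations on the full cyclotomic field\<close>

context
  fixes v :: "complex \<Rightarrow> ereal"
  assumes v: "padic_ext L v"
begin

interpretation valued_field L v using padic_ext_valued_field[OF complex_subfield_Qcyc v] .

lemma v_integers: "c \<in> integers k \<Longrightarrow> 0 \<le> v c"
  using v_integers_nonneg[OF complex_subfield_Qcyc v] integers_subset_L by blast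

lemma v_unif_pos: "0 < v (unif k)"
proof (rule ccontr)
  assume "\<not> 0 < v (unif k)"
  hence 0: "v (unif k) = 0" using v_integers[OF unif_in] by (metis less_eq_ereal_def)
  have uL: "unif k \<in> L" using integers_subset_L by blast
  obtain M where "congr k (of_nat p) (unif k ^ M) 0" using unif_power by blast
  then obtain u where u: "u \<in> integers k" "unif k ^ M = of_nat p * u" by (auto simp: congr_def)
  have "v (of_nat p * u) = 0" using v_power_eq_0[OF uL 0, of M] u(2) by simp
  hence "1 + v u = 0" using v_mult[of "of_nat p" u] integers_subset_L[OF u(1)] padic_ext_p[OF v] by simp
  moreover have "0 < 1 + v u" using v_integers[OF u(1)] by (intro add_pos_nonneg) auto
  ultimately show False by simp
qed

lemma v_congr_pos:
  assumes "congr k (unif k) x y"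
  shows "0 < v (x - y)"
proof -
  obtain c where c: "c \<in> integers k" "x - y = unif k * c" using assms by (auto simp: congr_def)
  thus ?thesis
    using v_mult_pos[of "unif k" c] v_unif_pos v_integers[OF c(1)] integers_subset_L[OF c(1)]
      integers_subset_L[OF unif_in] by simp
qed

lemma v_integers_step:
  assumes c: "c \<in> integers k" "0 < v c"
  shows "\<exists>d\<in>integers k. v d = 0 \<and> congr k (unif k) (d * c) 0"
proof -
  obtain f where f: "f > 0" "congr k (unif k) (c ^ (p ^ f)) c" using Frobenius_power_fixed[OF c(1)] by blast
  have "1 < p ^ f" using f p_gt_1 by (intro one_less_power) auto
  then obtain q where q: "p ^ f = Suc q" "q > 0" by (cases "p ^ f") auto
  define d where "d = 1 - c ^ q"
  have cL: "c \<in> L" using c integers_subset_L by blast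
  have "v d = 0" unfolding d_def using v_power_pos[OF cL c(2) q(2)] cL by (intro v_one_minus) auto
  moreover have "d * c = c - c ^ (p ^ f)" by (simp add: d_def q algebra_simps)
  hence "congr k (unif k) (d * c) 0" using congr_diff[OF congr_refl f(2), of c] by simp
  moreover have "d \<in> integers k" unfolding d_def using c(1) by blast
  ultimately show ?thesis by blast
qed

lemma v_quotient:
  assumes "x \<in> L" "m > 0" "of_nat m * x \<in> integers k" "0 \<le> v x"
  shows "\<exists>d\<in>integers k. \<exists>c\<in>integers k. v d = 0 \<and> d * x = c"
  unfolding lev_0[symmetric]
proof (rule lev_quotient)
  show "v (of_nat m) \<le> v (of_nat m * x)"
    using v_mult[of "of_nat m" x] assms by (simp add: ereal_le_add_self)
  show "0 < v (of_nat p)" using padic_ext_p[OF v] by simp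
qed (use assms v_integers_step v_integers integers_subset_L v_mult padic_ext_coprime[OF v] in \<open>auto simp: lev_0\<close>)

text \<open>Modulo the maximal ideal the automorphism is a power map, so it preserves the valuation ring.\<close>

lemma v_hom_invariant:
  assumes h: "complex_hom L \<sigma>"
    and cong: "\<And>k c. c \<in> integers k \<Longrightarrow> congr k (unif k) (\<sigma> c) (c ^ e) \<and> \<sigma> c \<in> integers k"
    and x: "x \<in> L"
  shows "v (\<sigma> x) = v x"
proof -
  note hD = complex_homD[OF complex_subfield_Qcyc h]
  have in_L: "\<sigma> x \<in> L" if "x \<in> L" for x using complex_hom_image_Qcyc[OF h] that by blast
  have "real_valuation L (\<lambda>x. v (\<sigma> x))"
    unfolding real_valuation_def using in_L v_add by (simp add: hD v_mult)
  hence vf: "valued_field L (\<lambda>x. v (\<sigma> x))"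
    by (rule complex_subfield_valued_field[OF complex_subfield_Qcyc])
  have "v x = v (\<sigma> x)"
  proof (rule valuations_eq_if_ring_subset[OF valued_field_axioms vf, of "of_nat p"])
    show "v (of_nat p) = 1" "v (\<sigma> (of_nat p)) = 1" by (simp_all add: hD padic_ext_p[OF v])
    fix y assume y: "y \<in> L" "0 \<le> v y"
    obtain k m where km: "m > (0::nat)" "of_nat m * y \<in> integers (Suc k)" using L_integers_quotient y(1) by blast
    obtain d c where d: "d \<in> integers (Suc k)" "c \<in> integers (Suc k)" "v d = 0" "d * y = c"
      using v_quotient[OF y(1) km y(2)] by blast
    have dL: "d \<in> L" using d(1) integers_subset_L by blast
    \<comment> \<open>The element \<open>d ^ e\<close> is a unit at \<open>v\<close>, so its
      perturbation \<open>\<sigma> d\<close> is one too. Hence \<open>\<sigma> y\<close>, the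
      quotient of the integer \<open>\<sigma> c\<close> by it, is integral.\<close>
    have "0 < v (\<sigma> d - d ^ e)" using cong[OF d(1)] v_congr_pos by blast
    hence "v (d ^ e) < v (\<sigma> d - d ^ e)" using v_power_eq_0[OF dL d(3)] by simp
    hence "v (\<sigma> d) = v (d ^ e)" using dL in_L by (intro v_eq_if_close) auto
    hence "v (\<sigma> d) = 0" using v_power_eq_0[OF dL d(3)] by simp
    moreover have "\<sigma> d * \<sigma> y = \<sigma> c" using hD(4)[OF dL y(1)] d(4) by simp
    moreover have "0 \<le> v (\<sigma> c)" using cong[OF d(2)] v_integers by blast
    moreover have "v (\<sigma> d * \<sigma> y) = v (\<sigma> d) + v (\<sigma> y)" using in_L dL y(1) by (intro v_mult) auto
    ultimately show "0 \<le> v (\<sigma> y)" by simp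
  qed (use x in auto)
  thus ?thesis by simp
qed

lemma v_tau: "x \<in> L \<Longrightarrow> v (tau x) = v x"
  by (rule v_hom_invariant[OF tau_hom, of p]) (simp_all add: tau_sig_congr)

lemma v_sig: "coprime a p \<Longrightarrow> x \<in> L \<Longrightarrow> v (sig a x) = v x"
  by (rule v_hom_invariant[OF sig_hom, of a 1]) (simp_all add: tau_sig_congr)

lemma v_tau_funpow: "x \<in> L \<Longrightarrow> v ((tau ^^ f) x) = v x"
  by (induction f) (auto simp: v_tau)

text \<open>Invariance under \<open>tau\<close>, which is the \<open>p\<close>-th power modulo the
  maximal ideal, makes \<open>y\<close> a root of \<open>X^p - X\<close> there. The residues
  \<open>0, ..., p - 1\<close> already account for all its roots.\<close>

lemma v_F_residue:
  assumes y: "y \<in> F" "0 \<le> v y"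
  shows "\<exists>a. 1 \<le> v (y - of_nat a)"
proof -
  have yK: "y \<in> K" and yL: "y \<in> L" and tau_y: "tau y = y"
    using F_subset_K[OF y(1)] F_subset_L[OF y(1)] y(1)[unfolded F_eq_K] by simp_all
  have u0: "unif 0 = of_nat p" by (simp add: unif_def)
  \<comment> \<open>The field \<open>K\<close> is unramified at \<open>p\<close>: at level 0 the
    uniformiser is \<open>p\<close> itself, so a positive value is at least 1.\<close>
  have discrete: "1 \<le> v x" if x: "x \<in> K" "0 < v x" for x
  proof -
    have xL: "x \<in> L" using x K_subset_L by blast
    obtain m where m: "m > (0::nat)" "of_nat m * x \<in> integers 0" using K_integers_quotient x(1) by blast
    obtain d c where d: "d \<in> integers 0" "c \<in> integers 0" "v d = 0" "d * x = c"
      using v_quotient[OF xL m] x(2) by (auto simp: less_imp_le)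
    have vc: "v c = v x" using v_mult[OF integers_subset_L[OF d(1)] xL] d(3,4) by simp
    obtain d' where d': "d' \<in> integers 0" "v d' = 0" "congr 0 (unif 0) (d' * c) 0"
      using v_integers_step[OF d(2)] vc x(2) by auto
    then obtain c' where c': "c' \<in> integers 0" "d' * c = of_nat p * c'" by (auto simp: congr_def u0)
    have "v c = v (d' * c)" using v_mult[OF integers_subset_L[OF d'(1)] integers_subset_L[OF d(2)]] d'(2) by simp
    also have "\<dots> = 1 + v c'"
      using v_mult[OF of_nat_in integers_subset_L[OF c'(1)]] c'(2) padic_ext_p[OF v] by simp
    also have "1 + 0 \<le> 1 + v c'" using v_integers[OF c'(1)] by (intro add_left_mono)
    finally show ?thesis using vc by simp
  qed
  obtain m where m: "m > (0::nat)" "of_nat m * y \<in> integers 0" using K_integers_quotient yK by blast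
  obtain d c where d: "d \<in> integers 0" "c \<in> integers 0" "v d = 0" "d * y = c"
    using v_quotient[OF yL m y(2)] by blast
  have L: "d \<in> L" "c \<in> L" using d integers_subset_L by blast+
  have "tau d * y = tau c" using tauD(4)[OF L(1) yL] d(4) tau_y by simp
  moreover have "d ^ p * y ^ p = c ^ p" using d(4) by (simp flip: power_mult_distrib)
  ultimately have "d ^ p * (y ^ p - y) = (tau d - d ^ p) * y - (tau c - c ^ p)"
    by (simp add: algebra_simps)
  moreover have "0 < v ((tau d - d ^ p) * y - (tau c - c ^ p))"
  proof (rule v_diff_gt)
    show "0 < v ((tau d - d ^ p) * y)"
      using v_mult_pos[OF _ yL v_congr_pos[OF tau_sig_congr(1)[OF d(1)]] y(2)] L by simp
    show "0 < v (tau c - c ^ p)" by (rule v_congr_pos[OF tau_sig_congr(1)[OF d(2)]])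
  qed (use L yL in auto)
  moreover have "v (d ^ p * (y ^ p - y)) = v (y ^ p - y)"
    using v_mult[of "d ^ p" "y ^ p - y"] L yL v_power_eq_0[OF L(1) d(3)] by simp
  ultimately have yp: "0 < v (y ^ p - y)" by simp
  have "\<exists>a<p. 0 < v (y - of_nat a)"
  proof (rule ccontr)
    assume "\<not> (\<exists>a<p. 0 < v (y - of_nat a))"
    hence na: "\<not> 0 < v (y - of_nat a)" if "a < p" for a using that by blast
    have na: "v (y - of_nat a) = 0" if "a < p" for a
    proof (rule antisym)
      show "v (y - of_nat a) \<le> 0" using na[OF that] by simp
      show "0 \<le> v (y - of_nat a)" using yL y(2) by (intro v_diff_ge) auto
    qed
    \<comment> \<open>If \<open>y\<close> had none of these residues, the set \<open>A\<close> would
      consist of \<open>p + 1\<close> pairwise incongruent roots of a polynomial of degree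
      \<open>p\<close>, forcing its leading coefficient 1 to have positive value.\<close>
    define A where "A = insert y (of_nat ` {..<p})"
    define P where "P = monom 1 p - monom (1 :: complex) 1"
    have notin: "y \<notin> of_nat ` {..<p}"
    proof
      assume "y \<in> of_nat ` {..<p}"
      then obtain a where "a < p" "y = of_nat a" by auto
      thus False using na[of a] by simp
    qed
    have diff: "v (of_nat a - of_nat b) = 0" if "a < p" "b < p" "a \<noteq> b" for a b
    proof -
      have "\<not> int p dvd int a - int b"
      proof
        assume "int p dvd int a - int b"
        hence "[int a = int b] (mod int p)" by (simp add: cong_iff_dvd_diff)
        hence "[a = b] (mod p)" by (simp add: cong_int_iff)
        thus False using that by (simp add: cong_def)
      qed
      from padic_ext_int[OF v this] show ?thesis by simp
    qed
    have "0 < v (coeff P p)"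
    proof (rule v_coeff_pos_if_many_roots[of P p A])
      have c: "coeff P i \<in> {0, 1, -1}" for i by (auto simp: P_def)
      show "coeff P i \<in> L" for i using c[of i] by auto
      show "0 \<le> v (coeff P i)" for i using c[of i] by auto
      show "degree P \<le> p" unfolding P_def using p_gt_1
        by (intro degree_diff_le order.trans[OF degree_monom_le]) auto
      show "finite A" by (simp add: A_def)
      show "card A = Suc p" unfolding A_def using notin by (simp add: card_image inj_on_def)
      show "A \<subseteq> L" using yL by (auto simp: A_def)
      show "0 \<le> v a" if "a \<in> A" for a using that y(2) by (auto simp: A_def)
      show "v (a - b) = 0" if "a \<in> A" "b \<in> A" "a \<noteq> b" for a b
        using that diff na yL v_minus_commute[of y] by (auto simp: A_def)
      show "0 < v (poly P a)" if aA: "a \<in> A" for a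
      proof (cases "a = y")
        case True
        thus ?thesis using yp by (simp add: P_def poly_monom)
      next
        case False
        then obtain b where b: "a = of_nat b" using aA by (auto simp: A_def)
        have "int p dvd int b ^ p - int b"
        proof -
          have "[b ^ p = b] (mod p)"
          proof (cases "p dvd b")
            case True
            hence "p dvd b ^ p" using p_pos by (cases p) auto
            thus ?thesis using True by (simp add: cong_def mod_0_imp_dvd)
          next
            case False
            have "[b ^ (p - 1) * b = 1 * b] (mod p)"
              by (intro cong_mult fermat_theorem prime_p False cong_refl)
            thus ?thesis using p_pos by (metis mult.left_neutral power_minus_mult)
          qed
          hence "[int (b ^ p) = int b] (mod int p)" by (simp only: cong_int_iff)
          thus ?thesis by (simp add: cong_iff_dvd_diff)
        qed
        then obtain e where e: "int b ^ p - int b = int p * e" by (auto elim: dvdE)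
        have "poly P a = of_int (int b ^ p - int b)" by (simp add: P_def poly_monom b)
        also have "\<dots> = of_nat p * of_int e" unfolding e by simp
        finally show ?thesis using v_mult_pos[of "of_nat p" "of_int e"] padic_ext_p[OF v] by simp
      qed
    qed
    moreover have "coeff P p = 1" using p_gt_1 by (simp add: P_def)
    ultimately show False by simp
  qed
  then obtain a where "0 < v (y - of_nat a)" by blast
  moreover have "y - of_nat a \<in> K" using yK Qcyc_prime_to_closed(7,12) by blast
  ultimately show ?thesis using discrete by blast
qed

text \<open>A p-adic digit expansion: subtract the residue, divide by \<open>p\<close>, which stays
  in \<open>F\<close>, and repeat. A general element is first multiplied by a power of
  \<open>p\<close> to make it integral, and the precision is raised by the same exponent.\<close>

lemma Rats_dense_F:
  assumes "y \<in> F"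
  shows "\<exists>r::rat. ereal (real n) \<le> v (y - of_rat r)"
proof -
  have int: "\<exists>r::rat. ereal (real n) \<le> v (y - of_rat r)" if "y \<in> F" "0 \<le> v y" for y n
    using that
  proof (induction n arbitrary: y)
    case 0
    thus ?case by (intro exI[of _ 0]) (simp flip: zero_ereal_def)
  next
    case (Suc n)
    obtain a where a: "1 \<le> v (y - of_nat a)" using v_F_residue Suc.prems by blast
    define z where "z = (y - of_nat a) / of_nat p"
    have zF: "z \<in> F" unfolding z_def by (intro F_closed(7,8,12) Suc.prems)
    have yz: "y - of_nat a = of_nat p * z" using p_pos by (simp add: z_def)
    have zL: "z \<in> L" using zF F_subset_L by blast
    have "1 \<le> 1 + v z" using a yz v_mult[OF of_nat_in zL] padic_ext_p[OF v] by simp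
    hence "0 \<le> v z" by (cases "v z") auto
    then obtain r where r: "ereal (real n) \<le> v (z - of_rat r)" using Suc.IH zF by blast
    have rL: "of_rat r \<in> L" by (rule Qcyc_closed(14))
    have "y - of_rat (of_nat a + of_nat p * r) = of_nat p * (z - of_rat r)"
      using yz by (simp add: of_rat_add of_rat_mult algebra_simps)
    hence "v (y - of_rat (of_nat a + of_nat p * r)) = 1 + v (z - of_rat r)"
      using v_mult[OF of_nat_in diff_in[OF zL rL]] padic_ext_p[OF v] by simp
    moreover have "ereal (real (Suc n)) = 1 + ereal (real n)" by (simp add: one_ereal_def)
    ultimately show ?case using r add_left_mono by metis
  qed
  have yL: "y \<in> L" using assms F_subset_L by blast
  obtain j :: nat where j: "0 \<le> v (of_nat p ^ j * y)"
  proof (cases "y = 0")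
    case True
    thus ?thesis using that[of 0] by simp
  next
    case False
    then obtain r where r: "v y = ereal r" using v_real yL by blast
    have "v (of_nat p ^ nat \<lceil>- r\<rceil> * y) = ereal (real (nat \<lceil>- r\<rceil>) + r)"
      using yL r by (simp add: v_mult v_power padic_ext_p[OF v] one_ereal_def)
    moreover have "0 \<le> real (nat \<lceil>- r\<rceil>) + r" by linarith
    ultimately show ?thesis using that[of "nat \<lceil>- r\<rceil>"] by simp
  qed
  have "of_nat p ^ j * y \<in> F" by (intro F_closed(6,9,12) assms)
  then obtain r where r: "ereal (real (n + j)) \<le> v (of_nat p ^ j * y - of_rat r)" using int j by blast
  define s where "s = r / of_nat p ^ j"
  have "(of_rat s :: complex) = of_rat r / of_nat p ^ j" by (simp add: s_def of_rat_divide of_rat_power)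
  hence "of_nat p ^ j * y - of_rat r = of_nat p ^ j * (y - of_rat s)" using p_pos by (simp add: algebra_simps)
  moreover have sL: "y - of_rat s \<in> L" using yL Qcyc_closed(7,14) by blast
  ultimately have "v (of_nat p ^ j * y - of_rat r) = ereal (real j) + v (y - of_rat s)"
    using v_mult[OF power_in[OF of_nat_in] sL] by (simp add: v_power padic_ext_p[OF v] one_ereal_def)
  hence "ereal (real n) \<le> v (y - of_rat s)" using r by (cases "v (y - of_rat s)") auto
  thus ?thesis by blast
qed

end


section \<open>Norms from a finite level down to \<open>F\<close>\<close>

definition U :: "nat \<Rightarrow> nat set" where
  "U k = {a. a < p ^ k \<and> coprime a p}"

lemma finite_U [simp]: "finite (U k)" and U_coprime: "a \<in> U k \<Longrightarrow> coprime a p"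
  by (auto simp: U_def)

text \<open>The set \<open>U 0\<close> is empty, as 0 is not coprime to \<open>p\<close>; a norm at
  exponent 0 would be an empty product. This is why levels appear as \<open>Suc k\<close>.\<close>

lemma card_U_pos: "card (U (Suc k)) > 0"
proof -
  have "1 < p ^ Suc k" using p_gt_1 by (rule one_less_power) simp
  hence "1 \<in> U (Suc k)" by (simp add: U_def)
  thus ?thesis by (auto simp: card_gt_0_iff)
qed

text \<open>The product over all pairs of exponents, not over distinct conjugates. At a level that
  is not minimal for \<open>x\<close>, conjugates repeat and the result is a power of the actual
  norm; \<open>wt\<close> counts the factors, so dividing values by it removes the dependence on the
  level.\<close>

definition Nm :: "nat \<Rightarrow> nat \<Rightarrow> complex \<Rightarrow> complex" where
  "Nm f k x = (\<Prod>i<f. \<Prod>a\<in>U k. (tau ^^ i) (sig a x))"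

definition wt :: "nat \<Rightarrow> nat \<Rightarrow> nat" where
  "wt f k = f * card (U k)"

lemma wt_pos: "f > 0 \<Longrightarrow> wt f (Suc k) > 0"
  using card_U_pos by (simp add: wt_def)

lemma prod_const_wt: "(\<Prod>i<f. \<Prod>a\<in>U k. x) = (x :: complex) ^ wt f k"
  unfolding wt_def by (simp add: mult.commute flip: power_mult)

definition level :: "nat \<Rightarrow> nat \<Rightarrow> complex \<Rightarrow> bool" where
  "level f k x \<longleftrightarrow> x \<in> L \<and> (tau ^^ f) x = x \<and>
     (\<forall>a b. coprime a p \<longrightarrow> coprime b p \<longrightarrow> [a = b] (mod p ^ k) \<longrightarrow> sig a x = sig b x)"

lemma levelD:
  assumes "level f k x"
  shows "x \<in> L" "(tau ^^ f) x = x"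
    "coprime a p \<Longrightarrow> coprime b p \<Longrightarrow> [a = b] (mod p ^ k) \<Longrightarrow> sig a x = sig b x"
  using assms unfolding level_def by blast+

lemma lev_level: "x \<in> lev f k \<Longrightarrow> level f k x"
  using integers_levels(2) integers_subset_L by (auto simp: lev_def level_def)

lemma tau_funpow_mult: "(tau ^^ f) x = x \<Longrightarrow> (tau ^^ (f * g)) x = x"
  by (induction g) (simp_all add: funpow_add)

lemma level_mono:
  assumes "level f k x" shows "level (f * g) (k + j) x"
proof -
  have "[a = b] (mod p ^ k)" if "[a = b] (mod p ^ (k + j))" for a b
    using that by (rule cong_dvd_modulus_nat) (simp add: power_add)
  thus ?thesis using assms tau_funpow_mult unfolding level_def by blast
qed

lemma level_add: "level f k x \<Longrightarrow> level f k y \<Longrightarrow> level f k (x + y)"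
  and level_mult: "level f k x \<Longrightarrow> level f k y \<Longrightarrow> level f k (x * y)"
proof -
  assume l: "level f k x" "level f k y"
  note x = levelD[OF l(1)] and y = levelD[OF l(2)]
  have "sig a (x + y) = sig b (x + y) \<and> sig a (x * y) = sig b (x * y)"
    if ab: "coprime a p" "coprime b p" "[a = b] (mod p ^ k)" for a b
    using sigD(3,4)[OF ab(1) x(1) y(1)] sigD(3,4)[OF ab(2) x(1) y(1)] x(3)[OF ab] y(3)[OF ab] by simp
  moreover have "x + y \<in> L" "x * y \<in> L" using Qcyc_closed(5,6) x(1) y(1) by blast+
  moreover have "(tau ^^ f) (x + y) = x + y" "(tau ^^ f) (x * y) = x * y"
    using tau_funpowD(3,4)[OF x(1) y(1)] x(2) y(2) by simp_all
  ultimately show "level f k (x + y)" "level f k (x * y)" unfolding level_def by blast+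
qed

lemma level_of_nat: "level f k (of_nat n)"
  using lev_level[OF lev_closed(2)] .

lemma level_inverse: "level f k x \<Longrightarrow> level f k (inverse x)"
proof -
  assume l: "level f k x"
  note x = levelD[OF l]
  have "sig a (inverse x) = sig b (inverse x)"
    if ab: "coprime a p" "coprime b p" "[a = b] (mod p ^ k)" for a b
    using sigD(7)[OF ab(1) x(1)] sigD(7)[OF ab(2) x(1)] x(3)[OF ab] by simp
  moreover have "inverse x \<in> L" using Qcyc_closed(4) x(1) by blast
  moreover have "(tau ^^ f) (inverse x) = inverse x" using tau_funpowD(7)[OF x(1)] x(2) by simp
  ultimately show "level f k (inverse x)" unfolding level_def by blast
qed

lemma level_exists:
  assumes "x \<in> L"
  obtains f k m where "f > 0" "level f (Suc k) x" "m > (0::nat)" "of_nat m * x \<in> lev f (Suc k)"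
proof -
  obtain k m where km: "m > (0::nat)" "of_nat m * x \<in> integers (Suc k)" using L_integers_quotient assms by blast
  obtain f where f: "f > 0" "(tau ^^ f) (of_nat m * x) = of_nat m * x" using integers_levels(1)[OF km(2)] by blast
  have l: "of_nat m * x \<in> lev f (Suc k)" using f km by (simp add: lev_def)
  have "level f (Suc k) (of_nat m * x * inverse (of_nat m))"
    by (intro level_mult level_inverse level_of_nat lev_level l)
  moreover have "of_nat m * x * inverse (of_nat m) = x" using km(1) by simp
  ultimately have "level f (Suc k) x" by simp
  thus ?thesis using that f(1) km(1) l by blast
qed

lemma Nm_in_L: "x \<in> L \<Longrightarrow> Nm f k x \<in> L"
  unfolding Nm_def by (intro Qcyc_closed(10)) (auto simp: U_coprime)

lemma Nm_mult: "x \<in> L \<Longrightarrow> y \<in> L \<Longrightarrow> Nm f k (x * y) = Nm f k x * Nm f k y"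
proof -
  assume "x \<in> L" "y \<in> L"
  hence "(tau ^^ i) (sig a (x * y)) = (tau ^^ i) (sig a x) * (tau ^^ i) (sig a y)" if "a \<in> U k" for i a
    using U_coprime[OF that] by (simp add: sigD tau_funpowD)
  thus ?thesis unfolding Nm_def by (simp add: prod.distrib cong: prod.cong)
qed

lemma Nm_of_nat: "Nm f k (of_nat n) = of_nat n ^ wt f k"
proof -
  have "(tau ^^ i) (sig a (of_nat n)) = of_nat n" if "a \<in> U k" for i a
    using U_coprime[OF that] by (simp add: sigD tau_funpowD)
  hence "Nm f k (of_nat n) = (\<Prod>i<f. \<Prod>a\<in>U k. of_nat n)" unfolding Nm_def by simp
  thus ?thesis by (simp only: prod_const_wt)
qed

lemma Nm_eq_0_iff:
  assumes "x \<in> L" "f > 0"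
  shows "Nm f (Suc k) x = 0 \<longleftrightarrow> x = 0"
proof
  assume "Nm f (Suc k) x = 0"
  then obtain i a where a: "a \<in> U (Suc k)" "(tau ^^ i) (sig a x) = 0" unfolding Nm_def by auto
  have c: "coprime a p" using a U_coprime by blast
  have "sig a x = 0" using a(2) tau_funpowD(15)[OF sig_in[OF c assms(1)]] by simp
  thus "x = 0" using sigD(15)[OF c assms(1)] by simp
next
  assume "x = 0"
  thus "Nm f (Suc k) x = 0" using Nm_of_nat[of f "Suc k" 0] wt_pos[OF assms(2), of k] by (simp add: power_0_left)
qed

lemma Nm_fixed:
  assumes x: "\<And>i a. a \<in> U k \<Longrightarrow> (tau ^^ i) (sig a x) = x"
  shows "Nm f k x = x ^ wt f k"
proof -
  have "Nm f k x = (\<Prod>i<f. \<Prod>a\<in>U k. x)" unfolding Nm_def by (intro prod.cong refl x)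
  thus ?thesis by (simp only: prod_const_wt)
qed

lemma U_mult_bij:
  assumes "coprime b p"
  shows "bij_betw (\<lambda>a. b * a mod p ^ k) (U k) (U k)"
proof -
  have pk: "p ^ k > 0" using p_pos by simp
  have cb: "coprime b (p ^ k)" using assms by simp
  have into: "b * a mod p ^ k \<in> U k" if "a \<in> U k" for a
  proof (cases "k = 0")
    case False
    have "coprime (b * a) (p ^ k)" using that assms by (auto simp: U_def)
    hence "coprime (b * a mod p ^ k) (p ^ k)"
      using coprime_mod_left_iff[of "p ^ k" "b * a"] pk by (metis less_irrefl)
    thus ?thesis using False pk by (simp add: U_def)
  qed (use that in \<open>auto simp: U_def\<close>)
  have inj: "inj_on (\<lambda>a. b * a mod p ^ k) (U k)"
  proof (rule inj_onI)
    fix a a' assume a: "a \<in> U k" "a' \<in> U k" "b * a mod p ^ k = b * a' mod p ^ k"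
    hence "[b * a = b * a'] (mod p ^ k)" by (simp add: cong_def)
    hence "[a = a'] (mod p ^ k)" using cb by (simp add: cong_mult_lcancel_nat)
    thus "a = a'" using a by (simp add: cong_def U_def)
  qed
  show ?thesis
    unfolding bij_betw_def using inj into
    by (metis (no_types, lifting) endo_inj_surj finite_U image_subsetI)
qed

text \<open>The automorphism \<open>tau\<close> shifts the inner products \<open>g i\<close>
  cyclically, and \<open>sig b\<close> permutes the residues in \<open>U k\<close>. Being fixed by
  all of them characterises \<open>F\<close> inside \<open>L\<close>.\<close>

lemma Nm_in_F:
  assumes l: "level f k x"
  shows "Nm f k x \<in> F"
proof -
  note x = levelD[OF l]
  define g where "g i = (\<Prod>a\<in>U k. (tau ^^ i) (sig a x))" for i
  have N: "Nm f k x = (\<Prod>i<f. g i)" by (simp add: Nm_def g_def)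
  have gL: "g i \<in> L" for i unfolding g_def using x(1) by (intro Qcyc_closed(10)) (simp add: U_coprime)
  have tg: "tau (g i) = g (Suc i)" for i
    unfolding g_def using x(1) by (subst tauD(10)) (auto simp: U_coprime)
  have gf: "g f = g 0"
    unfolding g_def
  proof (rule prod.cong)
    fix a assume "a \<in> U k"
    hence "coprime a p" by (rule U_coprime)
    thus "(tau ^^ f) (sig a x) = (tau ^^ 0) (sig a x)" using sig_tau_funpow[of a x f] x(1,2) by simp
  qed simp
  have "tau (Nm f k x) = (\<Prod>i<f. g (Suc i))" unfolding N using gL by (subst tauD(10)) (auto simp: tg)
  also have "\<dots> = (\<Prod>i<f. g i)"
  proof (cases f)
    case (Suc f')
    have "(\<Prod>i<Suc f'. g (Suc i)) = (\<Prod>i<f'. g (Suc i)) * g 0" using gf Suc by simp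
    also have "\<dots> = (\<Prod>i<Suc f'. g i)" by (subst prod.lessThan_Suc_shift) (simp add: mult.commute)
    finally show ?thesis using Suc by simp
  qed simp
  finally have 1: "tau (Nm f k x) = Nm f k x" by (simp add: N)
  have 2: "sig b (Nm f k x) = Nm f k x" if b: "coprime b p" for b
  proof -
    have "sig b (g i) = g i" for i
    proof -
      have "sig b (g i) = (\<Prod>a\<in>U k. sig b ((tau ^^ i) (sig a x)))"
        unfolding g_def using x(1) by (intro sigD(10)[OF b]) (simp add: U_coprime)
      also have "\<dots> = (\<Prod>a\<in>U k. (tau ^^ i) (sig (b * a mod p ^ k) x))"
      proof (rule prod.cong)
        fix a assume a: "a \<in> U k"
        have ca: "coprime a p" using U_coprime a by blast
        have "b * a mod p ^ k \<in> U k" using U_mult_bij[OF b] a by (auto simp: bij_betw_def)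
        hence cb: "coprime (b * a mod p ^ k) p" by (rule U_coprime)
        have "sig (b * a) x = sig (b * a mod p ^ k) x"
          using cb b ca by (intro x(3)) (auto simp: cong_def)
        thus "sig b ((tau ^^ i) (sig a x)) = (tau ^^ i) (sig (b * a mod p ^ k) x)"
          using sig_tau_funpow[OF b sig_in[OF ca x(1)]] sig_sig[OF b ca x(1)] by simp
      qed simp
      also have "\<dots> = g i" unfolding g_def by (rule prod.reindex_bij_betw[OF U_mult_bij[OF b]])
      finally show ?thesis .
    qed
    thus ?thesis unfolding N using gL by (subst sigD(10)[OF b]) auto
  qed
  show ?thesis unfolding F_eq using Nm_in_L[OF x(1)] 1 2 by blast
qed

text \<open>Going up to level \<open>(f * g, Suc k + j)\<close> runs \<open>g\<close> times through
  the powers of \<open>tau\<close> and \<open>p ^ j\<close> times through the units modulo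
  \<open>p ^ Suc k\<close>.\<close>

lemma Nm_scale:
  assumes l: "level f (Suc k) x"
  shows "Nm (f * g) (Suc k + j) x = Nm f (Suc k) x ^ (g * p ^ j)"
proof -
  note x = levelD[OF l]
  \<comment> \<open>The value 1 off the units turns the product over \<open>U\<close> into one over
    an interval, where both repetitions become periodicity.\<close>
  define h where "h i a = (if coprime a p then (tau ^^ i) (sig a x) else 1)" for i a
  have U: "(\<Prod>a\<in>U m. (tau ^^ i) (sig a x)) = (\<Prod>a<p ^ m. h i a)" for m i
  proof -
    have "U m = {a \<in> {..<p ^ m}. coprime a p}" by (auto simp: U_def)
    thus ?thesis unfolding h_def using prod.inter_filter[of "{..<p ^ m}"] by (metis finite_lessThan)
  qed
  have per: "h i (a + p ^ Suc k) = h i a" for i a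
  proof -
    have "(a + p ^ Suc k) mod p = a mod p" by simp
    hence *: "coprime (a + p ^ Suc k) p \<longleftrightarrow> coprime a p"
      using coprime_mod_left_iff[of p "a + p ^ Suc k"] coprime_mod_left_iff[of p a] p_pos
      by (metis less_irrefl)
    show ?thesis
    proof (cases "coprime a p")
      case True
      have "[a + p ^ Suc k = a] (mod p ^ Suc k)" by (simp add: cong_def)
      hence "sig (a + p ^ Suc k) x = sig a x" using * True by (intro x(3)) blast+
      thus ?thesis using * True unfolding h_def by (simp only:)
    next
      case False
      thus ?thesis using * unfolding h_def by (simp only: if_False)
    qed
  qed
  have perf: "h (i + f) a = h i a" for i a
  proof (cases "coprime a p")
    case True
    thus ?thesis using sig_tau_funpow[OF True x(1), of f] x(2) by (simp add: h_def funpow_add)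
  qed (simp add: h_def)
  have "(\<Prod>a<p ^ (Suc k + j). h i a) = (\<Prod>a<p ^ Suc k. h i a) ^ (p ^ j)" for i
    using prod_periodic[of "h i" "p ^ Suc k" "p ^ j"] per by (simp only: power_add mult.commute)
  hence "Nm (f * g) (Suc k + j) x = (\<Prod>i<g * f. (\<Prod>a<p ^ Suc k. h i a) ^ (p ^ j))"
    unfolding Nm_def U by (simp only: mult.commute)
  also have "\<dots> = (\<Prod>i<f. (\<Prod>a<p ^ Suc k. h i a) ^ (p ^ j)) ^ g"
    by (rule prod_periodic) (simp only: perf)
  also have "\<dots> = Nm f (Suc k) x ^ (g * p ^ j)"
    unfolding Nm_def U by (simp only: prod_power_distrib[symmetric] power_mult[symmetric] mult.commute)
  finally show ?thesis .
qed

text \<open>Read off from the scaling of norms by applying it to the constant \<open>p\<close> and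
  comparing exponents.\<close>

lemma wt_scale: "wt (f * g) (Suc k + j) = wt f (Suc k) * (g * p ^ j)"
proof -
  have "(of_nat p :: complex) ^ wt (f * g) (Suc k + j) = of_nat p ^ (wt f (Suc k) * (g * p ^ j))"
    using Nm_scale[OF level_of_nat[of f "Suc k" p], of g j] unfolding Nm_of_nat by (simp only: power_mult)
  hence "p ^ wt (f * g) (Suc k + j) = p ^ (wt f (Suc k) * (g * p ^ j))"
    by (metis of_nat_eq_iff of_nat_power)
  thus ?thesis using p_gt_1 by simp
qed

lemma v_Nm:
  assumes v: "padic_ext L v" and x: "x \<in> L"
  shows "v (Nm f k x) = ereal (real (wt f k)) * v x"
proof -
  interpret valued_field L v using padic_ext_valued_field[OF complex_subfield_Qcyc v] .
  have *: "v ((tau ^^ i) (sig a x)) = v x" if "a \<in> U k" for i a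
    using v_tau_funpow[OF v sig_in[OF U_coprime[OF that] x]] v_sig[OF v U_coprime[OF that] x] by simp
  have "v (Nm f k x) = (\<Sum>i<f. v (\<Prod>a\<in>U k. (tau ^^ i) (sig a x)))"
    unfolding Nm_def using x by (intro v_prod prod_in) (simp add: U_coprime)
  also have "\<dots> = (\<Sum>i<f. \<Sum>a\<in>U k. v ((tau ^^ i) (sig a x)))"
    using x by (intro sum.cong refl v_prod) (simp add: U_coprime)
  also have "\<dots> = (\<Sum>i<f. \<Sum>a\<in>U k. v x)" using * by simp
  also have "\<dots> = (\<Sum>i<f. v (\<Prod>a\<in>U k. x))" using x by (simp only: v_prod)
  also have "\<dots> = v (\<Prod>i<f. \<Prod>a\<in>U k. x)" using x by (intro v_prod[symmetric] prod_in)
  also have "(\<Prod>i<f. \<Prod>a\<in>U k. x) = x ^ wt f k" by (rule prod_const_wt)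
  finally show ?thesis using x by (simp add: v_power)
qed

lemma padic_ext_unique:
  assumes v: "padic_ext L v" and v': "padic_ext L v'"
    and eq: "\<And>x. x \<in> F \<Longrightarrow> v x = v' x" and x: "x \<in> L"
  shows "v x = v' x"
proof -
  obtain f k where fk: "f > 0" "level f (Suc k) x" using level_exists[OF x] by blast
  have "ereal (real (wt f (Suc k))) * v x = ereal (real (wt f (Suc k))) * v' x"
    using eq[OF Nm_in_F[OF fk(2)]] v_Nm[OF v x] v_Nm[OF v' x] by simp
  thus ?thesis using wt_pos[OF fk(1), of k] by (simp add: ereal_mult_cancel_left)
qed

section \<open>Extending a valuation from the fixed field of the Frobenius\<close>

lemma idempotent_power:
  assumes "e \<in> integers k" "congr k m (e * e) e" "n > 0"
  shows "congr k m (e ^ n) e"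
  using assms(3)
proof (induction n rule: nat_induct_non_zero)
  case (Suc n)
  have "congr k m (e * e ^ n) (e * e)" using Suc assms(1) by (intro congr_mult) auto
  thus ?case using assms(2) congr_trans by auto
qed simp

text \<open>An approximate idempotent is congruent to all its conjugates, hence to its norm.\<close>

lemma idempotent_Nm:
  assumes e: "e \<in> integers k" "congr k (unif k) (e * e) e" and f: "f > 0" and k: "k > 0"
  shows "congr k (unif k) (Nm f k e) e"
proof -
  have conj: "congr k (unif k) ((tau ^^ i) (sig a e)) e \<and> (tau ^^ i) (sig a e) \<in> integers k"
    if "coprime a p" for i a
  proof (induction i)
    case 0
    show ?case using tau_sig_congr(2,4)[OF e(1) that] by simp
  next
    case (Suc i)
    let ?x = "(tau ^^ i) (sig a e)"
    have "congr k (unif k) (tau ?x) (?x ^ p)" using tau_sig_congr(1) Suc by blast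
    also have "congr k (unif k) \<dots> (e ^ p)" using Suc e(1) by (intro congr_power) auto
    also have "congr k (unif k) \<dots> e" by (rule idempotent_power[OF e p_pos])
    finally show ?case using tau_sig_congr(3) Suc by simp
  qed
  obtain k' where k': "k = Suc k'" using k by (cases k) auto
  have "congr k (unif k) (Nm f k e) (\<Prod>i<f. \<Prod>a\<in>U k. e)"
    unfolding Nm_def using conj U_coprime e(1)
    by (intro congr_prod integers_prod) auto
  also have "(\<Prod>i<f. \<Prod>a\<in>U k. e) = e ^ wt f k" by (rule prod_const_wt)
  also have "congr k (unif k) \<dots> e"
    using wt_pos[OF f, of k'] k' by (intro idempotent_power[OF e]) simp
  finally show ?thesis .
qed

lemma Nm_integers: "x \<in> integers k \<Longrightarrow> Nm f k x \<in> integers k"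
  unfolding Nm_def using tau_sig_congr(4) tau_funpow_integers U_coprime
  by (intro integers_prod) blast

context
  fixes u :: "complex \<Rightarrow> ereal"
  assumes u: "padic_ext F u"
begin

interpretation uF: valued_field F u using padic_ext_valued_field[OF complex_subfield_F u] .

lemma u_integers: "x \<in> F \<Longrightarrow> x \<in> integers k \<Longrightarrow> 0 \<le> u x"
  using v_integers_nonneg[OF complex_subfield_F u] .

text \<open>The uniformiser need not lie in \<open>F\<close>, where \<open>u\<close> is a valuation.
  Instead \<open>t ^ M\<close> is divided by \<open>p\<close>: the quotient \<open>s\<close> lies in
  \<open>F\<close> and is a cyclotomic integer, so \<open>u (t ^ M)\<close> is at least 1.\<close>

lemma u_congr_pos:
  assumes "congr k (unif k) t 0" "t \<in> F"
  shows "0 < u t"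
proof (rule ccontr)
  assume neg: "\<not> 0 < u t"
  obtain c where c: "c \<in> integers k" "t = unif k * c" using assms(1) by (auto simp: congr_def)
  obtain M where M: "congr k (of_nat p) (unif k ^ M) 0" using unif_power by blast
  then obtain d where d: "d \<in> integers k" "unif k ^ M = of_nat p * d" by (auto simp: congr_def)
  define s where "s = t ^ M / of_nat p"
  have "s = d * c ^ M" using c(2) d(2) p_pos by (simp add: s_def power_mult_distrib)
  hence sI: "s \<in> integers k" using c d by blast
  have sF: "s \<in> F" unfolding s_def by (intro F_closed(8,9,12) assms)
  have "t ^ M = of_nat p * s" using p_pos by (simp add: s_def)
  hence "u (t ^ M) = 1 + u s" using uF.v_mult[OF uF.of_nat_in sF] padic_ext_p[OF u] by simp
  hence "0 < u (t ^ M)" using u_integers[OF sF sI] by (simp add: add_pos_nonneg)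
  moreover have "u (t ^ M) = ereal (real M) * u t" by (rule uF.v_power[OF assms(2)])
  moreover have "ereal (real M) * u t \<le> ereal (real M) * 0" using neg by (intro ereal_mult_left_mono) auto
  ultimately show False by simp
qed

text \<open>Both \<open>e\<close> and \<open>d = 1 - e\<close> are idempotent modulo the
  uniformiser, hence congruent to their norms, so that \<open>Nm f k d\<close> is close to
  \<open>1 - Nm f k e\<close>. The norm of \<open>e\<close> is a power of the norm of
  \<open>c\<close> and has positive value, which gives the norm of \<open>d\<close> the value
  0.\<close>

lemma Nm_step:
  assumes f: "f > 0" and k: "k > 0" and c: "c \<in> lev f k" "0 < u (Nm f k c)"
  shows "\<exists>d\<in>lev f k. u (Nm f k d) = 0 \<and> congr k (unif k) (d * c) 0"
proof -
  have cI: "c \<in> integers k" using lev_closed(9)[OF c(1)] .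
  obtain g where g: "g > 0" "congr k (unif k) (c ^ (p ^ g)) c" using Frobenius_power_fixed[OF cI] by blast
  have "1 < p ^ g" using g p_gt_1 by (intro one_less_power) auto
  \<comment> \<open>The exponent \<open>Suc q = p ^ g - 1\<close> must be positive for
    \<open>e\<close> to inherit positive value from \<open>c\<close>.\<close>
  hence "p ^ g = Suc (Suc (p ^ g - 2))" by linarith
  then obtain q where q: "p ^ g = Suc (Suc q)" by (rule that)
  define e where "e = c ^ Suc q"
  define d where "d = 1 - e"
  have eL: "e \<in> lev f k" unfolding e_def by (rule lev_closed(7)[OF c(1)])
  have dL: "d \<in> lev f k" unfolding d_def by (rule lev_closed(5)[OF lev_closed(1) eL])
  have I: "e \<in> integers k" "d \<in> integers k" using lev_closed(9)[OF eL] lev_closed(9)[OF dL] .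
  have "e * e = c ^ (p ^ g) * c ^ q" by (simp add: e_def q flip: power_add)
  also have "congr k (unif k) \<dots> (c * c ^ q)" using g cI by (intro congr_mult) auto
  also have "c * c ^ q = e" by (simp add: e_def)
  finally have ee: "congr k (unif k) (e * e) e" .
  have "d * d = 1 - e - (e - e * e)" by (simp add: d_def algebra_simps)
  moreover have "congr k (unif k) (1 - e - (e - e * e)) (1 - e - (e - e))"
    by (intro congr_diff congr_refl ee)
  ultimately have dd: "congr k (unif k) (d * d) d" by (simp add: d_def)
  have F: "Nm f k d \<in> F" "Nm f k e \<in> F" using Nm_in_F[OF lev_level[OF dL]] Nm_in_F[OF lev_level[OF eL]] .
  have "congr k (unif k) (Nm f k d - (1 - Nm f k e)) (d - (1 - e))"
    by (intro congr_diff congr_refl idempotent_Nm I dd ee f k)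
  hence t: "0 < u (Nm f k d - (1 - Nm f k e))"
    using F by (intro u_congr_pos) (auto simp: d_def)
  have "Nm f k (c ^ n) = Nm f k c ^ n" for n
  proof (induction n)
    case 0
    show ?case using Nm_of_nat[of f k 1] by simp
  next
    case (Suc n)
    thus ?case using Nm_mult lev_closed(7,8) c(1) by (metis power_Suc)
  qed
  hence "u (Nm f k e) = u (Nm f k c ^ Suc q)" by (simp only: e_def)
  also have "0 < \<dots>" using Nm_in_F[OF lev_level[OF c(1)]] c(2) by (intro uF.v_power_pos) auto
  finally have "u (1 - Nm f k e) = 0" using F(2) by (rule uF.v_one_minus[rotated])
  hence "u (Nm f k d) = 0" using uF.v_eq_if_close[of "1 - Nm f k e" "Nm f k d"] F t by simp
  moreover have "d * c = c - c ^ (p ^ g)" by (simp add: d_def e_def q algebra_simps)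
  hence "congr k (unif k) (d * c) 0" using congr_diff[OF congr_refl g(2), of c] by simp
  ultimately show ?thesis using dL by blast
qed

text \<open>The formula is forced, since a valuation above \<open>p\<close> multiplies by
  \<open>wt\<close> when composed with the norm. The choice of level is immaterial by
  \<open>ext_val_eq\<close>.\<close>

definition ext_val :: "complex \<Rightarrow> ereal" where
  "ext_val x = (let (f, k) = SOME (f, k). f > 0 \<and> level f (Suc k) x
     in u (Nm f (Suc k) x) / ereal (real (wt f (Suc k))))"

text \<open>Two levels are compared through their common refinement \<open>(f * f', k + k')\<close>,
  where the value of the norm and the weight are multiplied by the same factor.\<close>

lemma ext_val_eq:
  assumes l: "f > 0" "level f (Suc k) x"
  shows "ext_val x = u (Nm f (Suc k) x) / ereal (real (wt f (Suc k)))"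
proof -
  define val where "val f k = u (Nm f (Suc k) x) / ereal (real (wt f (Suc k)))" for f k
  have scale: "val (f * g) (k + j) = val f k" if l: "f > 0" "g > 0" "level f (Suc k) x" for f g k j
  proof -
    have F: "Nm f (Suc k) x \<in> F" using Nm_in_F l by blast
    have c: "g * p ^ j > 0" using l p_pos by simp
    have "val (f * g) (k + j) = ereal (real (g * p ^ j)) * u (Nm f (Suc k) x) / ereal (real (wt f (Suc k) * (g * p ^ j)))"
      unfolding val_def using Nm_scale[OF l(3), of g j] wt_scale[of f g k j] uF.v_power[OF F] by simp
    also have "\<dots> = val f k"
      unfolding val_def using c wt_pos[OF l(1), of k]
      by (cases "u (Nm f (Suc k) x)") (auto simp: field_simps)
    finally show ?thesis .
  qed
  define w where "w = (SOME (f, k). f > 0 \<and> level f (Suc k) x)"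
  obtain f' k' where w: "w = (f', k')" by (cases w)
  have "case w of (f, k) \<Rightarrow> f > 0 \<and> level f (Suc k) x"
    unfolding w_def by (rule someI[of _ "(f, k)"]) (use l in simp)
  hence l': "f' > 0" "level f' (Suc k') x" by (simp_all add: w)
  have "ext_val x = val f' k'" by (simp add: ext_val_def val_def w flip: w_def)
  also have "\<dots> = val (f' * f) (k' + k)" by (rule scale[symmetric]) (use l l' in auto)
  also have "\<dots> = val (f * f') (k + k')" by (simp add: mult.commute add.commute)
  also have "\<dots> = val f k" by (rule scale) (use l l' in auto)
  finally show ?thesis by (simp add: val_def)
qed

lemma level_common:
  assumes "x \<in> L" "y \<in> L"
  obtains f k where "f > 0" "level f (Suc k) x" "level f (Suc k) y"
proof -
  obtain f k where fk: "f > 0" "level f (Suc k) x" using level_exists[OF assms(1)] by blast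
  obtain f' k' where fk': "f' > 0" "level f' (Suc k') y" using level_exists[OF assms(2)] by blast
  have "level (f * f') (Suc (k + k')) x" "level (f * f') (Suc (k + k')) y"
    using level_mono[OF fk(2), of f' k'] level_mono[OF fk'(2), of f k] by (simp_all add: mult.commute add.commute)
  thus ?thesis using that[of "f * f'" "k + k'"] fk(1) fk'(1) by simp
qed

lemma ext_val_mult:
  assumes "x \<in> L" "y \<in> L"
  shows "ext_val (x * y) = ext_val x + ext_val y"
proof -
  obtain f k where l: "f > 0" "level f (Suc k) x" "level f (Suc k) y" using level_common[OF assms] by blast
  have F: "Nm f (Suc k) x \<in> F" "Nm f (Suc k) y \<in> F" using Nm_in_F l by blast+
  show ?thesis
    unfolding ext_val_eq[OF l(1,2)] ext_val_eq[OF l(1,3)] ext_val_eq[OF l(1) level_mult[OF l(2,3)]]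
      Nm_mult[OF assms] uF.v_mult[OF F]
    using wt_pos[OF l(1), of k] uF.v_not_MInf[OF F(1)] uF.v_not_MInf[OF F(2)]
    by (cases "u (Nm f (Suc k) x)"; cases "u (Nm f (Suc k) y)") (auto simp: add_divide_distrib)
qed

lemma ext_val_F:
  assumes "x \<in> F"
  shows "ext_val x = u x"
proof -
  have xL: "x \<in> L" and fix_x: "tau x = x" "\<And>c. coprime c p \<Longrightarrow> sig c x = x" using assms by (auto simp: F_eq)
  have tf: "(tau ^^ i) x = x" for i by (induction i) (auto simp: fix_x)
  have l: "level 1 (Suc 0) x" using xL fix_x by (simp add: level_def)
  have "Nm 1 (Suc 0) x = x ^ wt 1 (Suc 0)" using fix_x tf U_coprime by (intro Nm_fixed) simp
  hence "ext_val x = ereal (real (wt 1 (Suc 0))) * u x / ereal (real (wt 1 (Suc 0)))"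
    using ext_val_eq[OF _ l] uF.v_power[OF assms] by simp
  thus ?thesis using wt_pos[of 1 0] by (cases "u x") auto
qed

text \<open>The heart of the ultrametric inequality. Writing \<open>z\<close> as
  \<open>c / d\<close> with integers of finite level and \<open>d\<close> of norm value 0, the
  number \<open>1 + z\<close> becomes \<open>(d + c) / d\<close>. The norm of the integer
  \<open>d + c\<close> is an integral element of \<open>F\<close>, on which \<open>u\<close> is
  nonnegative.\<close>

lemma ext_val_one_plus:
  assumes z: "z \<in> L" "0 \<le> ext_val z"
  shows "0 \<le> ext_val (1 + z)"
proof -
  obtain f k m where l: "f > 0" "level f (Suc k) z" and m: "m > (0::nat)" "of_nat m * z \<in> lev f (Suc k)"
    using level_exists[OF z(1)] by blast
  define V where "V c = u (Nm f (Suc k) c)" for c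
  have w: "wt f (Suc k) > 0" using wt_pos[OF l(1)] .
  have VF: "Nm f (Suc k) c \<in> F" if "c \<in> lev f (Suc k)" for c using Nm_in_F[OF lev_level[OF that]] .
  have Vm: "V (c * d) = V c + V d" if "level f (Suc k) c" "level f (Suc k) d" for c d
    unfolding V_def Nm_mult[OF levelD(1)[OF that(1)] levelD(1)[OF that(2)]]
    by (rule uF.v_mult[OF Nm_in_F[OF that(1)] Nm_in_F[OF that(2)]])
  have Vn: "0 \<le> V c" if "c \<in> lev f (Suc k)" for c
    unfolding V_def using u_integers[OF VF[OF that] Nm_integers[OF lev_closed(9)[OF that]]] .
  have nn: "0 \<le> V y \<longleftrightarrow> 0 \<le> ext_val y" if "level f (Suc k) y" for y
    unfolding ext_val_eq[OF l(1) that] V_def[symmetric] using w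
    by (cases "V y") (auto simp: field_simps)
  have "\<exists>d\<in>lev f (Suc k). \<exists>c\<in>lev f (Suc k). V d = 0 \<and> d * z = c"
  proof (rule lev_quotient[OF _ Vn _ _ _ _ m])
    fix c d assume "c \<in> lev f (Suc k)" "d \<in> lev f (Suc k)"
    thus "V (c * d) = V c + V d" using Vm lev_level by blast
  next
    fix c assume c: "c \<in> lev f (Suc k)"
    thus "V c = \<infinity> \<longleftrightarrow> c = 0"
      unfolding V_def using uF.v_eq_PInf_iff[OF VF[OF c]] Nm_eq_0_iff[OF lev_closed(8)[OF c] l(1)] by simp
  next
    show "0 < V (of_nat p)"
      unfolding V_def Nm_of_nat using w padic_ext_p[OF u] by (intro uF.v_power_pos) auto
  next
    fix r assume "coprime r p"
    thus "V (of_nat r) = 0"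
      unfolding V_def Nm_of_nat using padic_ext_coprime[OF u] by (intro uF.v_power_eq_0) auto
  next
    fix c assume "c \<in> lev f (Suc k)" "0 < V c"
    thus "\<exists>d\<in>lev f (Suc k). V d = 0 \<and> congr (Suc k) (unif (Suc k)) (d * c) 0"
      unfolding V_def using Nm_step[OF l(1)] by blast
  next
    have "0 \<le> V z" using nn[OF l(2)] z(2) by simp
    thus "V (of_nat m) \<le> V (of_nat m * z)"
      using Vm[OF level_of_nat l(2)] by (simp add: ereal_le_add_self)
  qed
  then obtain d c where d: "d \<in> lev f (Suc k)" "c \<in> lev f (Suc k)" "V d = 0" "d * z = c" by blast
  have l1: "level f (Suc k) (1 + z)" using level_add[OF _ l(2), of 1] level_of_nat[of f "Suc k" 1] by simp
  have "d * (1 + z) = d + c" using d(4) by (simp add: algebra_simps)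
  hence "V d + V (1 + z) = V (d + c)" using Vm[OF lev_level[OF d(1)] l1] by simp
  hence "0 \<le> V (1 + z)" using Vn[OF lev_closed(4)[OF d(1,2)]] d(3) by simp
  thus ?thesis using nn[OF l1] by simp
qed

lemma ext_val_real_valuation: "real_valuation L ext_val"
proof -
  have 1: "ext_val x \<noteq> -\<infinity> \<and> (ext_val x = \<infinity> \<longleftrightarrow> x = 0)" if x: "x \<in> L" for x
  proof -
    obtain f k where l: "f > 0" "level f (Suc k) x" using level_exists[OF x] by blast
    have F: "Nm f (Suc k) x \<in> F" using Nm_in_F l by blast
    have w: "wt f (Suc k) > 0" using wt_pos[OF l(1)] .
    show ?thesis
      unfolding ext_val_eq[OF l] using uF.v_not_MInf[OF F] uF.v_eq_PInf_iff[OF F] Nm_eq_0_iff[OF x l(1), of k] w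
      by (cases "u (Nm f (Suc k) x)") auto
  qed
  have add: "ext_val x \<le> ext_val (x + y)"
    if xy: "x \<in> L" "y \<in> L" "ext_val x \<le> ext_val y" for x y
  proof (cases "x = 0")
    case True
    hence "ext_val y = \<infinity>" using xy 1[of 0] Qcyc_closed(2) by simp
    hence "y = 0" using 1[OF xy(2)] by simp
    thus ?thesis using True by simp
  next
    case False
    \<comment> \<open>Factoring out the summand of smaller value reduces the inequality to
      \<open>1 + z\<close> with \<open>z\<close> of nonnegative value.\<close>
    define z where "z = y / x"
    have z: "z \<in> L" "y = x * z" using xy False Qcyc_closed(8) by (auto simp: z_def)
    obtain r where r: "ext_val x = ereal r" using 1[OF xy(1)] False by (cases "ext_val x") auto
    have "ereal r \<le> ereal r + ext_val z" using xy(3) ext_val_mult[OF xy(1) z(1)] z(2) r by simp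
    hence "0 \<le> ext_val z" by (cases "ext_val z") auto
    hence "0 \<le> ext_val (1 + z)" by (rule ext_val_one_plus[OF z(1)])
    moreover have "x + y = x * (1 + z)" using z by (simp add: algebra_simps)
    moreover have "1 + z \<in> L" using z Qcyc_closed(1,5) by blast
    ultimately show ?thesis using ext_val_mult[OF xy(1), of "1 + z"] by (simp add: ereal_le_add_self)
  qed
  have "min (ext_val x) (ext_val y) \<le> ext_val (x + y)" if "x \<in> L" "y \<in> L" for x y
    using add[of x y] add[of y x] that by (auto simp: min_def add.commute)
  thus ?thesis unfolding real_valuation_def using 1 ext_val_mult by blast
qed

lemma padic_ext_exists: "\<exists>v\<in>Val_p p. \<forall>x\<in>F. v x = u x"
proof (intro bexI ballI)
  have eq: "restrict ext_val L x = ext_val x" if "x \<in> L" for x using that by simp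
  have "real_valuation L (restrict ext_val L)"
    using ext_val_real_valuation Qcyc_closed(5,6) unfolding real_valuation_def by simp
  moreover have "restrict ext_val L (of_rat q) = padic_val p q" for q
    using ext_val_F[OF F_closed(14)] u Qcyc_closed(14) by (simp add: padic_ext_def)
  ultimately show "restrict ext_val L \<in> Val_p p" by (simp add: Val_p_eq padic_ext_def)
  fix x assume "x \<in> F"
  thus "restrict ext_val L x = u x" using ext_val_F F_subset_L by simp
qed

end

end

section \<open>Completions\<close>

lemma ereal_add_gt:
  "ereal B < a \<Longrightarrow> ereal (C - B) < b \<Longrightarrow> ereal C < a + b"
  by (cases a; cases b) auto

context valued_field
begin

lemma cauchy_in: "s \<in> cauchy_seqs S v \<Longrightarrow> s n \<in> S"
  and null_in: "s \<in> null_seqs S v \<Longrightarrow> s n \<in> S"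
  by (auto simp: cauchy_seqs_def null_seqs_def)

lemma cauchyD: "s \<in> cauchy_seqs S v \<Longrightarrow> \<exists>N. \<forall>m\<ge>N. \<forall>n\<ge>N. ereal C < v (s m - s n)"
  by (auto simp: cauchy_seqs_def)

lemma tendsto_PInfty_seq:
  "(\<lambda>n. f n) \<longlonglongrightarrow> (\<infinity>::ereal) \<longleftrightarrow> (\<forall>C. \<exists>N. \<forall>n\<ge>N. ereal C < f n)"
  by (simp add: tendsto_PInfty eventually_sequentially)

lemma null_seqs_iff:
  "s \<in> null_seqs S v \<longleftrightarrow> (\<forall>n. s n \<in> S) \<and> (\<forall>C. \<exists>N. \<forall>n\<ge>N. ereal C < v (s n))"
proof
  assume "s \<in> null_seqs S v"
  thus "(\<forall>n. s n \<in> S) \<and> (\<forall>C. \<exists>N. \<forall>n\<ge>N. ereal C < v (s n))"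
    by (auto simp: null_seqs_def cauchy_seqs_def tendsto_PInfty_seq)
next
  assume *: "(\<forall>n. s n \<in> S) \<and> (\<forall>C. \<exists>N. \<forall>n\<ge>N. ereal C < v (s n))"
  have "\<exists>N. \<forall>m\<ge>N. \<forall>n\<ge>N. ereal C < v (s m - s n)" for C
  proof -
    obtain N where "\<forall>n\<ge>N. ereal C < v (s n)" using * by blast
    thus ?thesis using * by (intro exI[of _ N]) (simp add: v_diff_gt)
  qed
  thus "s \<in> null_seqs S v" using * by (auto simp: null_seqs_def cauchy_seqs_def tendsto_PInfty_seq)
qed

lemma null_cauchy: "s \<in> null_seqs S v \<Longrightarrow> s \<in> cauchy_seqs S v"
  by (simp add: null_seqs_def)

lemma const_cauchy: "x \<in> S \<Longrightarrow> (\<lambda>_. x) \<in> cauchy_seqs S v"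
  by (auto simp: cauchy_seqs_def)

lemma cauchy_add:
  assumes "s \<in> cauchy_seqs S v" "t \<in> cauchy_seqs S v"
  shows "(\<lambda>n. s n + t n) \<in> cauchy_seqs S v"
proof -
  have "\<exists>N. \<forall>m\<ge>N. \<forall>n\<ge>N. ereal C < v (s m + t m - (s n + t n))" for C
  proof -
    obtain N where N: "\<forall>m\<ge>N. \<forall>n\<ge>N. ereal C < v (s m - s n)" using cauchyD assms(1) by blast
    obtain M where M: "\<forall>m\<ge>M. \<forall>n\<ge>M. ereal C < v (t m - t n)" using cauchyD assms(2) by blast
    show ?thesis
    proof (intro exI[of _ "max N M"] allI impI)
      fix m n assume mn: "max N M \<le> m" "max N M \<le> n"
      have "ereal C < v ((s m - s n) + (t m - t n))"
        using N M mn cauchy_in assms by (intro v_add_gt) auto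
      thus "ereal C < v (s m + t m - (s n + t n))" by (simp add: algebra_simps)
    qed
  qed
  thus ?thesis using cauchy_in assms by (auto simp: cauchy_seqs_def)
qed

lemma cauchy_minus:
  assumes "s \<in> cauchy_seqs S v"
  shows "(\<lambda>n. - s n) \<in> cauchy_seqs S v"
proof -
  have "v (- s m - - s n) = v (s m - s n)" for m n
    using v_minus_commute[of "s m" "s n"] cauchy_in[OF assms] by simp
  thus ?thesis using cauchy_in[OF assms] assms by (auto simp: cauchy_seqs_def)
qed

lemma cauchy_bounded:
  assumes s: "s \<in> cauchy_seqs S v"
  obtains B where "\<And>n. ereal B < v (s n)"
proof -
  have fin: "\<exists>B. \<forall>n<N. ereal B < v (s n)" for N
  proof (induction N)
    case (Suc N)
    then obtain B where B: "\<forall>n<N. ereal B < v (s n)" by blast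
    have "v (s N) \<noteq> - \<infinity>" using cauchy_in[OF s] by simp
    then obtain B' where B': "ereal B' < v (s N)"
      using ereal_dense2[of "- \<infinity>" "v (s N)"] by auto
    have "\<forall>n<Suc N. ereal (min B B') < v (s n)"
    proof (intro allI impI)
      fix n assume n: "n < Suc N"
      show "ereal (min B B') < v (s n)"
        using B B' n by (cases "n = N") (auto simp: min_less_iff_disj)
    qed
    thus ?case by blast
  qed simp
  obtain N where N: "\<forall>m\<ge>N. \<forall>n\<ge>N. ereal 0 < v (s m - s n)" using cauchyD[OF s] by blast
  obtain B where B: "\<forall>n<Suc N. ereal B < v (s n)" using fin by blast
  have "ereal (min B 0) < v (s n)" for n
  proof (cases "n \<le> N")
    case True
    hence "ereal B < v (s n)" using B by simp
    moreover have "ereal (min B 0) \<le> ereal B" by simp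
    ultimately show ?thesis by (rule order.strict_trans1[rotated])
  next
    case False
    have "ereal (min B 0) < v (s n - s N)"
      by (rule order.strict_trans1[of _ "ereal 0"]) (use N False in auto)
    moreover have "ereal (min B 0) < v (s N)"
      by (rule order.strict_trans1[of _ "ereal B"]) (use B in auto)
    ultimately have "ereal (min B 0) < v ((s n - s N) + s N)"
      using cauchy_in[OF s] by (intro v_add_gt) auto
    thus ?thesis by simp
  qed
  thus ?thesis using that by blast
qed

lemma null_mult:
  assumes s: "s \<in> null_seqs S v" and t: "t \<in> cauchy_seqs S v"
  shows "(\<lambda>n. s n * t n) \<in> null_seqs S v"
proof -
  obtain B where B: "\<And>n. ereal B < v (t n)" using cauchy_bounded[OF t] by blast
  have "\<exists>N. \<forall>n\<ge>N. ereal C < v (s n * t n)" for C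
  proof -
    obtain N where N: "\<forall>n\<ge>N. ereal (C - B) < v (s n)" using s unfolding null_seqs_iff by blast
    have "ereal C < v (s n * t n)" if "n \<ge> N" for n
      using ereal_add_gt[OF B] N that v_mult[OF null_in[OF s] cauchy_in[OF t]] by (simp add: add.commute)
    thus ?thesis by blast
  qed
  thus ?thesis unfolding null_seqs_iff using null_in[OF s] cauchy_in[OF t] by simp
qed

lemma null_add:
  assumes s: "s \<in> null_seqs S v" and t: "t \<in> null_seqs S v"
  shows "(\<lambda>n. s n + t n) \<in> null_seqs S v"
proof -
  have "\<exists>N. \<forall>n\<ge>N. ereal C < v (s n + t n)" for C
  proof -
    obtain N where N: "\<forall>n\<ge>N. ereal C < v (s n)" using s unfolding null_seqs_iff by blast
    obtain M where M: "\<forall>n\<ge>M. ereal C < v (t n)" using t unfolding null_seqs_iff by blast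
    have "ereal C < v (s n + t n)" if "n \<ge> max N M" for n
      using N M that null_in[OF s] null_in[OF t] by (intro v_add_gt) auto
    thus ?thesis by blast
  qed
  thus ?thesis unfolding null_seqs_iff using null_in[OF s] null_in[OF t] by simp
qed

lemma null_minus: "s \<in> null_seqs S v \<Longrightarrow> (\<lambda>n. - s n) \<in> null_seqs S v"
  unfolding null_seqs_iff by simp

lemma null_diff:
  "s \<in> null_seqs S v \<Longrightarrow> t \<in> null_seqs S v \<Longrightarrow> (\<lambda>n. s n - t n) \<in> null_seqs S v"
  using null_add[of s "\<lambda>n. - t n"] null_minus[of t] by simp

lemma null_zero: "(\<lambda>_. 0) \<in> null_seqs S v"
  unfolding null_seqs_iff by simp

lemma cauchy_mult:
  assumes s: "s \<in> cauchy_seqs S v" and t: "t \<in> cauchy_seqs S v"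
  shows "(\<lambda>n. s n * t n) \<in> cauchy_seqs S v"
proof -
  obtain A where A: "\<And>n. ereal A < v (s n)" using cauchy_bounded[OF s] by blast
  obtain B where B: "\<And>n. ereal B < v (t n)" using cauchy_bounded[OF t] by blast
  have "\<exists>N. \<forall>m\<ge>N. \<forall>n\<ge>N. ereal C < v (s m * t m - s n * t n)" for C
  proof -
    obtain N where N: "\<forall>m\<ge>N. \<forall>n\<ge>N. ereal (C - B) < v (s m - s n)" using cauchyD[OF s] by blast
    obtain M where M: "\<forall>m\<ge>M. \<forall>n\<ge>M. ereal (C - A) < v (t m - t n)" using cauchyD[OF t] by blast
    show ?thesis
    proof (intro exI[of _ "max N M"] allI impI)
      fix m n assume mn: "max N M \<le> m" "max N M \<le> n"
      have in_S: "s m \<in> S" "s n \<in> S" "t m \<in> S" "t n \<in> S" using cauchy_in s t by auto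
      have "ereal C < v (s m * (t m - t n))"
        using ereal_add_gt[OF A[of m], of C "v (t m - t n)"] M mn in_S by (simp add: v_mult)
      moreover have "ereal C < v (t n * (s m - s n))"
        using ereal_add_gt[OF B[of n], of C "v (s m - s n)"] N mn in_S by (simp add: v_mult)
      ultimately have "ereal C < v (s m * (t m - t n) + t n * (s m - s n))"
        using in_S by (intro v_add_gt) auto
      thus "ereal C < v (s m * t m - s n * t n)" by (simp add: algebra_simps)
    qed
  qed
  thus ?thesis using cauchy_in s t by (auto simp: cauchy_seqs_def)
qed

lemma cauchy_ring_simps:
  "carrier (cauchy_ring S v) = cauchy_seqs S v"
  "s \<otimes>\<^bsub>cauchy_ring S v\<^esub> t = (\<lambda>n. s n * t n)" "s \<oplus>\<^bsub>cauchy_ring S v\<^esub> t = (\<lambda>n. s n + t n)"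
  "\<one>\<^bsub>cauchy_ring S v\<^esub> = (\<lambda>_. 1)" "\<zero>\<^bsub>cauchy_ring S v\<^esub> = (\<lambda>_. 0)"
  by (simp_all add: cauchy_ring_def)

lemma cring_cauchy_ring: "cring (cauchy_ring S v)"
proof (rule cringI)
  show "abelian_group (cauchy_ring S v)"
  proof (rule abelian_groupI, unfold cauchy_ring_simps)
    fix s assume "s \<in> cauchy_seqs S v"
    thus "\<exists>t\<in>cauchy_seqs S v. (\<lambda>n. t n + s n) = (\<lambda>_. 0)"
      using cauchy_minus by (intro bexI[of _ "\<lambda>n. - s n"]) auto
  qed (auto simp: cauchy_add const_cauchy add_ac)
  show "comm_monoid (cauchy_ring S v)"
    by (rule comm_monoidI, unfold cauchy_ring_simps) (auto simp: cauchy_mult const_cauchy mult_ac)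
qed (unfold cauchy_ring_simps, simp add: algebra_simps)

lemma ideal_null_seqs: "ideal (null_seqs S v) (cauchy_ring S v)"
proof -
  interpret R: cring "cauchy_ring S v" by (rule cring_cauchy_ring)
  have minus: "inv\<^bsub>add_monoid (cauchy_ring S v)\<^esub> s = (\<lambda>n. - s n)" if "s \<in> null_seqs S v" for s
  proof -
    have "\<ominus>\<^bsub>cauchy_ring S v\<^esub> s = (\<lambda>n. - s n)"
      using that null_cauchy cauchy_minus
      by (intro R.minus_equality) (auto simp: cauchy_ring_simps)
    thus ?thesis by (simp add: a_inv_def)
  qed
  show ?thesis
  proof (rule idealI)
    show "ring (cauchy_ring S v)" by (rule R.ring_axioms)
    show "subgroup (null_seqs S v) (add_monoid (cauchy_ring S v))"
    proof (rule group.subgroupI[OF R.a_group])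
      show "null_seqs S v \<noteq> {}" using null_zero by blast
      fix s assume "s \<in> null_seqs S v"
      thus "inv\<^bsub>add_monoid (cauchy_ring S v)\<^esub> s \<in> null_seqs S v" using minus null_minus by simp
    qed (auto simp: cauchy_ring_simps null_cauchy null_add)
  next
    fix s t assume "s \<in> null_seqs S v" "t \<in> carrier (cauchy_ring S v)"
    hence "(\<lambda>n. s n * t n) \<in> null_seqs S v" by (intro null_mult) (simp_all add: cauchy_ring_simps)
    thus "s \<otimes>\<^bsub>cauchy_ring S v\<^esub> t \<in> null_seqs S v" "t \<otimes>\<^bsub>cauchy_ring S v\<^esub> s \<in> null_seqs S v"
      by (simp_all add: cauchy_ring_simps mult.commute)
  qed
qed

lemma seq_class_ring_hom: "seq_class S v \<in> Ring.ring_hom (cauchy_ring S v) (completion S v)"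
proof -
  have "seq_class S v = (+>\<^bsub>cauchy_ring S v\<^esub>) (null_seqs S v)" by (rule ext) (simp add: seq_class_def)
  thus ?thesis using ideal.rcos_ring_hom[OF ideal_null_seqs] by (simp add: completion_def)
qed

lemma completion_simps:
  "s \<in> cauchy_seqs S v \<Longrightarrow> seq_class S v s \<in> carrier (completion S v)"
  "s \<in> cauchy_seqs S v \<Longrightarrow> t \<in> cauchy_seqs S v \<Longrightarrow>
    seq_class S v s \<oplus>\<^bsub>completion S v\<^esub> seq_class S v t = seq_class S v (\<lambda>n. s n + t n)"
  "s \<in> cauchy_seqs S v \<Longrightarrow> t \<in> cauchy_seqs S v \<Longrightarrow>
    seq_class S v s \<otimes>\<^bsub>completion S v\<^esub> seq_class S v t = seq_class S v (\<lambda>n. s n * t n)"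
  "\<one>\<^bsub>completion S v\<^esub> = seq_class S v (\<lambda>_. 1)"
  using seq_class_ring_hom by (auto simp: Ring.ring_hom_def cauchy_ring_simps)

lemma completion_carrierE:
  assumes "c \<in> carrier (completion S v)"
  obtains s where "s \<in> cauchy_seqs S v" "c = seq_class S v s"
  using assms unfolding completion_def FactRing_def A_RCOSETS_def' seq_class_def
  by (auto simp: cauchy_ring_simps)

lemma seq_class_eq_set:
  assumes "s \<in> cauchy_seqs S v"
  shows "seq_class S v s = {t. (\<lambda>n. t n - s n) \<in> null_seqs S v}"
proof (intro Set.set_eqI iffI)
  fix t assume "t \<in> seq_class S v s"
  then obtain h where "h \<in> null_seqs S v" "t = (\<lambda>n. h n + s n)"
    by (auto simp: seq_class_def a_r_coset_def' cauchy_ring_simps)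
  thus "t \<in> {t. (\<lambda>n. t n - s n) \<in> null_seqs S v}" by simp
next
  fix t assume "t \<in> {t. (\<lambda>n. t n - s n) \<in> null_seqs S v}"
  hence "(\<lambda>n. t n - s n) \<in> null_seqs S v" by simp
  moreover have "t = (\<lambda>n. (t n - s n) + s n)" by simp
  ultimately show "t \<in> seq_class S v s"
    unfolding seq_class_def a_r_coset_def' cauchy_ring_simps by blast
qed

lemma seq_class_eq_iff:
  assumes s: "s \<in> cauchy_seqs S v" and t: "t \<in> cauchy_seqs S v"
  shows "seq_class S v s = seq_class S v t \<longleftrightarrow> (\<lambda>n. s n - t n) \<in> null_seqs S v"
proof
  assume "seq_class S v s = seq_class S v t"
  moreover have "s \<in> seq_class S v s" using seq_class_eq_set[OF s] null_zero by simp
  ultimately show "(\<lambda>n. s n - t n) \<in> null_seqs S v" using seq_class_eq_set[OF t] by simp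
next
  assume st: "(\<lambda>n. s n - t n) \<in> null_seqs S v"
  have "(\<lambda>n. r n - s n) \<in> null_seqs S v \<longleftrightarrow> (\<lambda>n. r n - t n) \<in> null_seqs S v" for r
    using null_add[of "\<lambda>n. r n - s n", OF _ st] null_diff[of "\<lambda>n. r n - t n", OF _ st] by auto
  thus "seq_class S v s = seq_class S v t" by (simp add: seq_class_eq_set[OF s] seq_class_eq_set[OF t])
qed

text \<open>If the values do not tend to infinity, some late term has value below that of all later
  differences; the ultrametric inequality then freezes the value from that point on.\<close>

lemma cauchy_null_or_stationary:
  assumes s: "s \<in> cauchy_seqs S v"
  shows "s \<in> null_seqs S v \<or> (\<exists>r. \<exists>N. \<forall>n\<ge>N. v (s n) = ereal r)"
proof (cases "s \<in> null_seqs S v")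
  case False
  then obtain C where C: "\<And>N. \<exists>n\<ge>N. v (s n) \<le> ereal C"
    using cauchy_in[OF s] unfolding null_seqs_iff by (meson not_less)
  obtain N where N: "\<forall>m\<ge>N. \<forall>n\<ge>N. ereal C < v (s m - s n)" using cauchyD[OF s] by blast
  obtain m where m: "m \<ge> N" "v (s m) \<le> ereal C" using C by blast
  have "v (s n) = v (s m)" if "n \<ge> N" for n
    using N m that cauchy_in[OF s] by (intro v_eq_if_close) (auto intro: order.strict_trans1)
  moreover have "s m \<noteq> 0" using m(2) by auto
  then obtain r where "v (s m) = ereal r" using v_real cauchy_in[OF s] by blast
  ultimately have "\<forall>n\<ge>N. v (s n) = ereal r" by simp
  thus ?thesis by blast
qed simp

text \<open>The continuous extension of \<open>v\<close> to the completion. It is computed on an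
  arbitrary representative, and the limit is the same along every other one.\<close>

definition class_val :: "(nat \<Rightarrow> 'a) set \<Rightarrow> ereal" where
  "class_val c = lim (\<lambda>n. v ((SOME s. s \<in> c) n))"

lemma class_val_tendsto:
  assumes s: "s \<in> cauchy_seqs S v"
  shows "(\<lambda>n. v (s n)) \<longlonglongrightarrow> class_val (seq_class S v s)" "class_val (seq_class S v s) \<noteq> - \<infinity>"
proof -
  define t where "t = (SOME t. t \<in> seq_class S v s)"
  have "s \<in> seq_class S v s" using seq_class_eq_set[OF s] null_zero by simp
  hence "t \<in> seq_class S v s" unfolding t_def by (rule someI[of "\<lambda>t. t \<in> seq_class S v s"])
  hence ts: "(\<lambda>n. t n - s n) \<in> null_seqs S v" using seq_class_eq_set[OF s] by simp
  have t_in: "t n \<in> S" for n using null_in[OF ts, of n] cauchy_in[OF s, of n] add_in[of "t n - s n" "s n"] by simp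
  have "(\<exists>l. l \<noteq> - \<infinity> \<and> (\<lambda>n. v (s n)) \<longlonglongrightarrow> l \<and> (\<lambda>n. v (t n)) \<longlonglongrightarrow> l)"
    using cauchy_null_or_stationary[OF s]
  proof
    assume "s \<in> null_seqs S v"
    moreover from this have "t \<in> null_seqs S v" using null_add[OF ts, of s] by simp
    ultimately show ?thesis by (intro exI[of _ \<infinity>]) (simp add: null_seqs_def)
  next
    assume "\<exists>r N. \<forall>n\<ge>N. v (s n) = ereal r"
    then obtain r N where N: "\<forall>n\<ge>N. v (s n) = ereal r" by blast
    obtain M where M: "\<forall>n\<ge>M. ereal r < v (t n - s n)" using ts unfolding null_seqs_iff by blast
    have "v (t n) = ereal r" if "n \<ge> max N M" for n
    proof -
      have "v (s n) < v (t n - s n)" using N M that by simp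
      from v_eq_if_close[OF cauchy_in[OF s] t_in this] show ?thesis using N that by simp
    qed
    hence "\<forall>\<^sub>F n in sequentially. v (t n) = ereal r" unfolding eventually_sequentially by blast
    moreover have "\<forall>\<^sub>F n in sequentially. v (s n) = ereal r" unfolding eventually_sequentially using N by blast
    ultimately show ?thesis by (intro exI[of _ "ereal r"]) (simp add: tendsto_eventually)
  qed
  then obtain l where l: "l \<noteq> - \<infinity>" "(\<lambda>n. v (s n)) \<longlonglongrightarrow> l" "(\<lambda>n. v (t n)) \<longlonglongrightarrow> l" by blast
  have "class_val (seq_class S v s) = l" unfolding class_val_def t_def[symmetric] using l(3) by (rule limI)
  thus "(\<lambda>n. v (s n)) \<longlonglongrightarrow> class_val (seq_class S v s)" "class_val (seq_class S v s) \<noteq> - \<infinity>"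
    using l by simp_all
qed

lemma class_val_const: "x \<in> S \<Longrightarrow> class_val (seq_class S v (\<lambda>_. x)) = v x"
  using class_val_tendsto(1)[OF const_cauchy[of x]] LIMSEQ_unique tendsto_const by metis

lemma class_val_mult:
  assumes "c \<in> carrier (completion S v)" "d \<in> carrier (completion S v)"
  shows "class_val (c \<otimes>\<^bsub>completion S v\<^esub> d) = class_val c + class_val d"
proof -
  obtain s where s: "s \<in> cauchy_seqs S v" "c = seq_class S v s" using completion_carrierE assms(1) by blast
  obtain t where t: "t \<in> cauchy_seqs S v" "d = seq_class S v t" using completion_carrierE assms(2) by blast
  have "(\<lambda>n. v (s n) + v (t n)) \<longlonglongrightarrow> class_val c + class_val d"
    using class_val_tendsto s t by (intro tendsto_add_ereal_general) auto
  hence "(\<lambda>n. v (s n * t n)) \<longlonglongrightarrow> class_val c + class_val d"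
    using v_mult cauchy_in s t by simp
  moreover have "(\<lambda>n. v (s n * t n)) \<longlonglongrightarrow> class_val (c \<otimes>\<^bsub>completion S v\<^esub> d)"
    using class_val_tendsto(1)[OF cauchy_mult[OF s(1) t(1)]] completion_simps(3)[OF s(1) t(1)] s t by simp
  ultimately show ?thesis by (rule LIMSEQ_unique[rotated])
qed

lemma class_val_add:
  assumes "c \<in> carrier (completion S v)" "d \<in> carrier (completion S v)"
  shows "min (class_val c) (class_val d) \<le> class_val (c \<oplus>\<^bsub>completion S v\<^esub> d)"
proof -
  obtain s where s: "s \<in> cauchy_seqs S v" "c = seq_class S v s" using completion_carrierE assms(1) by blast
  obtain t where t: "t \<in> cauchy_seqs S v" "d = seq_class S v t" using completion_carrierE assms(2) by blast
  have 1: "(\<lambda>n. min (v (s n)) (v (t n))) \<longlonglongrightarrow> min (class_val c) (class_val d)"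
    using class_val_tendsto s t by (intro tendsto_min) auto
  have 2: "(\<lambda>n. v (s n + t n)) \<longlonglongrightarrow> class_val (c \<oplus>\<^bsub>completion S v\<^esub> d)"
    using class_val_tendsto(1)[OF cauchy_add[OF s(1) t(1)]] completion_simps(2)[OF s(1) t(1)] s t by simp
  show ?thesis by (rule LIMSEQ_le[OF 1 2]) (use v_add cauchy_in s t in auto)
qed

lemma class_val_not_MInf: "c \<in> carrier (completion S v) \<Longrightarrow> class_val c \<noteq> - \<infinity>"
  using class_val_tendsto(2) by (auto elim: completion_carrierE)

end

section \<open>Galois groups and actions\<close>

lemma galD:
  assumes "complex_subfield S" "\<sigma> \<in> gal S \<rat>"
  shows "\<sigma> \<in> extensional S" "complex_hom S \<sigma>" "\<sigma> ` S = S" "x \<in> S \<Longrightarrow> \<sigma> x \<in> S" "\<sigma> \<in> Bij S"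
  using assms(2) unfolding gal_eq[OF assms(1)] apply simp_all
  using complex_homD(16)[OF assms(1)] by (auto simp: Bij_def bij_betw_def)

lemma compose_in_gal:
  assumes S: "complex_subfield S" and "\<sigma> \<in> gal S \<rat>" "\<rho> \<in> gal S \<rat>"
  shows "compose S \<sigma> \<rho> \<in> gal S \<rat>"
proof -
  note s = galD[OF S assms(2)] and r = galD[OF S assms(3)] and cl = complex_subfieldD[OF S]
  have "complex_hom S (compose S \<sigma> \<rho>)"
    unfolding complex_hom_def using r(4) cl(1,5,6)
    by (simp add: compose_eq complex_homD[OF S s(2)] complex_homD[OF S r(2)])
  moreover have "compose S \<sigma> \<rho> ` S = S"
    using s(3) r(3) by (auto simp: compose_eq image_def set_eq_iff) (metis imageE r(3) s(3))+
  ultimately show ?thesis by (simp add: gal_eq[OF S])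
qed

lemma subgroup_gal:
  assumes S: "complex_subfield S"
  shows "subgroup (gal S \<rat>) (BijGroup S)"
proof (rule group.subgroupI[OF group_BijGroup])
  note cl = complex_subfieldD[OF S]
  show "gal S \<rat> \<subseteq> carrier (BijGroup S)" using galD(5)[OF S] by (auto simp: BijGroup_def)
  have "complex_hom S (\<lambda>x\<in>S. x)" unfolding complex_hom_def using cl(1,5,6) by simp
  hence "(\<lambda>x\<in>S. x) \<in> gal S \<rat>" by (simp add: gal_eq[OF S])
  thus "gal S \<rat> \<noteq> {}" by blast
  fix \<sigma> \<rho> assume s: "\<sigma> \<in> gal S \<rat>" and r: "\<rho> \<in> gal S \<rat>"
  note sD = galD[OF S s]
  show "\<sigma> \<otimes>\<^bsub>BijGroup S\<^esub> \<rho> \<in> gal S \<rat>"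
    using compose_in_gal[OF S s r] sD(5) galD(5)[OF S r] by (simp add: BijGroup_def)
  have inj: "inj_on \<sigma> S" using sD(5) by (simp add: Bij_def bij_betw_def)
  define \<theta> where "\<theta> = (\<lambda>x\<in>S. inv_into S \<sigma> x)"
  have th: "\<theta> x \<in> S" "\<sigma> (\<theta> x) = x" if "x \<in> S" for x
    using that sD(3) inv_into_into[of x \<sigma> S] f_inv_into_f[of x \<sigma> S] by (simp_all add: \<theta>_def)
  have ths: "\<theta> (\<sigma> x) = x" if "x \<in> S" for x using that inj sD(4) by (simp add: \<theta>_def)
  note h = complex_homD[OF S sD(2)]
  have "complex_hom S \<theta>"
    unfolding complex_hom_def
  proof (intro conjI ballI)
    show "\<theta> 1 = 1" using ths[of 1] h(1) cl(1) by simp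
    fix x y assume xy: "x \<in> S" "y \<in> S"
    have "\<theta> (\<sigma> (\<theta> x + \<theta> y)) = \<theta> x + \<theta> y" "\<theta> (\<sigma> (\<theta> x * \<theta> y)) = \<theta> x * \<theta> y"
      using ths th xy cl(5,6) by simp_all
    thus "\<theta> (x + y) = \<theta> x + \<theta> y" "\<theta> (x * y) = \<theta> x * \<theta> y" using h(3,4) th xy by simp_all
  qed
  moreover have "\<theta> ` S = S"
  proof
    show "\<theta> ` S \<subseteq> S" using th by blast
    show "S \<subseteq> \<theta> ` S" using ths sD(4) by (metis image_eqI subsetI)
  qed
  ultimately have "\<theta> \<in> gal S \<rat>" by (simp add: gal_eq[OF S] \<theta>_def)
  thus "inv\<^bsub>BijGroup S\<^esub> \<sigma> \<in> gal S \<rat>" using inv_BijGroup[OF sD(5)] by (simp add: \<theta>_def)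
qed

lemma group_Gal: "complex_subfield S \<Longrightarrow> group (Gal S \<rat>)"
  unfolding Gal_def by (rule subgroup.subgroup_is_group[OF subgroup_gal group_BijGroup])

lemma Gal_mult:
  assumes "complex_subfield S" "\<sigma> \<in> gal S \<rat>" "\<rho> \<in> gal S \<rat>"
  shows "\<sigma> \<otimes>\<^bsub>Gal S \<rat>\<^esub> \<rho> = compose S \<sigma> \<rho>"
  using galD(5)[OF assms(1,2)] galD(5)[OF assms(1,3)] by (simp add: Gal_def BijGroup_def)

lemma Gal_one: "\<one>\<^bsub>Gal S \<rat>\<^esub> = (\<lambda>x\<in>S. x)"
  by (simp add: Gal_def BijGroup_def)

lemma group_actionI:
  assumes G: "group G"
    and ext: "\<And>g. g \<in> carrier G \<Longrightarrow> \<phi> g \<in> extensional E"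
    and into: "\<And>g x. g \<in> carrier G \<Longrightarrow> x \<in> E \<Longrightarrow> \<phi> g x \<in> E"
    and one: "\<And>x. x \<in> E \<Longrightarrow> \<phi> \<one>\<^bsub>G\<^esub> x = x"
    and mult: "\<And>g h x. g \<in> carrier G \<Longrightarrow> h \<in> carrier G \<Longrightarrow> x \<in> E \<Longrightarrow> \<phi> (g \<otimes>\<^bsub>G\<^esub> h) x = \<phi> g (\<phi> h x)"
  shows "group_action G E \<phi>"
proof -
  interpret group G by (rule G)
  have Bij: "\<phi> g \<in> Bij E" if g: "g \<in> carrier G" for g
  proof -
    have "bij_betw (\<phi> g) E E"
    proof (rule bij_betw_byWitness[where f' = "\<phi> (inv\<^bsub>G\<^esub> g)"])
      show "\<forall>x\<in>E. \<phi> (inv\<^bsub>G\<^esub> g) (\<phi> g x) = x"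
        using mult[OF inv_closed[OF g] g] one g by simp
      show "\<forall>x\<in>E. \<phi> g (\<phi> (inv\<^bsub>G\<^esub> g) x) = x"
        using mult[OF g inv_closed[OF g]] one g by simp
    qed (use into g in auto)
    thus ?thesis using ext[OF g] by (simp add: Bij_def)
  qed
  have "\<phi> \<in> hom G (BijGroup E)"
  proof (rule homI)
    fix g h assume gh: "g \<in> carrier G" "h \<in> carrier G"
    have "\<phi> (g \<otimes>\<^bsub>G\<^esub> h) = compose E (\<phi> g) (\<phi> h)"
      by (rule extensionalityI[of _ E]) (use gh ext mult in \<open>auto simp: compose_eq\<close>)
    thus "\<phi> (g \<otimes>\<^bsub>G\<^esub> h) = \<phi> g \<otimes>\<^bsub>BijGroup E\<^esub> \<phi> h" using Bij gh by (simp add: BijGroup_def)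
  qed (use Bij in \<open>simp add: BijGroup_def\<close>)
  thus ?thesis
    by (intro group_action.intro group_hom.intro group_hom_axioms.intro G group_BijGroup)
qed

context cyclotomic_prime
begin

lemmas galK = galD[OF complex_subfield_Qcyc_prime_to]
lemmas galL = galD[OF complex_subfield_Qcyc]

text \<open>At each order prime to \<open>p\<close> both automorphisms are power maps on the roots
  of unity, and exponents multiply commutatively.\<close>

lemma gal_K_commute:
  assumes "\<sigma> \<in> gal K \<rat>" "\<rho> \<in> gal K \<rat>" "x \<in> K"
  shows "\<sigma> (\<rho> x) = \<rho> (\<sigma> x)"
proof -
  note s = galK[OF assms(1)] and r = galK[OF assms(2)]
  note S = complex_subfield_Qcyc_prime_to[of p]
  note hs = complex_homD[OF S s(2)] and hr = complex_homD[OF S r(2)]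
  have "complex_hom K (\<lambda>x. \<sigma> (\<rho> x))" "complex_hom K (\<lambda>x. \<rho> (\<sigma> x))"
    unfolding complex_hom_def using s(4) r(4) by (simp_all add: hs hr)
  thus ?thesis
  proof (rule hom_eq_K[OF _ _ _ assms(3)])
    fix z assume z: "z \<in> roots_prime_to p"
    then obtain n where n: "n > 0" "coprime n p" "z ^ n = 1" by (auto simp: roots_prime_to_def)
    have zK: "z \<in> K" by (rule root_prime_to_in_K[OF z])
    have zeta: "zeta n \<in> K" by (rule root_of_unity_in_Qcyc_prime_to[OF zeta_power_order[OF n(1)] n(1,2)])
    obtain a where a: "\<And>z. z ^ n = 1 \<Longrightarrow> \<sigma> z = z ^ a"
      using root_of_unity_hom_exponent[OF S s(2) n(1) zeta] by blast
    obtain b where b: "\<And>z. z ^ n = 1 \<Longrightarrow> \<rho> z = z ^ b"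
      using root_of_unity_hom_exponent[OF S r(2) n(1) zeta] by blast
    show "\<sigma> (\<rho> z) = \<rho> (\<sigma> z)"
      using a[OF n(3)] b[OF n(3)] hs(9)[OF zK, of b] hr(9)[OF zK, of a]
      by (simp add: mult.commute flip: power_mult)
  qed
qed

lemma Fr_in_gal: "Fr p \<in> gal K \<rat>"
proof -
  have h: "complex_hom K (restrict tau K)"
    using complex_hom_subset[OF tau_hom Qcyc_prime_to_subset] Qcyc_prime_to_closed(1,5,6)
    by (simp add: complex_hom_def)
  thus ?thesis using complex_hom_image_Qcyc_prime_to[OF h]
    by (simp add: gal_eq[OF complex_subfield_Qcyc_prime_to] Fr_eq)
qed

lemma gal_K_F:
  assumes "\<gamma> \<in> gal K \<rat>" "x \<in> F"
  shows "\<gamma> x \<in> F"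
proof -
  have x: "x \<in> K" "Fr p x = x" using assms(2) by (auto simp: Fr_fixed_def)
  have "Fr p (\<gamma> x) = \<gamma> x" using gal_K_commute[OF Fr_in_gal assms(1) x(1)] x(2) by simp
  thus ?thesis using galK(4)[OF assms(1) x(1)] by (simp add: Fr_fixed_def)
qed

text \<open>Fixing a given \<open>x\<close> is a closed condition for pointwise convergence: the
  automorphisms that agree with \<open>\<gamma>\<close> at \<open>x\<close> form an open
  neighbourhood of \<open>\<gamma>\<close>, which meets the subgroup generated by the Frobenius, and
  every member of that subgroup fixes \<open>x\<close>.\<close>

lemma Fr_closed_subgroupD:
  assumes "\<gamma> \<in> Fr_closed_subgroup p"
  shows "\<gamma> \<in> gal K \<rat>" "x \<in> F \<Longrightarrow> \<gamma> x = x"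
proof -
  let ?X = "krull_topology K \<rat>"
  have cl: "\<gamma> \<in> ?X closure_of generate (G_p p) {Fr p}" using assms by (simp add: Fr_closed_subgroup_def)
  have top: "\<gamma> \<in> topspace ?X" using cl by (simp add: in_closure_of)
  thus gal: "\<gamma> \<in> gal K \<rat>" by (simp add: krull_topology_def)
  assume x: "x \<in> F"
  interpret G: group "G_p p" by (rule group_Gal[OF complex_subfield_Qcyc_prime_to])
  have fixed: "g \<in> gal K \<rat> \<and> g x = x" if "g \<in> generate (G_p p) {Fr p}" for g
    using that
  proof (induction rule: generate.induct)
    case one
    have "\<one>\<^bsub>G_p p\<^esub> \<in> gal K \<rat>" using G.one_closed by simp
    moreover have "\<one>\<^bsub>G_p p\<^esub> x = x" using F_subset_K[OF x] by (simp add: Gal_one)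
    ultimately show ?case ..
  next
    case (incl h)
    thus ?case using Fr_in_gal x by (simp add: Fr_fixed_def)
  next
    case (inv h)
    hence h: "h \<in> gal K \<rat>" "h x = x" using Fr_in_gal x by (simp_all add: Fr_fixed_def)
    have i: "inv\<^bsub>G_p p\<^esub> h \<in> gal K \<rat>" using G.inv_closed h(1) by simp
    have "inv\<^bsub>G_p p\<^esub> h \<otimes>\<^bsub>G_p p\<^esub> h = \<one>\<^bsub>G_p p\<^esub>" using h(1) by simp
    hence "compose K (inv\<^bsub>G_p p\<^esub> h) h x = x"
      using Gal_mult[OF complex_subfield_Qcyc_prime_to i h(1)] F_subset_K[OF x] by (simp add: Gal_one)
    thus ?case using i h(2) F_subset_K[OF x] by (simp add: compose_eq)
  next
    case (eng h1 h2)
    thus ?case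
      using G.m_closed[of h1 h2] F_subset_K[OF x] Gal_mult[OF complex_subfield_Qcyc_prime_to, of h1 p h2]
      by (simp add: compose_eq)
  qed
  define T where "T = {f \<in> topspace ?X. f x \<in> {\<gamma> x}}"
  have "continuous_map ?X (discrete_topology K) (\<lambda>f. f x)"
    unfolding krull_topology_def
    using continuous_map_product_projection[OF F_subset_K[OF x], of "\<lambda>_. discrete_topology K"]
    by (rule continuous_map_from_subtopology)
  moreover have "openin (discrete_topology K) {\<gamma> x}"
    unfolding openin_discrete_topology using galK(4)[OF gal F_subset_K[OF x]] by blast
  ultimately have "openin ?X T" unfolding T_def by (rule openin_continuous_map_preimage)
  moreover have "\<gamma> \<in> T" using top by (simp add: T_def)
  ultimately obtain g where g: "g \<in> generate (G_p p) {Fr p}" "g \<in> T" using cl by (auto simp: in_closure_of)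
  have "\<gamma> x = g x" using g(2) unfolding T_def by simp
  thus "\<gamma> x = x" using fixed[OF g(1)] by simp
qed

section \<open>The map from valuations to homomorphisms\<close>

abbreviation "cQ \<equiv> cauchy_seqs (UNIV :: rat set) (padic_val p)"
abbreviation "nQ \<equiv> null_seqs (UNIV :: rat set) (padic_val p)"
abbreviation "classQ \<equiv> seq_class (UNIV :: rat set) (padic_val p)"

sublocale Q: valued_field "UNIV :: rat set" "padic_val p"
  using real_valuation_padic[OF prime_p] by unfold_locales auto

lemma Val_pD:
  assumes "v \<in> Val_p p"
  shows "padic_ext L v" "v \<in> extensional L" "valued_field L v" "v (of_rat q) = padic_val p q"
  using assms padic_ext_valued_field[OF complex_subfield_Qcyc] by (auto simp: Val_p_eq padic_ext_def)

lemma of_rat_seq: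
  assumes v: "v \<in> Val_p p"
  shows "s \<in> cQ \<Longrightarrow> (\<lambda>n. of_rat (s n)) \<in> cauchy_seqs L v"
    "(\<lambda>n. of_rat (s n)) \<in> null_seqs L v \<longleftrightarrow> s \<in> nQ"
proof -
  interpret V: valued_field L v by (rule Val_pD(3)[OF v])
  have "v (of_rat (s m) - of_rat (s n)) = padic_val p (s m - s n)" for m n
    using Val_pD(4)[OF v, of "s m - s n"] by (simp add: of_rat_diff)
  thus "s \<in> cQ \<Longrightarrow> (\<lambda>n. of_rat (s n)) \<in> cauchy_seqs L v"
    using Qcyc_closed(14) by (auto simp: cauchy_seqs_def)
  show "(\<lambda>n. of_rat (s n)) \<in> null_seqs L v \<longleftrightarrow> s \<in> nQ"
    unfolding V.null_seqs_iff Q.null_seqs_iff using Qcyc_closed(14) Val_pD(4)[OF v] by simp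
qed

text \<open>Equivalent rational sequences remain equivalent in the completion of \<open>L\<close>,
  so the image set in the definition of \<open>Qp_to_completion\<close> is a singleton and
  \<open>the_elem\<close> is meaningful.\<close>

lemma Qp_to_completion_class:
  assumes v: "v \<in> Val_p p" and s: "s \<in> cQ"
  shows "Qp_to_completion v (classQ s) = seq_class L v (\<lambda>n. of_rat (s n))"
proof -
  interpret V: valued_field L v by (rule Val_pD(3)[OF v])
  have "seq_class L v (\<lambda>n. of_rat (t n)) = seq_class L v (\<lambda>n. of_rat (s n))" if t: "t \<in> classQ s" for t
  proof -
    have ts: "(\<lambda>n. t n - s n) \<in> nQ" using t Q.seq_class_eq_set[OF s] by simp
    have "t = (\<lambda>n. (t n - s n) + s n)" by simp
    hence tc: "t \<in> cQ" using Q.cauchy_add[OF Q.null_cauchy[OF ts] s] by simp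
    have "(\<lambda>n. of_rat (t n) - of_rat (s n)) \<in> null_seqs L v"
      using of_rat_seq(2)[OF v, of "\<lambda>n. t n - s n"] ts by (simp add: of_rat_diff)
    thus ?thesis using V.seq_class_eq_iff of_rat_seq(1)[OF v] tc s by blast
  qed
  moreover have "s \<in> classQ s" using Q.seq_class_eq_set[OF s] Q.null_zero by simp
  ultimately have "(\<lambda>s. seq_class L v (\<lambda>n. of_rat (s n))) ` classQ s = {seq_class L v (\<lambda>n. of_rat (s n))}"
    by blast
  thus ?thesis by (simp add: Qp_to_completion_def)
qed

text \<open>A concrete witness for the value of \<open>\<beta>_map p v\<close> at \<open>x\<close>:
  a p-adic Cauchy sequence of rationals that converges to \<open>x\<close> at \<open>v\<close>.
  Statements about the definite description are reduced to such sequences.\<close>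

definition approx :: "(complex \<Rightarrow> ereal) \<Rightarrow> complex \<Rightarrow> (nat \<Rightarrow> rat) \<Rightarrow> bool" where
  "approx v x s \<longleftrightarrow> s \<in> cQ \<and> (\<lambda>n. x - of_rat (s n)) \<in> null_seqs L v"

lemma approx_exists:
  assumes v: "v \<in> Val_p p" and x: "x \<in> F"
  obtains s where "approx v x s"
proof -
  interpret V: valued_field L v by (rule Val_pD(3)[OF v])
  have xL: "x \<in> L" by (rule F_subset_L[OF x])
  obtain s where s: "\<And>n. ereal (real n) \<le> v (x - of_rat (s n))"
    using Rats_dense_F[OF Val_pD(1)[OF v] x] by metis
  have rL: "of_rat r \<in> L" for r by (rule Qcyc_closed(14))
  have "\<exists>N. \<forall>n\<ge>N. ereal C < v (x - of_rat (s n))" for C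
  proof -
    obtain N :: nat where N: "C < real N" using reals_Archimedean2 by blast
    have "ereal C < v (x - of_rat (s n))" if "n \<ge> N" for n
    proof -
      have "ereal C < ereal (real n)" using N that by simp
      thus ?thesis using s[of n] by (rule less_le_trans)
    qed
    thus ?thesis by blast
  qed
  hence null: "(\<lambda>n. x - of_rat (s n)) \<in> null_seqs L v"
    unfolding V.null_seqs_iff using xL rL Qcyc_closed(7) by blast
  have "(\<lambda>n. x - (x - of_rat (s n))) \<in> cauchy_seqs L v"
    using V.cauchy_add[OF V.const_cauchy[OF xL] V.cauchy_minus[OF V.null_cauchy[OF null]]] by simp
  moreover have "v (of_rat (s m) - of_rat (s n)) = padic_val p (s m - s n)" for m n
    using Val_pD(4)[OF v, of "s m - s n"] by (simp add: of_rat_diff)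
  ultimately have "s \<in> cQ" by (auto simp: cauchy_seqs_def)
  thus ?thesis using that null by (simp add: approx_def)
qed

lemma approx_class_iff:
  assumes v: "v \<in> Val_p p" and x: "x \<in> L" and s: "s \<in> cQ"
  shows "Qp_to_completion v (classQ s) = Qcyc_to_completion v x \<longleftrightarrow> approx v x s"
proof -
  interpret V: valued_field L v by (rule Val_pD(3)[OF v])
  have "Qp_to_completion v (classQ s) = Qcyc_to_completion v x \<longleftrightarrow>
      seq_class L v (\<lambda>_. x) = seq_class L v (\<lambda>n. of_rat (s n))"
    unfolding Qp_to_completion_class[OF v s] Qcyc_to_completion_def by auto
  also have "\<dots> \<longleftrightarrow> (\<lambda>n. x - of_rat (s n)) \<in> null_seqs L v"
    by (rule V.seq_class_eq_iff[OF V.const_cauchy[OF x] of_rat_seq(1)[OF v s]])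
  finally show ?thesis using s by (simp add: approx_def)
qed

lemma approx_unique:
  assumes v: "v \<in> Val_p p" and "approx v x s" "approx v x t"
  shows "classQ s = classQ t"
proof -
  interpret V: valued_field L v by (rule Val_pD(3)[OF v])
  have "(\<lambda>n. (x - of_rat (t n)) - (x - of_rat (s n))) \<in> null_seqs L v"
    by (rule V.null_diff) (use assms(2,3) in \<open>simp_all add: approx_def\<close>)
  hence "(\<lambda>n. of_rat (s n - t n)) \<in> null_seqs L v" by (simp add: of_rat_diff)
  hence "(\<lambda>n. s n - t n) \<in> nQ" using of_rat_seq(2)[OF v, of "\<lambda>n. s n - t n"] by simp
  thus ?thesis using Q.seq_class_eq_iff assms(2,3) by (simp add: approx_def)
qed

lemma approx_class_cong:
  assumes v: "v \<in> Val_p p" and "approx v x s" "t \<in> cQ" "classQ s = classQ t"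
  shows "approx v x t"
proof -
  interpret V: valued_field L v by (rule Val_pD(3)[OF v])
  have "(\<lambda>n. s n - t n) \<in> nQ" using Q.seq_class_eq_iff[of s t] assms(2-4) by (simp add: approx_def)
  hence "(\<lambda>n. of_rat (s n - t n)) \<in> null_seqs L v" using of_rat_seq(2)[OF v, of "\<lambda>n. s n - t n"] by simp
  hence "(\<lambda>n. (x - of_rat (s n)) + of_rat (s n - t n)) \<in> null_seqs L v"
    using assms(2) unfolding approx_def by (intro V.null_add) blast+
  thus ?thesis using assms(3) by (simp add: approx_def of_rat_diff)
qed

lemma Qp_carrierE:
  assumes "c \<in> carrier (Qp p)"
  obtains s where "s \<in> cQ" "c = classQ s"
  using assms Q.completion_carrierE unfolding Qp_def by blast

lemma beta_eq:
  assumes v: "v \<in> Val_p p" and x: "x \<in> F" and a: "approx v x s"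
  shows "\<beta>_map p v x = classQ s"
proof -
  have s: "s \<in> cQ" using a by (simp add: approx_def)
  have xL: "x \<in> L" by (rule F_subset_L[OF x])
  have "(THE y. y \<in> carrier (Qp p) \<and> Qp_to_completion v y = Qcyc_to_completion v x) = classQ s"
  proof (rule the_equality)
    show "classQ s \<in> carrier (Qp p) \<and> Qp_to_completion v (classQ s) = Qcyc_to_completion v x"
      using approx_class_iff[OF v xL s] a Q.completion_simps(1)[OF s] by (simp add: Qp_def)
    fix y assume y: "y \<in> carrier (Qp p) \<and> Qp_to_completion v y = Qcyc_to_completion v x"
    then obtain t where t: "t \<in> cQ" "y = classQ t" using Qp_carrierE by blast
    hence "approx v x t" using approx_class_iff[OF v xL t(1)] y by simp
    thus "y = classQ s" using approx_unique[OF v _ a] t(2) by simp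
  qed
  thus ?thesis using x by (simp add: \<beta>_map_def)
qed

lemma beta_spec:
  assumes v: "v \<in> Val_p p" and x: "x \<in> F"
  shows "\<beta>_map p v x \<in> carrier (Qp p) \<and> Qp_to_completion v (\<beta>_map p v x) = Qcyc_to_completion v x"
proof -
  obtain s where s: "approx v x s" using approx_exists[OF v x] by blast
  hence "s \<in> cQ" by (simp add: approx_def)
  thus ?thesis
    using beta_eq[OF v x s] approx_class_iff[OF v F_subset_L[OF x]] Q.completion_simps(1) s
    by (simp add: Qp_def)
qed

lemma beta_in_Hom:
  assumes v: "v \<in> Val_p p"
  shows "\<beta>_map p v \<in> Hom_Qp p"
proof -
  interpret V: valued_field L v by (rule Val_pD(3)[OF v])
  have "\<beta>_map p v \<in> Ring.ring_hom (subring_of F) (Qp p)"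
  proof (rule ring_hom_memI)
    fix x assume "x \<in> carrier (subring_of F)"
    thus "\<beta>_map p v x \<in> carrier (Qp p)" using beta_spec[OF v] by simp
  next
    fix x y assume "x \<in> carrier (subring_of F)" "y \<in> carrier (subring_of F)"
    hence x: "x \<in> F" and y: "y \<in> F" by simp_all
    obtain s where s: "approx v x s" using approx_exists[OF v x] by blast
    obtain t where t: "approx v y t" using approx_exists[OF v y] by blast
    have st: "s \<in> cQ" "t \<in> cQ" "(\<lambda>n. x - of_rat (s n)) \<in> null_seqs L v" "(\<lambda>n. y - of_rat (t n)) \<in> null_seqs L v"
      using s t by (simp_all add: approx_def)
    have "(\<lambda>n. (x - of_rat (s n)) + (y - of_rat (t n))) \<in> null_seqs L v"
      by (rule V.null_add[OF st(3,4)])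
    hence "approx v (x + y) (\<lambda>n. s n + t n)"
      using Q.cauchy_add[OF st(1,2)] by (simp add: approx_def of_rat_add algebra_simps)
    hence "\<beta>_map p v (x + y) = classQ (\<lambda>n. s n + t n)" using beta_eq[OF v F_closed(5)[OF x y]] by blast
    thus "\<beta>_map p v (x \<oplus>\<^bsub>subring_of F\<^esub> y) = \<beta>_map p v x \<oplus>\<^bsub>Qp p\<^esub> \<beta>_map p v y"
      using beta_eq[OF v x s] beta_eq[OF v y t] Q.completion_simps(2)[OF st(1,2)] by (simp add: Qp_def)
    \<comment> \<open>The expression telescopes to the difference between \<open>x * y\<close> and
      the product of the two approximations.\<close>
    have "(\<lambda>n. (x - of_rat (s n)) * y + (y - of_rat (t n)) * of_rat (s n)) \<in> null_seqs L v"
      by (intro V.null_add V.null_mult st V.const_cauchy F_subset_L y of_rat_seq(1)[OF v])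
    hence "approx v (x * y) (\<lambda>n. s n * t n)"
      using Q.cauchy_mult[OF st(1,2)] by (simp add: approx_def of_rat_mult algebra_simps)
    hence "\<beta>_map p v (x * y) = classQ (\<lambda>n. s n * t n)" using beta_eq[OF v F_closed(6)[OF x y]] by blast
    thus "\<beta>_map p v (x \<otimes>\<^bsub>subring_of F\<^esub> y) = \<beta>_map p v x \<otimes>\<^bsub>Qp p\<^esub> \<beta>_map p v y"
      using beta_eq[OF v x s] beta_eq[OF v y t] Q.completion_simps(3)[OF st(1,2)] by (simp add: Qp_def)
  next
    have "approx v 1 (\<lambda>_. 1)" using Q.const_cauchy[of 1] V.null_zero by (simp add: approx_def)
    thus "\<beta>_map p v \<one>\<^bsub>subring_of F\<^esub> = \<one>\<^bsub>Qp p\<^esub>"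
      using beta_eq[OF v F_closed(1)] Q.completion_simps(4) by (simp add: Qp_def)
  qed
  thus ?thesis by (simp add: Hom_Qp_def \<beta>_map_def)
qed

lemma approx_eventually:
  assumes v: "v \<in> Val_p p" and x: "x \<in> L" "x \<noteq> 0" and s: "approx v x s"
  shows "\<forall>\<^sub>F n in sequentially. padic_val p (s n) = v x"
proof -
  interpret V: valued_field L v by (rule Val_pD(3)[OF v])
  obtain r where r: "v x = ereal r" using V.v_real x by blast
  obtain N where N: "\<forall>n\<ge>N. ereal r < v (x - of_rat (s n))"
    using s unfolding approx_def V.null_seqs_iff by blast
  have "padic_val p (s n) = v x" if "n \<ge> N" for n
  proof -
    have rL: "of_rat (s n) \<in> L" by (rule Qcyc_closed(14))
    have "ereal r < v (x - of_rat (s n))" using N that by blast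
    hence "v x < v (of_rat (s n) - x)" using r V.v_minus_commute[OF x(1) rL] by simp
    from V.v_eq_if_close[OF x(1) rL this] show ?thesis using Val_pD(4)[OF v] by simp
  qed
  thus ?thesis unfolding eventually_sequentially by blast
qed

text \<open>If the images agree, one rational sequence approximates \<open>x\<close> for both
  valuations, and its p-adic values eventually equal both \<open>v x\<close> and
  \<open>v' x\<close>. Agreement on \<open>F\<close> then propagates to \<open>L\<close> by
  uniqueness of the extension.\<close>

lemma beta_inj: "inj_on (\<beta>_map p) (Val_p p)"
proof (rule inj_onI)
  fix v v' assume v: "v \<in> Val_p p" and v': "v' \<in> Val_p p" and eq: "\<beta>_map p v = \<beta>_map p v'"
  interpret V: valued_field L v by (rule Val_pD(3)[OF v])
  interpret V': valued_field L v' by (rule Val_pD(3)[OF v'])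
  have F: "v x = v' x" if x: "x \<in> F" for x
  proof (cases "x = 0")
    case False
    obtain s where s: "approx v x s" using approx_exists[OF v x] by blast
    obtain t where t: "approx v' x t" using approx_exists[OF v' x] by blast
    have "classQ t = classQ s" using beta_eq[OF v x s] beta_eq[OF v' x t] eq by simp
    hence s': "approx v' x s" using approx_class_cong[OF v' t] s by (simp add: approx_def)
    have "\<forall>\<^sub>F n in sequentially. padic_val p (s n) = v x \<and> padic_val p (s n) = v' x"
      using approx_eventually[OF v F_subset_L[OF x] False s] approx_eventually[OF v' F_subset_L[OF x] False s']
      by (rule eventually_conj)
    then obtain n where "padic_val p (s n) = v x" "padic_val p (s n) = v' x"
      unfolding eventually_sequentially by blast
    thus ?thesis by simp
  qed simp
  have "v x = v' x" if "x \<in> L" for x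
    by (rule padic_ext_unique[OF Val_pD(1)[OF v] Val_pD(1)[OF v'] F that])
  thus "v = v'" by (rule extensionalityI[OF Val_pD(2)[OF v] Val_pD(2)[OF v']])
qed

section \<open>Surjectivity: the valuation attached to a homomorphism\<close>

context
  fixes b :: "complex \<Rightarrow> (nat \<Rightarrow> rat) set"
  assumes b: "b \<in> Hom_Qp p"
begin

lemma b_hom:
  shows "x \<in> F \<Longrightarrow> b x \<in> carrier (Qp p)"
    "x \<in> F \<Longrightarrow> y \<in> F \<Longrightarrow> b (x + y) = b x \<oplus>\<^bsub>Qp p\<^esub> b y"
    "x \<in> F \<Longrightarrow> y \<in> F \<Longrightarrow> b (x * y) = b x \<otimes>\<^bsub>Qp p\<^esub> b y"
    "b 1 = classQ (\<lambda>_. 1)"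
  using b Q.completion_simps(4) by (auto simp: Hom_Qp_def Ring.ring_hom_def Qp_def)

lemma b_class:
  assumes "x \<in> F"
  obtains s where "s \<in> cQ" "b x = classQ s"
  using Qp_carrierE[OF b_hom(1)[OF assms]] by blast

lemma b_of_nat: "b (of_nat n) = classQ (\<lambda>_. of_nat n)"
proof (induction n)
  case 0
  obtain s where s: "s \<in> cQ" "b 0 = classQ s" using b_class[OF F_closed(2)] by blast
  have "b (0 + 0) = classQ (\<lambda>n. s n + s n)"
    using b_hom(2)[OF F_closed(2) F_closed(2)] s Q.completion_simps(2)[OF s(1) s(1)] by (simp add: Qp_def)
  hence "classQ (\<lambda>n. s n + s n) = classQ s" using s by simp
  hence "s \<in> nQ" using Q.seq_class_eq_iff[OF Q.cauchy_add[OF s(1) s(1)] s(1)] by simp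
  hence "classQ s = classQ (\<lambda>_. 0)" using Q.seq_class_eq_iff[OF s(1) Q.const_cauchy[of 0]] by simp
  thus ?case using s by simp
next
  case (Suc n)
  have "b (1 + of_nat n) = classQ (\<lambda>_. 1 + of_nat n)"
    using b_hom(2)[OF F_closed(1) F_closed(12)] Suc b_hom(4)
      Q.completion_simps(2)[OF Q.const_cauchy[of 1] Q.const_cauchy[of "of_nat n"]] by (simp add: Qp_def)
  thus ?case by simp
qed

text \<open>The values on natural numbers are known. An equation between natural numbers with
  \<open>q\<close> as its unknown is transported by \<open>b\<close> and then divided by the
  denominator at the level of sequences.\<close>

lemma b_of_rat: "b (of_rat q) = classQ (\<lambda>_. q)"
proof -
  obtain a d where ad: "quotient_of q = (a, d)" by (cases "quotient_of q")
  have d: "d > 0" using quotient_of_denom_pos[OF ad] .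
  have q0: "q * of_int d = of_int a" using quotient_of_div[OF ad] d by simp
  have nd: "(of_int d :: rat) = of_nat (nat d)" using d by simp
  \<comment> \<open>The numerator is split into its positive and negative parts, so that only sums
    and products of natural numbers occur in the equation for \<open>q\<close>.\<close>
  have na: "(of_int a :: rat) = of_nat (nat a) - of_nat (nat (- a))" by (cases "a \<ge> 0"; simp)
  have q: "q * of_nat (nat d) + of_nat (nat (- a)) = of_nat (nat a)"
    using q0 unfolding nd na by (metis diff_add_cancel)
  have "of_rat (q * of_nat (nat d) + of_nat (nat (- a))) = (of_rat (of_nat (nat a)) :: complex)" using q by simp
  hence q': "(of_rat q :: complex) * of_nat (nat d) + of_nat (nat (- a)) = of_nat (nat a)"
    by (simp only: of_rat_add of_rat_mult of_rat_of_nat_eq)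
  have qF: "of_rat q \<in> F" by (rule F_closed(14))
  obtain s where s: "s \<in> cQ" "b (of_rat q) = classQ s" using b_class[OF qF] by blast
  have c: "(\<lambda>_. of_nat m) \<in> cQ" for m by (rule Q.const_cauchy) simp
  have "b (of_rat q * of_nat (nat d) + of_nat (nat (- a)))
      = classQ (\<lambda>n. s n * of_nat (nat d) + of_nat (nat (- a)))"
    using b_hom(2)[OF F_closed(6)[OF qF F_closed(12)] F_closed(12)] b_hom(3)[OF qF F_closed(12)] b_of_nat s(2)
      Q.completion_simps(3)[OF s(1) c] Q.completion_simps(2)[OF Q.cauchy_mult[OF s(1) c] c]
    by (simp add: Qp_def)
  hence "classQ (\<lambda>n. s n * of_nat (nat d) + of_nat (nat (- a))) = classQ (\<lambda>_. of_nat (nat a))"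
    unfolding q' b_of_nat by simp
  hence "(\<lambda>n. s n * of_nat (nat d) + of_nat (nat (- a)) - of_nat (nat a)) \<in> nQ"
    using Q.seq_class_eq_iff[OF Q.cauchy_add[OF Q.cauchy_mult[OF s(1) c] c] c] by simp
  hence "(\<lambda>n. (s n * of_nat (nat d) + of_nat (nat (- a)) - of_nat (nat a)) * inverse (of_nat (nat d))) \<in> nQ"
    by (rule Q.null_mult[OF _ Q.const_cauchy]) simp
  moreover have "(s n * of_nat (nat d) + of_nat (nat (- a)) - of_nat (nat a)) * inverse (of_nat (nat d)) = s n - q" for n
  proof -
    have "s n * of_nat (nat d) + of_nat (nat (- a)) - of_nat (nat a) = (s n - q) * of_nat (nat d)"
      unfolding q[symmetric] by (simp add: left_diff_distrib)
    moreover have "(of_nat (nat d) :: rat) \<noteq> 0" using d by simp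
    ultimately show ?thesis by simp
  qed
  ultimately have "(\<lambda>n. s n - q) \<in> nQ" by simp
  thus ?thesis using Q.seq_class_eq_iff[OF s(1) Q.const_cauchy[of q]] s(2) by simp
qed

lemma padic_ext_Hom: "padic_ext F (\<lambda>x. Q.class_val (b x))"
proof -
  have mult: "Q.class_val (b (x * y)) = Q.class_val (b x) + Q.class_val (b y)" if "x \<in> F" "y \<in> F" for x y
    using b_hom(1,3) that Q.class_val_mult[of "b x" "b y"] by (simp add: Qp_def)
  have rat: "Q.class_val (b (of_rat q)) = padic_val p q" for q
    unfolding b_of_rat by (rule Q.class_val_const) simp
  have "Q.class_val (b x) = \<infinity> \<longleftrightarrow> x = 0" if x: "x \<in> F" for x
  proof
    assume inf: "Q.class_val (b x) = \<infinity>"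
    show "x = 0"
    proof (rule ccontr)
      assume "x \<noteq> 0"
      \<comment> \<open>Injectivity of \<open>b\<close> in valuation form: the product of
        \<open>x\<close> and its inverse is 1, whose value is finite.\<close>
      hence "Q.class_val (b 1) = \<infinity>" using mult[OF x F_closed(4)[OF x]] inf by simp
      thus False using rat[of 1] Q.v_1 by simp
    qed
  qed (use rat[of 0] in simp)
  moreover have "min (Q.class_val (b x)) (Q.class_val (b y)) \<le> Q.class_val (b (x + y))" if "x \<in> F" "y \<in> F" for x y
    using b_hom(1,2) that Q.class_val_add[of "b x" "b y"] by (simp add: Qp_def)
  moreover have "Q.class_val (b x) \<noteq> - \<infinity>" if "x \<in> F" for x
    using b_hom(1)[OF that] Q.class_val_not_MInf by (simp add: Qp_def)
  ultimately have "real_valuation F (\<lambda>x. Q.class_val (b x))"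
    unfolding real_valuation_def using mult by blast
  thus ?thesis unfolding padic_ext_def using rat by blast
qed

text \<open>Let \<open>v\<close> extend the valuation pulled back along \<open>b\<close>, let
  \<open>t\<close> represent \<open>b x\<close> and let \<open>s\<close> approximate
  \<open>x\<close> at \<open>v\<close>. Translating by rationals turns closeness of
  \<open>s n\<close> to \<open>x\<close> at \<open>v\<close> into p-adic closeness of
  \<open>s n\<close> to the terms of \<open>t\<close>, so \<open>s\<close> and \<open>t\<close>
  define the same class.\<close>

lemma b_in_image: "b \<in> \<beta>_map p ` Val_p p"
proof -
  obtain v where v: "v \<in> Val_p p" "\<And>x. x \<in> F \<Longrightarrow> v x = Q.class_val (b x)"
    using padic_ext_exists[OF padic_ext_Hom] by blast
  interpret V: valued_field L v by (rule Val_pD(3)[OF v(1)])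
  have "b x = \<beta>_map p v x" if x: "x \<in> F" for x
  proof -
    obtain s where s: "approx v x s" using approx_exists[OF v(1) x] by blast
    have sc: "s \<in> cQ" using s by (simp add: approx_def)
    obtain t where t: "t \<in> cQ" "b x = classQ t" using b_class[OF x] by blast
    \<comment> \<open>The rational \<open>r\<close> stays arbitrary because it is later specialised
      to each term \<open>s n\<close>.\<close>
    have lim: "(\<lambda>m. padic_val p (t m - r)) \<longlonglongrightarrow> v (x - of_rat r)" for r
    proof -
      have rF: "of_rat r \<in> F" "x - of_rat r \<in> F" using F_closed(7,14) x by blast+
      obtain w where w: "w \<in> cQ" "b (x - of_rat r) = classQ w" using b_class[OF rF(2)] by blast
      have rc: "(\<lambda>_. r) \<in> cQ" by (rule Q.const_cauchy) simp
      have "b ((x - of_rat r) + of_rat r) = classQ (\<lambda>n. w n + r)"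
        using b_hom(2)[OF rF(2,1)] w b_of_rat Q.completion_simps(2)[OF w(1) rc] by (simp add: Qp_def)
      hence "classQ (\<lambda>n. w n + r) = classQ t" using t(2) by simp
      hence "(\<lambda>n. w n + r - t n) \<in> nQ" using Q.seq_class_eq_iff[OF Q.cauchy_add[OF w(1) rc] t(1)] by simp
      hence "(\<lambda>n. w n - (t n - r)) \<in> nQ" by (simp add: algebra_simps)
      moreover have tr: "(\<lambda>n. t n - r) \<in> cQ"
        using Q.cauchy_add[OF t(1) Q.const_cauchy[of "- r"]] by simp
      ultimately have "classQ w = classQ (\<lambda>n. t n - r)" using Q.seq_class_eq_iff[OF w(1)] by blast
      thus ?thesis using Q.class_val_tendsto(1)[OF tr] v(2)[OF rF(2)] w(2) by simp
    qed
    have "\<exists>N. \<forall>n\<ge>N. ereal C < padic_val p (t n - s n)" for C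
    proof -
      obtain N where N: "\<forall>n\<ge>N. ereal C < v (x - of_rat (s n))"
        using s unfolding approx_def V.null_seqs_iff by blast
      obtain M where M: "\<forall>m\<ge>M. \<forall>n\<ge>M. ereal C < padic_val p (t m - t n)" using Q.cauchyD[OF t(1)] by blast
      have "ereal C < padic_val p (t n - s n)" if n: "n \<ge> max N M" for n
      proof -
        have "\<forall>\<^sub>F m in sequentially. ereal C < padic_val p (t m - s n)"
          using lim N n by (intro order_tendstoD(1)) auto
        then obtain m where m: "m \<ge> M" "ereal C < padic_val p (t m - s n)"
          unfolding eventually_sequentially by (meson linear order.trans)
        have "ereal C < padic_val p ((t n - t m) + (t m - s n))"
          using M m n by (intro Q.v_add_gt) auto
        thus ?thesis by simp
      qed
      thus ?thesis by blast
    qed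
    hence "(\<lambda>n. t n - s n) \<in> nQ" unfolding Q.null_seqs_iff by simp
    hence "classQ t = classQ s" using Q.seq_class_eq_iff[OF t(1) sc] by simp
    thus ?thesis using t(2) beta_eq[OF v(1) x s] by simp
  qed
  moreover have "b \<in> extensional F" "\<beta>_map p v \<in> extensional F"
    using b by (simp_all add: Hom_Qp_def \<beta>_map_def)
  ultimately have "b = \<beta>_map p v" by (intro extensionalityI[of b F])
  thus ?thesis using v(1) by blast
qed

end

lemma beta_bij: "bij_betw (\<beta>_map p) (Val_p p) (Hom_Qp p)"
  unfolding bij_betw_def using beta_inj beta_in_Hom b_in_image by blast

section \<open>Equivariance\<close>

lemma lift_gal_D:
  assumes "\<gamma> \<in> gal K \<rat>"
  shows "lift_gal p \<gamma> \<in> gal L \<rat>" "complex_hom L (lift_gal p \<gamma>)"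
    "x \<in> L \<Longrightarrow> lift_gal p \<gamma> x \<in> L" "x \<in> K \<Longrightarrow> lift_gal p \<gamma> x = \<gamma> x"
proof -
  have c: "\<gamma> \<in> carrier (G_p p)" using assms by simp
  show "lift_gal p \<gamma> \<in> gal L \<rat>" using lift_gal_carrier[OF c] by simp
  thus "complex_hom L (lift_gal p \<gamma>)" "x \<in> L \<Longrightarrow> lift_gal p \<gamma> x \<in> L" by (rule galL)+
  show "x \<in> K \<Longrightarrow> lift_gal p \<gamma> x = \<gamma> x" by (rule lift_gal_K[OF c])
qed

lemma act_Val_in:
  assumes g: "\<gamma> \<in> gal K \<rat>" and v: "v \<in> Val_p p"
  shows "act_Val p \<gamma> v \<in> Val_p p"
proof -
  interpret V: valued_field L v by (rule Val_pD(3)[OF v])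
  note l = lift_gal_D[OF g]
  note h = complex_homD[OF complex_subfield_Qcyc l(2)]
  have "real_valuation L (compose L v (lift_gal p \<gamma>))"
    unfolding real_valuation_def using l(3) Qcyc_closed(5,6) V.v_add by (simp add: compose_eq h V.v_mult)
  moreover have "compose L v (lift_gal p \<gamma>) (of_rat q) = padic_val p q" for q
    using Qcyc_closed(14) Val_pD(4)[OF v] by (simp add: compose_eq h)
  ultimately show ?thesis using v by (simp add: act_Val_def Val_p_eq padic_ext_def)
qed

lemma act_Val_apply:
  "v \<in> Val_p p \<Longrightarrow> x \<in> L \<Longrightarrow> act_Val p \<gamma> v x = v (lift_gal p \<gamma> x)"
  by (simp add: act_Val_def compose_eq)

text \<open>The lifts appear in reversed order, as precomposition requires for a left action. Both
  sides agree on \<open>K\<close>, where automorphisms commute, and are trivial on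
  \<open>p\<close>-power roots, so uniqueness of the lift identifies them.\<close>

lemma lift_gal_mult:
  assumes g: "\<gamma> \<in> gal K \<rat>" and d: "\<delta> \<in> gal K \<rat>" and x: "x \<in> L"
  shows "lift_gal p (\<gamma> \<otimes>\<^bsub>G_p p\<^esub> \<delta>) x = lift_gal p \<delta> (lift_gal p \<gamma> x)"
proof -
  have eq: "\<gamma> \<otimes>\<^bsub>G_p p\<^esub> \<delta> = compose K \<gamma> \<delta>" by (rule Gal_mult[OF complex_subfield_Qcyc_prime_to g d])
  have gd: "compose K \<gamma> \<delta> \<in> carrier (G_p p)"
    using compose_in_gal[OF complex_subfield_Qcyc_prime_to g d] by simp
  have "compose L (lift_gal p \<delta>) (lift_gal p \<gamma>) = lift_gal p (compose K \<gamma> \<delta>)"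
  proof (rule lift_gal_unique[OF gd])
    show "compose L (lift_gal p \<delta>) (lift_gal p \<gamma>) \<in> carrier (Gal L \<rat>)"
      using compose_in_gal[OF complex_subfield_Qcyc lift_gal_D(1)[OF d] lift_gal_D(1)[OF g]] by simp
    fix y assume y: "y \<in> K"
    show "compose L (lift_gal p \<delta>) (lift_gal p \<gamma>) y = compose K \<gamma> \<delta> y"
      using y K_subset_L[OF y] lift_gal_D(4)[OF g y] lift_gal_D(4)[OF d galK(4)[OF g y]]
        gal_K_commute[OF g d y] by (simp add: compose_eq)
  next
    fix z assume z: "z \<in> roots_p_power p"
    thus "compose L (lift_gal p \<delta>) (lift_gal p \<gamma>) z = z"
      using root_p_power_in_L[OF z] lift_gal_p_power g d by (simp add: compose_eq)
  qed
  hence "lift_gal p (\<gamma> \<otimes>\<^bsub>G_p p\<^esub> \<delta>) x = compose L (lift_gal p \<delta>) (lift_gal p \<gamma>) x" by (simp add: eq)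
  thus ?thesis using x by (simp add: compose_eq)
qed

lemma lift_gal_one: "x \<in> L \<Longrightarrow> lift_gal p \<one>\<^bsub>G_p p\<^esub> x = x"
proof -
  assume x: "x \<in> L"
  interpret G: group "G_p p" by (rule group_Gal[OF complex_subfield_Qcyc_prime_to])
  have "(\<lambda>x\<in>L. x) = lift_gal p \<one>\<^bsub>G_p p\<^esub>"
  proof (rule lift_gal_unique[OF G.one_closed])
    have "complex_hom L (\<lambda>x\<in>L. x)" using Qcyc_closed(1,5,6) by (simp add: complex_hom_def)
    thus "(\<lambda>x\<in>L. x) \<in> carrier (Gal L \<rat>)" by (simp add: gal_eq[OF complex_subfield_Qcyc])
  qed (use K_subset_L root_p_power_in_L in \<open>simp_all add: Gal_one\<close>)
  from this[symmetric] show ?thesis using x by simp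
qed

lemma group_action_Val: "group_action (G_p p) (Val_p p) (act_Val p)"
proof (rule group_actionI)
  show "group (G_p p)" by (rule group_Gal[OF complex_subfield_Qcyc_prime_to])
  fix g assume g: "g \<in> carrier (G_p p)"
  show "act_Val p g \<in> extensional (Val_p p)" by (simp add: act_Val_def)
  show in_V: "act_Val p g v \<in> Val_p p" if "v \<in> Val_p p" for v using act_Val_in g that by simp
  fix h v assume h: "h \<in> carrier (G_p p)" and v: "v \<in> Val_p p"
  have hv: "act_Val p h v \<in> Val_p p" using act_Val_in h v by simp
  have gh: "g \<otimes>\<^bsub>G_p p\<^esub> h \<in> carrier (G_p p)"
    using group.is_monoid[OF group_Gal[OF complex_subfield_Qcyc_prime_to]] g h by (rule monoid.m_closed)
  show "act_Val p (g \<otimes>\<^bsub>G_p p\<^esub> h) v = act_Val p g (act_Val p h v)"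
  proof (rule extensionalityI[of _ L])
    show "act_Val p (g \<otimes>\<^bsub>G_p p\<^esub> h) v \<in> extensional L" "act_Val p g (act_Val p h v) \<in> extensional L"
      using act_Val_in[OF _ v] act_Val_in[OF _ hv] gh g Val_pD(2) by simp_all
    fix x assume x: "x \<in> L"
    have gx: "lift_gal p g x \<in> L" using lift_gal_D(3) g x by simp
    show "act_Val p (g \<otimes>\<^bsub>G_p p\<^esub> h) v x = act_Val p g (act_Val p h v) x"
      using act_Val_apply[OF v x] act_Val_apply[OF hv x] act_Val_apply[OF v gx] lift_gal_mult[of g h x] g h x
      by simp
  qed
next
  fix v assume v: "v \<in> Val_p p"
  have one: "\<one>\<^bsub>G_p p\<^esub> \<in> gal K \<rat>"
    using monoid.one_closed[OF group.is_monoid[OF group_Gal[OF complex_subfield_Qcyc_prime_to]]] by simp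
  show "act_Val p \<one>\<^bsub>G_p p\<^esub> v = v"
    by (rule extensionalityI[OF Val_pD(2)[OF act_Val_in[OF one v]] Val_pD(2)[OF v]])
       (simp add: act_Val_apply[OF v] lift_gal_one)
qed

lemma act_Hom_in:
  assumes g: "\<gamma> \<in> gal K \<rat>" and b: "b \<in> Hom_Qp p"
  shows "act_Hom p \<gamma> b \<in> Hom_Qp p"
proof -
  note h = complex_homD[OF complex_subfield_Qcyc_prime_to galK(2)[OF g]]
  have "compose F b \<gamma> \<in> Ring.ring_hom (subring_of F) (Qp p)"
  proof (rule ring_hom_memI)
    show "compose F b \<gamma> \<one>\<^bsub>subring_of F\<^esub> = \<one>\<^bsub>Qp p\<^esub>"
      using b_hom(4)[OF b] F_closed(1) h(1) Q.completion_simps(4) by (simp add: compose_eq Qp_def)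
  qed (use b_hom(1-3)[OF b] gal_K_F[OF g] h(3,4) F_subset_K F_closed(5,6) in \<open>simp_all add: compose_eq\<close>)
  thus ?thesis using b by (simp add: act_Hom_def Hom_Qp_def)
qed

lemma act_Hom_apply: "b \<in> Hom_Qp p \<Longrightarrow> x \<in> F \<Longrightarrow> act_Hom p \<gamma> b x = b (\<gamma> x)"
  by (simp add: act_Hom_def compose_eq)

lemma Hom_extensional: "b \<in> Hom_Qp p \<Longrightarrow> b \<in> extensional F"
  by (simp add: Hom_Qp_def)

lemma group_action_Hom: "group_action (G_p p) (Hom_Qp p) (act_Hom p)"
proof (rule group_actionI)
  show "group (G_p p)" by (rule group_Gal[OF complex_subfield_Qcyc_prime_to])
  fix g assume g: "g \<in> carrier (G_p p)"
  show "act_Hom p g \<in> extensional (Hom_Qp p)" by (simp add: act_Hom_def)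
  show "act_Hom p g b \<in> Hom_Qp p" if "b \<in> Hom_Qp p" for b using act_Hom_in g that by simp
  fix h b assume h: "h \<in> carrier (G_p p)" and b: "b \<in> Hom_Qp p"
  have gh': "g \<otimes>\<^bsub>G_p p\<^esub> h = compose K g h" "compose K g h \<in> gal K \<rat>"
    using Gal_mult[OF complex_subfield_Qcyc_prime_to] compose_in_gal[OF complex_subfield_Qcyc_prime_to] g h by simp_all
  have hb: "act_Hom p h b \<in> Hom_Qp p" using act_Hom_in h b by simp
  show "act_Hom p (g \<otimes>\<^bsub>G_p p\<^esub> h) b = act_Hom p g (act_Hom p h b)"
  proof (rule extensionalityI[of _ F])
    show "act_Hom p (g \<otimes>\<^bsub>G_p p\<^esub> h) b \<in> extensional F" "act_Hom p g (act_Hom p h b) \<in> extensional F"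
      using act_Hom_in[OF _ b] act_Hom_in[OF _ hb] gh' g Hom_extensional by simp_all
    fix x assume x: "x \<in> F"
    have gx: "g x \<in> F" using gal_K_F g x by simp
    show "act_Hom p (g \<otimes>\<^bsub>G_p p\<^esub> h) b x = act_Hom p g (act_Hom p h b) x"
      using act_Hom_apply[OF b x] act_Hom_apply[OF hb x] act_Hom_apply[OF b gx] gal_K_commute[of g h x] g h
        F_subset_K[OF x] by (simp add: gh' compose_eq)
  qed
next
  fix b assume b: "b \<in> Hom_Qp p"
  have one: "\<one>\<^bsub>G_p p\<^esub> \<in> gal K \<rat>"
    using monoid.one_closed[OF group.is_monoid[OF group_Gal[OF complex_subfield_Qcyc_prime_to]]] by simp
  show "act_Hom p \<one>\<^bsub>G_p p\<^esub> b = b"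
    by (rule extensionalityI[OF Hom_extensional[OF act_Hom_in[OF one b]] Hom_extensional[OF b]])
       (simp add: act_Hom_apply[OF b] Gal_one F_subset_K)
qed

text \<open>The lift of \<open>\<gamma>\<close> fixes the rationals and agrees with
  \<open>\<gamma>\<close> on \<open>K\<close>. Hence the same rational sequence approximates
  \<open>\<gamma> x\<close> at \<open>v\<close> and \<open>x\<close> at the transported
  valuation.\<close>

lemma beta_equivariant:
  assumes g: "\<gamma> \<in> gal K \<rat>" and v: "v \<in> Val_p p"
  shows "\<beta>_map p (act_Val p \<gamma> v) = act_Hom p \<gamma> (\<beta>_map p v)"
proof (rule extensionalityI[of _ F])
  have gv: "act_Val p \<gamma> v \<in> Val_p p" by (rule act_Val_in[OF g v])
  show "\<beta>_map p (act_Val p \<gamma> v) \<in> extensional F" by (simp add: \<beta>_map_def)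
  show "act_Hom p \<gamma> (\<beta>_map p v) \<in> extensional F"
    by (rule Hom_extensional[OF act_Hom_in[OF g beta_in_Hom[OF v]]])
  interpret V: valued_field L v by (rule Val_pD(3)[OF v])
  interpret V': valued_field L "act_Val p \<gamma> v" by (rule Val_pD(3)[OF gv])
  fix x assume x: "x \<in> F"
  have gx: "\<gamma> x \<in> F" by (rule gal_K_F[OF g x])
  have xL: "x \<in> L" by (rule F_subset_L[OF x])
  obtain s where s: "approx v (\<gamma> x) s" using approx_exists[OF v gx] by blast
  note h = complex_homD[OF complex_subfield_Qcyc lift_gal_D(2)[OF g]]
  have rL: "of_rat r \<in> L" for r by (rule Qcyc_closed(14))
  have "act_Val p \<gamma> v (x - of_rat r) = v (\<gamma> x - of_rat r)" for r
    using act_Val_apply[OF v Qcyc_closed(7)[OF xL rL]] h(6)[OF xL rL] lift_gal_D(4)[OF g F_subset_K[OF x]]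
    by (simp add: h(14))
  hence "approx (act_Val p \<gamma> v) x s"
    using s Qcyc_closed(7)[OF xL rL] unfolding approx_def V.null_seqs_iff V'.null_seqs_iff by simp
  thus "\<beta>_map p (act_Val p \<gamma> v) x = act_Hom p \<gamma> (\<beta>_map p v) x"
    using beta_eq[OF gv x] beta_eq[OF v gx s] act_Hom_apply[OF beta_in_Hom[OF v] x] by simp
qed

text \<open>Such automorphisms fix \<open>F\<close> pointwise and therefore act trivially on
  homomorphisms. Equivariance and injectivity of the map carry this over to valuations.\<close>

lemma Fr_closed_subgroup_trivial:
  assumes g: "\<gamma> \<in> Fr_closed_subgroup p"
  shows "b \<in> Hom_Qp p \<Longrightarrow> act_Hom p \<gamma> b = b" "v \<in> Val_p p \<Longrightarrow> act_Val p \<gamma> v = v"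
proof -
  note gD = Fr_closed_subgroupD[OF g]
  show *: "act_Hom p \<gamma> b = b" if b: "b \<in> Hom_Qp p" for b
    by (rule extensionalityI[OF Hom_extensional[OF act_Hom_in[OF gD(1) b]] Hom_extensional[OF b]])
       (simp add: act_Hom_apply[OF b] gD(2))
  assume v: "v \<in> Val_p p"
  have "\<beta>_map p (act_Val p \<gamma> v) = \<beta>_map p v"
    using beta_equivariant[OF gD(1) v] *[OF beta_in_Hom[OF v]] by simp
  thus "act_Val p \<gamma> v = v" using beta_inj act_Val_in[OF gD(1) v] v by (auto dest: inj_onD)
qed

end

text \<open>The first conjunct certifies that the definite description in \<open>\<beta>_map\<close>
  denotes the inclusion determined by \<open>v\<close>. The triviality of
  \<open>Fr_closed_subgroup p\<close> on both sides lets the two actions factor through the quotient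
  of \<open>G_p p\<close> by that subgroup.\<close>

theorem proposition8p12:
  fixes p :: nat
  assumes "prime p"
  shows "(\<forall>v\<in>Val_p p. \<forall>x\<in>Fr_fixed p. \<beta>_map p v x \<in> carrier (Qp p) \<and>
            Qp_to_completion v (\<beta>_map p v x) = Qcyc_to_completion v x)
       \<and> bij_betw (\<beta>_map p) (Val_p p) (Hom_Qp p)
       \<and> group_action (G_p p) (Val_p p) (act_Val p)
       \<and> group_action (G_p p) (Hom_Qp p) (act_Hom p)
       \<and> (\<forall>\<gamma>\<in>Fr_closed_subgroup p.
            (\<forall>v\<in>Val_p p. act_Val p \<gamma> v = v) \<and> (\<forall>b\<in>Hom_Qp p. act_Hom p \<gamma> b = b))
       \<and> (\<forall>\<gamma>\<in>carrier (G_p p). \<forall>v\<in>Val_p p.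
            \<beta>_map p (act_Val p \<gamma> v) = act_Hom p \<gamma> (\<beta>_map p v))"
proof -
  interpret cyclotomic_prime p by unfold_locales (rule assms)
  have "\<beta>_map p (act_Val p \<gamma> v) = act_Hom p \<gamma> (\<beta>_map p v)"
    if "\<gamma> \<in> carrier (G_p p)" "v \<in> Val_p p" for \<gamma> v
    using beta_equivariant that by simp
  thus ?thesis
    using beta_spec beta_bij group_action_Val group_action_Hom Fr_closed_subgroup_trivial by blast
qed

end
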